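(* Let $\Theta\subset\mathbb{R}^d$ be compact, let $\{\nu_\theta\}_{\theta\in\Theta}$ be a family of probability distributions on $(0,1)$, and let $\theta^\star$ be an interior point of $\Theta$. Let $X$ be the random walk in an i.i.d. random environment with marginal law $\nu_{\theta^\star}$, with annealed law $\mathbf{P}^\star:=\mathbf{P}^{\theta^\star}$. Assume: (1) for every $\theta\in\Theta$, $\mathbb{E}^\theta|\log\rho_0|<\infty$ and $\mathbb{E}^\theta(\log\rho_0)<0$; (2) for every $\theta\in\Theta$, $\mathbb{E}^\theta(\rho_0)<1$; (3) for every $x,y\in\mathbb{N}$, the map $\theta\mapsto\phi_\theta(x,y)$ is continuous on $\Theta$; (4) for all $\theta,\theta'\in\Theta$, $\nu_\theta\neq\nu_{\theta'}$ if and only if $\theta\neq\theta'$; (5) $\inf_{\theta\in\Theta}\mathbb{E}^\theta[\log(1-\omega_0)]>-\infty$. Then for every $\theta\in\Theta$ the deterministic quantity $\ell(\theta)=\mathbf{E}^\star[\phi_\theta(\tilde Z_0,\tilde Z_1)]$ is finite and $$\frac1n\ell_n(\theta)\xrightarrow[n\to\infty]{}\ell(\theta)\quad\text{in }\mathbf{P}^\star\text{-probability},$$ and this convergence is locally uniform in $\theta$ in the following sense: for every nonempty open subset $U\subset\Theta$, $$\frac1n\sum_{x=0}^{n-1}\sup_{\theta\in U}\phi_\theta(L_{x+1}^n,L_x^n)\xrightarrow[n\to\infty]{}\mathbf{E}^\star\Big(\sup_{\theta\in U}\phi_\theta(\tilde Z_0,\tilde Z_1)\Big)\quad\text{in }\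mathbf{P}^\star\text{-probability}.$$
   Context: $\mathbb{N}=\{0,1,2,\dots\}$. For $\theta\in\Theta$, $\mathbb{P}^\theta=\nu_\theta^{\otimes\mathbb{Z}}$ is the law on $(0,1)^{\mathbb{Z}}$ of an i.i.d. environment $\omega=\{\omega_x\}_{x\in\mathbb{Z}}$ with marginal $\nu_\theta$, with expectation $\mathbb{E}^\theta$, and $\rho_x=(1-\omega_x)/\omega_x$. Given $\omega$, under the quenched law $P_\omega$, $X=\{X_t\}_{t\in\mathbb{N}}$ is the Markov chain on $\mathbb{Z}$ with $X_0=0$ that jumps from $x$ to $x+1$ with probability $\omega_x$ and to $x-1$ with probability $1-\omega_x$. The annealed law is $\mathbf{P}^\theta(\cdot)=\int P_\omega(\cdot)\,d\mathbb{P}^\theta(\omega)$. For $n\ge1$, $T_n=\inf\{t\in\mathbb{N}: X_t=n\}$ (a.s. finite under (1)), and for $x\in\mathbb{Z}$, $L_x^n=\sum_{s=0}^{T_n-1}\mathbf{1}\{X_s=x,\ X_{s+1}=x-1\}$. For $x,y\in\mathbb{N}$, $$\phi_\theta(x,y)=\log\int_0^1 a^{x+1}(1-a)^y\,d\nu_\theta(a),\qquad \ell_n(\theta)=\sum_{x=0}^{n-1}\phi_\theta(L_{x+1}^n,L_x^n).$$ Let $Q_\theta(x,y)=\binom{x+y}{x}e^{\phi_\theta(x,y)}$, $x,y\in\mathbb{N}$; this is a Markov transition kernel on $\mathbb{N}$. Under (1) the kernel $Q_{\theta^\star}$ has a unique invariant probability measure $\pi^\star$, given by $\pi^\star(k)=\mathbb{E}^{\theta^\star}[S(1-S)^k]$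 with $S=(1+\rho_1+\rho_1\rho_2+\rho_1\rho_2\rho_3+\cdots)^{-1}$. $\{\tilde Z_n\}_{n\in\mathbb{N}}$ denotes the stationary Markov chain with transition kernel $Q_{\theta^\star}$ and initial distribution $\pi^\star$; $\mathbf{E}^\star$ denotes the corresponding expectation. *)

theory Defs
  imports "HOL-Probability.Probability"
begin

section \<open>Laws of Markov chains on countable state spaces\<close>

abbreviation path_space :: "(nat \<Rightarrow> 's) measure" where
  "path_space \<equiv> PiM UNIV (\<lambda>_. count_space UNIV)"

text \<open>
  The law on path space of the Markov chain with initial distribution \<open>\<mu>\<close> and transition kernel
  \<open>K\<close>. Existence and uniqueness are lemma \<open>ex1_markov_law\<close> below.
\<close>

definition is_markov_law :: "'s pmf \<Rightarrow> ('s \<Rightarrow> 's pmf) \<Rightarrow> (nat \<Rightarrow> 's) measure \<Rightarrow> bool" where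
  "is_markov_law \<mu> K P \<longleftrightarrow>
     prob_space P \<and> sets P = sets path_space \<and>
     (\<forall>n x. measure P {X. \<forall>i\<le>n. X i = x i} = pmf \<mu> (x 0) * (\<Prod>i<n. pmf (K (x i)) (x (Suc i))))"

definition markov_law :: "'s::countable pmf \<Rightarrow> ('s \<Rightarrow> 's pmf) \<Rightarrow> (nat \<Rightarrow> 's) measure" where
  "markov_law \<mu> K = (THE P. is_markov_law \<mu> K P)"

definition cylinders :: "(nat \<Rightarrow> 's) set set" where
  "cylinders = insert {} (insert UNIV {{X. \<forall>i\<le>n. X i = x i} | n x. True})"

lemma cylinder_sets: "{X. \<forall>i\<le>n. X i = x i} \<in> sets path_space"
proof -
  have "{X \<in> space path_space. \<forall>i\<le>n. X i = x i} \<in> sets path_space"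
    by measurable
  then show ?thesis by (simp add: space_PiM)
qed

lemma Int_stable_cylinders: "Int_stable (cylinders :: (nat \<Rightarrow> 's) set set)"
proof (rule Int_stableI)
  have *: "{X. \<forall>i\<le>n. X i = x i} \<inter> {X. \<forall>i\<le>m. X i = y i} \<in> cylinders" if "n \<le> m" for n m and x y :: "nat \<Rightarrow> 's"
  proof (cases "\<forall>i\<le>n. x i = y i")
    case True
    then have "{X. \<forall>i\<le>n. X i = x i} \<inter> {X. \<forall>i\<le>m. X i = y i} = {X. \<forall>i\<le>m. X i = y i}"
      using that by auto
    then show ?thesis by (auto simp: cylinders_def)
  next
    case False
    then have "{X. \<forall>i\<le>n. X i = x i} \<inter> {X. \<forall>i\<le>m. X i = y i} = {}"
      using that by fastforce
    then show ?thesis by (simp add: cylinders_def)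
  qed
  fix A B :: "(nat \<Rightarrow> 's) set" assume A: "A \<in> cylinders" and B: "B \<in> cylinders"
  show "A \<inter> B \<in> cylinders"
  proof (cases "A = {} \<or> A = UNIV \<or> B = {} \<or> B = UNIV")
    case True
    then have "A \<inter> B = {} \<or> A \<inter> B = A \<or> A \<inter> B = B" by auto
    then show ?thesis using A B by (elim disjE) (simp_all add: cylinders_def)
  next
    case False
    with A obtain n x where A': "A = {X. \<forall>i\<le>n. X i = x i}" by (auto simp: cylinders_def)
    from False B obtain m y where B': "B = {X. \<forall>i\<le>m. X i = y i}" by (auto simp: cylinders_def)
    show ?thesis
      using *[of n m x y] *[of m n y x] unfolding A' B' by (metis Int_commute linear)
  qed
qed

lemma sets_path_space: "sets (path_space :: (nat \<Rightarrow> 's::countable) measure) = sigma_sets UNIV cylinders"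
proof (rule antisym)
  show "sigma_sets UNIV cylinders \<subseteq> sets (path_space :: (nat \<Rightarrow> 's) measure)"
    using cylinder_sets sets.top[of "path_space :: (nat \<Rightarrow> 's) measure"]
    by (intro sets.sigma_sets_subset') (auto simp: cylinders_def space_PiM)
  interpret sigma_algebra UNIV "sigma_sets UNIV (cylinders :: (nat \<Rightarrow> 's) set set)"
    by (rule sigma_algebra_sigma_sets) simp
  have *: "{f. f i \<in> A} \<in> sigma_sets UNIV cylinders" for i and A :: "'s set"
  proof -
    define L where "L = {xs :: 's list. length xs = Suc i \<and> xs ! i \<in> A}"
    have eq: "{f. f i \<in> A} = (\<Union>xs\<in>L. {X. \<forall>j\<le>i. X j = xs ! j})"
    proof (intro set_eqI iffI)
      fix f assume "f \<in> {f. f i \<in> A}"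
      then have "map f [0..<Suc i] \<in> L"
        by (auto simp: L_def nth_append)
      moreover have "\<forall>j\<le>i. f j = map f [0..<Suc i] ! j"
      proof (intro allI impI)
        fix j assume "j \<le> i"
        then show "f j = map f [0..<Suc i] ! j"
          by (subst nth_map) (auto simp del: upt_Suc)
      qed
      ultimately show "f \<in> (\<Union>xs\<in>L. {X. \<forall>j\<le>i. X j = xs ! j})" by blast
    qed (auto simp: L_def)
    show ?thesis unfolding eq
      by (rule countable_UN') (auto intro!: sigma_sets.Basic simp: cylinders_def)
  qed
  show "sets (path_space :: (nat \<Rightarrow> 's) measure) \<subseteq> sigma_sets UNIV cylinders"
    unfolding sets_PiM_single using * by (simp, intro sigma_sets_mono) auto
qed

lemma is_markov_law_unique:
  fixes \<mu> :: "'s::countable pmf"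
  assumes "is_markov_law \<mu> K P" "is_markov_law \<mu> K Q"
  shows "P = Q"
proof -
  interpret P: prob_space P using assms by (simp add: is_markov_law_def)
  interpret Q: prob_space Q using assms by (simp add: is_markov_law_def)
  have sets: "sets P = sigma_sets UNIV cylinders" "sets Q = sigma_sets UNIV cylinders"
    using assms by (auto simp: is_markov_law_def sets_path_space)
  have sp: "space P = UNIV" "space Q = UNIV"
    using sets sets_eq_imp_space_eq[of P path_space] sets_eq_imp_space_eq[of Q path_space]
    by (auto simp: sets_path_space space_PiM)
  show ?thesis
  proof (rule measure_eqI_generator_eq[OF Int_stable_cylinders, where \<Omega>=UNIV and A="\<lambda>_. UNIV"])
    fix A :: "(nat \<Rightarrow> 's) set" assume "A \<in> cylinders"
    then show "emeasure P A = emeasure Q A"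
      using assms P.emeasure_space_1 Q.emeasure_space_1
      by (auto simp: cylinders_def is_markov_law_def P.emeasure_eq_measure Q.emeasure_eq_measure sp)
  qed (use sets in \<open>auto simp: cylinders_def\<close>)
qed

lemma is_markov_law_exists:
  fixes \<mu> :: "'s::countable pmf"
  shows "\<exists>P. is_markov_law \<mu> K P"
proof -
  define p where "p t x = (case t of 0 \<Rightarrow> \<mu> | Suc s \<Rightarrow> K (x s))" for t :: nat and x :: "nat \<Rightarrow> 's"
  let ?M = "\<lambda>_::nat. count_space (UNIV :: 's set)"
  have p_meas: "(\<lambda>x. measure_pmf (p t x)) \<in> measurable (PiM {0..<t} ?M) (subprob_algebra (count_space UNIV))" for t
  proof (cases t)
    case (Suc s)
    have "(\<lambda>x. x s) \<in> measurable (PiM {0..<t} ?M) (count_space UNIV)"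
      using Suc by (intro measurable_component_singleton) auto
    then have "(\<lambda>x. measure_pmf (K (x s))) \<in> measurable (PiM {0..<t} ?M) (subprob_algebra (count_space UNIV))"
      by (rule measurable_compose) (auto simp: measure_pmf_in_subprob_algebra)
    then show ?thesis by (simp add: p_def Suc)
  qed (simp add: p_def measure_pmf_in_subprob_algebra)
  interpret IT: Ionescu_Tulcea "\<lambda>t x. measure_pmf (p t x)" ?M
    using p_meas by unfold_locales (auto intro: measure_pmf.prob_space_axioms)
  let ?u = "\<lambda>_. undefined :: 's"
  have u: "?u \<in> space (PiM {0..<0} ?M)" by (simp add: space_PiM)
  have sing: "{restrict x {0..<n}} \<in> sets (PiM {0..<n} ?M)" for x n
  proof -
    have "{restrict x {0..<n}} = (\<Pi>\<^sub>E i\<in>{0..<n}. {x i})"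
      by (auto simp: PiE_iff extensional_def restrict_def fun_eq_iff)
    then show ?thesis by (auto intro!: sets_PiM_I_finite)
  qed
  have C: "emeasure (IT.C 0 n ?u) {restrict x {0..<n}} = ennreal (\<Prod>i<n. pmf (p i x) (x i))" for n x
  proof (induction n)
    case 0
    have "restrict x {0..<0} = ?u" by (auto simp: restrict_def)
    then show ?case using sing[of x 0] by (simp add: emeasure_return)
  next
    case (Suc n)
    note [measurable] = sing
    have eP: "emeasure (IT.eP n w) {restrict x {0..<Suc n}}
        = ennreal (pmf (p n x) (x n)) * indicator {restrict x {0..<n}} w"
      if w: "w \<in> space (PiM {0..<n} ?M)" for w
    proof (cases "w = restrict x {0..<n}")
      case True
      have "{y. fun_upd w n y = restrict x {0..<Suc n}} = {x n}"
        unfolding True by (auto simp: fun_eq_iff restrict_def split: if_splits)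
      moreover have "p n w = p n x" using True by (auto simp: p_def split: nat.split)
      ultimately show ?thesis
        using True w by (subst IT.emeasure_eP) (auto simp: vimage_def emeasure_pmf_single)
    next
      case False
      have "{y. fun_upd w n y = restrict x {0..<Suc n}} = {}"
      proof (rule ccontr)
        assume "\<not> ?thesis"
        then obtain y where y: "fun_upd w n y = restrict x {0..<Suc n}" by auto
        have "w i = restrict x {0..<n} i" for i
        proof (cases "i < n")
          case True then show ?thesis using fun_cong[OF y, of i] by auto
        next
          case nl: False
          then show ?thesis using w by (auto simp: space_PiM PiE_iff extensional_def)
        qed
        then show False using False by auto
      qed
      then show ?thesis
        using False w by (subst IT.emeasure_eP) (auto simp: vimage_def)
    qed
    have "emeasure (IT.C 0 (Suc n) ?u) {restrict x {0..<Suc n}}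
        = (\<integral>\<^sup>+w. emeasure (IT.eP n w) {restrict x {0..<Suc n}} \<partial>IT.C 0 n ?u)"
      using IT.measurable_eP[of n] IT.space_C[OF u, of n]
      by (simp, subst emeasure_bind[where N="PiM {0..<Suc n} ?M"])
         (use IT.prob_space_C[OF u, of n] IT.sets_C[OF u, of n] sing in
           \<open>auto simp: prob_space.not_empty simp del: IT.C.simps cong: measurable_cong_sets\<close>)
    also have "\<dots> = (\<integral>\<^sup>+w. ennreal (pmf (p n x) (x n)) * indicator {restrict x {0..<n}} w \<partial>IT.C 0 n ?u)"
      using IT.space_C[OF u, of n] by (intro nn_integral_cong eP) auto
    also have "\<dots> = ennreal (pmf (p n x) (x n)) * emeasure (IT.C 0 n ?u) {restrict x {0..<n}}"
      using IT.sets_C[OF u, of n] sing[of x n] by (subst nn_integral_cmult_indicator) auto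
    finally show ?case
      unfolding Suc.IH prod.lessThan_Suc
      by (simp only: ennreal_mult'[symmetric] pmf_nonneg mult.commute)
  qed
  define P where "P = IT.PF.lim"
  interpret P: prob_space P
  proof
    show "emeasure P (space P) = 1"
    proof -
      have "emeasure P (prod_emb UNIV ?M {} (space (PiM {} ?M))) = emeasure (IT.CI {}) (space (PiM {} ?M))"
        unfolding P_def by (rule IT.lim) auto
      moreover have "prod_emb UNIV ?M {} (space (PiM {} ?M)) = space P"
        by (auto simp: prod_emb_def P_def space_PiM)
      moreover have "emeasure (IT.CI {}) (space (PiM {} ?M)) = 1"
        using prob_space.emeasure_space_1[OF IT.PF.prob_space_P[of "{}"]] IT.PF.space_P[of "{}"] by simp
      ultimately show ?thesis by simp
    qed
  qed
  have setsP: "sets P = sets path_space" by (simp add: P_def)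
  have "measure P {X. \<forall>i\<le>n. X i = x i} = pmf \<mu> (x 0) * (\<Prod>i<n. pmf (K (x i)) (x (Suc i)))" for n x
  proof -
    have cyl: "{X. \<forall>i\<le>n. X i = x i} = prod_emb UNIV ?M {0..<Suc n} {restrict x {0..<Suc n}}"
      by (auto simp: prod_emb_def restrict_def fun_eq_iff less_Suc_eq_le split: if_splits)
    have "emeasure P {X. \<forall>i\<le>n. X i = x i} = emeasure (IT.CI {0..<Suc n}) {restrict x {0..<Suc n}}"
      unfolding cyl P_def by (rule IT.lim) (auto intro: sing)
    also have "\<dots> = emeasure (IT.C 0 (Suc n) ?u) (prod_emb {0..<Suc n} ?M {0..<Suc n} {restrict x {0..<Suc n}})"
      by (rule IT.emeasure_CI) (auto intro: sing)
    also have "prod_emb {0..<Suc n} ?M {0..<Suc n} {restrict x {0..<Suc n}} = {restrict x {0..<Suc n}}"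
      by (rule prod_emb_id) auto
    also have "emeasure (IT.C 0 (Suc n) ?u) \<dots> = ennreal (\<Prod>i<Suc n. pmf (p i x) (x i))" by (rule C)
    also have "(\<Prod>i<Suc n. pmf (p i x) (x i)) = pmf \<mu> (x 0) * (\<Prod>i<n. pmf (K (x i)) (x (Suc i)))"
      unfolding prod.lessThan_Suc_shift by (simp add: p_def)
    finally show ?thesis by (simp add: measure_def prod_nonneg)
  qed
  with setsP have "is_markov_law \<mu> K P"
    using P.prob_space_axioms by (simp add: is_markov_law_def)
  then show ?thesis ..
qed

lemma ex1_markov_law: "\<exists>!P. is_markov_law \<mu> K P"
  for \<mu> :: "'s::countable pmf"
  using is_markov_law_exists is_markov_law_unique by blast

lemma is_markov_law_markov_law: "is_markov_law \<mu> K (markov_law \<mu> K)"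
  unfolding markov_law_def by (rule theI'[OF ex1_markov_law])

lemma prob_space_markov_law: "prob_space (markov_law \<mu> K)"
  and sets_markov_law [simp, measurable_cong]: "sets (markov_law \<mu> K) = sets path_space"
  and measure_markov_law_cylinder:
    "measure (markov_law \<mu> K) {X. \<forall>i\<le>n. X i = x i} = pmf \<mu> (x 0) * (\<Prod>i<n. pmf (K (x i)) (x (Suc i)))"
  using is_markov_law_markov_law[of \<mu> K] by (auto simp: is_markov_law_def)

lemma space_markov_law [simp]: "space (markov_law \<mu> K) = UNIV"
  using sets_eq_imp_space_eq[OF sets_markov_law, of \<mu> K] by (simp add: space_PiM)

section \<open>Random walk in random environment\<close>

abbreviation unit_borel :: "real measure" where
  "unit_borel \<equiv> restrict_space borel {0<..<1}"

abbreviation env_space :: "(int \<Rightarrow> real) measure" where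
  "env_space \<equiv> PiM UNIV (\<lambda>_. unit_borel)"

definition env_law :: "real measure \<Rightarrow> (int \<Rightarrow> real) measure" where
  "env_law \<nu> = PiM UNIV (\<lambda>_. \<nu>)"

definition rho :: "(int \<Rightarrow> real) \<Rightarrow> int \<Rightarrow> real" where
  "rho w x = (1 - w x) / w x"

definition walk_kernel :: "(int \<Rightarrow> real) \<Rightarrow> int \<Rightarrow> int pmf" where
  "walk_kernel w x = map_pmf (\<lambda>right. if right then x + 1 else x - 1) (bernoulli_pmf (w x))"

definition quenched_law :: "(int \<Rightarrow> real) \<Rightarrow> (nat \<Rightarrow> int) measure" where
  "quenched_law w = markov_law (return_pmf 0) (walk_kernel w)"

definition annealed_law :: "real measure \<Rightarrow> (nat \<Rightarrow> int) measure" where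
  "annealed_law \<nu> = env_law \<nu> \<bind> quenched_law"

lemma pmf_walk_kernel:
  assumes "0 \<le> w x" "w x \<le> 1"
  shows "pmf (walk_kernel w x) y = (if y = x + 1 then w x else if y = x - 1 then 1 - w x else 0)"
proof -
  have "(\<lambda>right. if right then x + 1 else x - 1) -` {y} =
      (if y = x + 1 then {True} else if y = x - 1 then {False} else {})"
    by (auto split: if_splits)
  then show ?thesis
    using assms by (auto simp: walk_kernel_def pmf_map measure_pmf_single)
qed

lemma space_env_space: "w \<in> space env_space \<longleftrightarrow> (\<forall>x. 0 < w x \<and> w x < 1)"
  by (auto simp: space_PiM space_restrict_space PiE_iff)

lemma measurable_quenched_law [measurable]: "quenched_law \<in> env_space \<rightarrow>\<^sub>M prob_algebra path_space"
proof (rule measurable_prob_algebra_generated[OF sets_path_space Int_stable_cylinders])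
  fix A :: "(nat \<Rightarrow> int) set" assume A: "A \<in> cylinders"
  have pmf_meas: "(\<lambda>w. pmf (walk_kernel w x) y) \<in> borel_measurable env_space" for x y
  proof -
    have [measurable]: "(\<lambda>w. w x) \<in> borel_measurable env_space"
      by (rule measurable_compose[OF measurable_component_singleton]) 
         (auto intro: measurable_restrict_space1)
    have "(\<lambda>w. pmf (walk_kernel w x) y) \<in> borel_measurable env_space \<longleftrightarrow>
      (\<lambda>w. if y = x + 1 then w x else if y = x - 1 then 1 - w x else 0) \<in> borel_measurable env_space"
      by (intro measurable_cong pmf_walk_kernel) (auto simp: space_env_space less_imp_le)
    then show ?thesis by simp
  qed
  have eq: "emeasure (quenched_law w) B = ennreal (measure (quenched_law w) B)" for w B
    unfolding quenched_law_def
    by (intro finite_measure.emeasure_eq_measure prob_space.finite_measure prob_space_markov_law)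
  have UNIV: "emeasure (quenched_law w) UNIV = 1" for w
    using prob_space.emeasure_space_1[OF prob_space_markov_law] by (simp add: quenched_law_def)
  from A consider "A = {}" | "A = UNIV" | n x where "A = {X. \<forall>i\<le>n. X i = x i}"
    by (auto simp: cylinders_def)
  then show "(\<lambda>w. emeasure (quenched_law w) A) \<in> borel_measurable env_space"
  proof cases
    case 3
    have *: "emeasure (quenched_law w) A
        = ennreal (pmf (return_pmf 0) (x 0) * (\<Prod>i<n. pmf (walk_kernel w (x i)) (x (Suc i))))" for w
      unfolding 3 eq by (simp add: quenched_law_def measure_markov_law_cylinder)
    show ?thesis unfolding * using pmf_meas by measurable
  qed (simp_all add: UNIV)
qed (auto simp: quenched_law_def prob_space_markov_law)

lemma env_law_in_prob_algebra:
  assumes "\<nu> \<in> space (prob_algebra unit_borel)"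
  shows "env_law \<nu> \<in> space (prob_algebra env_space)"
  using assms unfolding env_law_def space_prob_algebra
  by (auto intro!: prob_space_PiM sets_PiM_cong)

lemma prob_space_annealed_law:
  assumes "\<nu> \<in> space (prob_algebra unit_borel)"
  shows "prob_space (annealed_law \<nu>)"
  unfolding annealed_law_def
  by (rule prob_space_bind'[OF env_law_in_prob_algebra[OF assms] measurable_quenched_law])

lemma sets_annealed_law:
  assumes "\<nu> \<in> space (prob_algebra unit_borel)"
  shows "sets (annealed_law \<nu>) = sets path_space"
  unfolding annealed_law_def
  by (rule sets_bind'[OF env_law_in_prob_algebra[OF assms] measurable_quenched_law])

lemma emeasure_annealed_law:
  assumes "\<nu> \<in> space (prob_algebra unit_borel)" and "A \<in> sets path_space"
  shows "emeasure (annealed_law \<nu>) A = (\<integral>\<^sup>+w. emeasure (quenched_law w) A \<partial>env_law \<nu>)"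
  unfolding annealed_law_def
  by (rule emeasure_bind_prob_algebra[OF env_law_in_prob_algebra[OF assms(1)] measurable_quenched_law assms(2)])


section \<open>The criterion function\<close>

text \<open>
  \<open>Inf\<close> on \<open>nat\<close> gives the value 0 on the paths that never reach \<open>n\<close>; under the hypotheses of the
  theorem these form a null set of the annealed law.
\<close>

definition hitting_time :: "nat \<Rightarrow> (nat \<Rightarrow> int) \<Rightarrow> nat" where
  "hitting_time n X = Inf {t. X t = int n}"

definition left_steps :: "nat \<Rightarrow> (nat \<Rightarrow> int) \<Rightarrow> int \<Rightarrow> nat" where
  "left_steps n X x = (\<Sum>s<hitting_time n X. if X s = x \<and> X (Suc s) = x - 1 then 1 else 0)"

definition phi :: "real measure \<Rightarrow> nat \<Rightarrow> nat \<Rightarrow> real" where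
  "phi \<nu> x y = ln (\<integral>a. a ^ (x + 1) * (1 - a) ^ y \<partial>\<nu>)"

definition criterion :: "nat \<Rightarrow> real measure \<Rightarrow> (nat \<Rightarrow> int) \<Rightarrow> real" where
  "criterion n \<nu> X = (\<Sum>x<n. phi \<nu> (left_steps n X (int x + 1)) (left_steps n X (int x)))"

lemma measurable_left_steps [measurable]:
  "(\<lambda>X. left_steps n X x) \<in> path_space \<rightarrow>\<^sub>M count_space UNIV"
  unfolding left_steps_def hitting_time_def Inf_nat_def by measurable

lemma measurable_fun_left_steps [measurable]:
  "(\<lambda>X. g (left_steps n X x) (left_steps n X y)) \<in> borel_measurable path_space"
  for g :: "nat \<Rightarrow> nat \<Rightarrow> real"
proof -
  have "(\<lambda>X. (left_steps n X x, left_steps n X y)) \<in> path_space \<rightarrow>\<^sub>M count_space UNIV \<Otimes>\<^sub>M count_space UNIV"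
    by measurable
  then have "(\<lambda>X. (left_steps n X x, left_steps n X y)) \<in> path_space \<rightarrow>\<^sub>M count_space UNIV"
    by (simp add: pair_measure_countable)
  then have "(\<lambda>X. case_prod g (left_steps n X x, left_steps n X y)) \<in> borel_measurable path_space"
    by (rule measurable_compose) simp
  then show ?thesis by simp
qed

lemma measurable_criterion [measurable]: "criterion n \<nu> \<in> borel_measurable path_space"
  unfolding criterion_def[abs_def] by (intro borel_measurable_sum measurable_fun_left_steps)

lemma phi_integral_bounds:
  assumes "\<nu> \<in> space (prob_algebra unit_borel)"
  shows "integrable \<nu> (\<lambda>a. a ^ (x + 1) * (1 - a) ^ y)"
    and "0 < (\<integral>a. a ^ (x + 1) * (1 - a) ^ y \<partial>\<nu>)"
    and "(\<integral>a. a ^ (x + 1) * (1 - a) ^ y \<partial>\<nu>) \<le> 1"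
proof -
  interpret prob_space \<nu> using assms by (simp add: space_prob_algebra)
  have sets [measurable_cong]: "sets \<nu> = sets unit_borel" using assms by (simp add: space_prob_algebra)
  have sp: "space \<nu> = {0<..<1}" using sets_eq_imp_space_eq[OF sets] by (simp add: space_restrict_space)
  have bd: "0 < a ^ (x + 1) * (1 - a) ^ y" "a ^ (x + 1) * (1 - a) ^ y \<le> 1" if "a \<in> space \<nu>" for a
    using that by (auto simp: sp intro!: mult_pos_pos zero_less_power mult_le_one power_le_one mult_nonneg_nonneg)
  have "(\<lambda>a. a ^ (x + 1) * (1 - a) ^ y) \<in> borel_measurable unit_borel"
    by (rule measurable_restrict_space1) measurable
  then have m: "(\<lambda>a. a ^ (x + 1) * (1 - a) ^ y) \<in> borel_measurable \<nu>"
    by (simp cong: measurable_cong_sets add: measurable_cong_sets[OF sets refl])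
  show i: "integrable \<nu> (\<lambda>a. a ^ (x + 1) * (1 - a) ^ y)"
    using bd m by (intro integrable_const_bound[where B=1] AE_I2) (auto simp: less_imp_le abs_of_pos)
  show "0 < (\<integral>a. a ^ (x + 1) * (1 - a) ^ y \<partial>\<nu>)"
  proof -
    have "(\<integral>a. 0 \<partial>\<nu>) < (\<integral>a. a ^ (x + 1) * (1 - a) ^ y \<partial>\<nu>)"
      using i bd by (intro integral_less_AE_space) (auto simp: emeasure_space_1)
    then show ?thesis by simp
  qed
  show "(\<integral>a. a ^ (x + 1) * (1 - a) ^ y \<partial>\<nu>) \<le> 1"
    using bd by (intro integral_le_const i AE_I2) auto
qed

lemma phi_nonpos: "\<nu> \<in> space (prob_algebra unit_borel) \<Longrightarrow> phi \<nu> x y \<le> 0"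
  unfolding phi_def using phi_integral_bounds[of \<nu> x y] by simp

lemma bdd_above_phi:
  "(\<And>t. t \<in> U \<Longrightarrow> \<nu> t \<in> space (prob_algebra unit_borel)) \<Longrightarrow> bdd_above ((\<lambda>t. phi (\<nu> t) x y) ` U)"
  by (intro bdd_aboveI[where M=0]) (auto intro: phi_nonpos)


section \<open>The stationary chain\<close>

text \<open>
  That the two uses of \<open>embed_pmf\<close> below give the stated mass functions is shown in lemmas
  \<open>pmf_Q_kernel\<close> and \<open>pmf_pi_star\<close>. The series is taken in \<open>ennreal\<close>, so that it is defined for every environment and
  \<open>env_S w = 0\<close> exactly if it diverges.
\<close>

definition env_S :: "(int \<Rightarrow> real) \<Rightarrow> real" where
  "env_S w = enn2real (inverse (\<Sum>n. \<Prod>k=1..n. ennreal (rho w (int k))))"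

definition Q_kernel :: "real measure \<Rightarrow> nat \<Rightarrow> nat pmf" where
  "Q_kernel \<nu> x = embed_pmf (\<lambda>y. real ((x + y) choose x) * exp (phi \<nu> x y))"

definition pi_star :: "real measure \<Rightarrow> nat pmf" where
  "pi_star \<nu> = embed_pmf (\<lambda>k. \<integral>w. env_S w * (1 - env_S w) ^ k \<partial>env_law \<nu>)"

definition stationary_law :: "real measure \<Rightarrow> (nat \<Rightarrow> nat) measure" where
  "stationary_law \<nu> = markov_law (pi_star \<nu>) (Q_kernel \<nu>)"

lemma pmf_Q_kernel:
  assumes "\<nu> \<in> space (prob_algebra unit_borel)"
  shows "pmf (Q_kernel \<nu> x) y = real ((x + y) choose x) * exp (phi \<nu> x y)"
  unfolding Q_kernel_def
proof (rule pmf_embed_pmf)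
  interpret prob_space \<nu> using assms by (simp add: space_prob_algebra)
  have sets [measurable_cong]: "sets \<nu> = sets unit_borel" using assms by (simp add: space_prob_algebra)
  have sp: "space \<nu> = {0<..<1}" using sets_eq_imp_space_eq[OF sets] by (simp add: space_restrict_space)
  have e: "ennreal (real ((x + y) choose x) * exp (phi \<nu> x y)) =
      (\<integral>\<^sup>+a. ennreal (pmf (neg_binomial_pmf (x + 1) a) y) \<partial>\<nu>)" for y
  proof -
    note b = phi_integral_bounds[OF assms, of x y]
    have "real ((x + y) choose x) * exp (phi \<nu> x y) =
        (\<integral>a. real ((x + y) choose x) * (a ^ (x + 1) * (1 - a) ^ y) \<partial>\<nu>)"
      unfolding phi_def using b by simp
    also have "ennreal \<dots> = (\<integral>\<^sup>+a. ennreal (real ((x + y) choose x) * (a ^ (x + 1) * (1 - a) ^ y)) \<partial>\<nu>)"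
      using b(1) by (intro nn_integral_eq_integral[symmetric] AE_I2) (auto simp: sp)
    also have "\<dots> = (\<integral>\<^sup>+a. ennreal (pmf (neg_binomial_pmf (x + 1) a) y) \<partial>\<nu>)"
    proof (intro nn_integral_cong)
      fix a assume "a \<in> space \<nu>"
      then have "pmf (neg_binomial_pmf (x + 1) a) y = real ((y + x) choose y) * a ^ (x + 1) * (1 - a) ^ y"
        by (subst pmf_neg_binomial) (auto simp: sp)
      also have "(y + x) choose y = (x + y) choose x"
        using binomial_symmetric[of y "y + x"] by (simp add: add.commute)
      finally show "ennreal (real ((x + y) choose x) * (a ^ (x + 1) * (1 - a) ^ y))
          = ennreal (pmf (neg_binomial_pmf (x + 1) a) y)" by (simp add: mult.assoc)
    qed
    finally show ?thesis .
  qed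
  have m: "(\<lambda>a. ennreal (pmf (neg_binomial_pmf (x + 1) a) y)) \<in> borel_measurable \<nu>" for y
  proof -
    have "(\<lambda>a. ennreal (pmf (neg_binomial_pmf (x + 1) a) y)) \<in> borel_measurable \<nu> \<longleftrightarrow>
      (\<lambda>a. ennreal (real ((y + (x + 1) - 1) choose y) * a ^ (x + 1) * (1 - a) ^ y)) \<in> borel_measurable \<nu>"
      by (intro measurable_cong) (subst pmf_neg_binomial, auto simp: sp)
    also have "\<dots> \<longleftrightarrow> (\<lambda>a. ennreal (real ((y + (x + 1) - 1) choose y) * a ^ (x + 1) * (1 - a) ^ y)) \<in> borel_measurable unit_borel"
      by (rule measurable_cong_sets[OF sets refl, THEN arg_cong])
    also have \<dots> by (rule measurable_restrict_space1) measurable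
    finally show ?thesis .
  qed
  have "(\<integral>\<^sup>+y. ennreal (real ((x + y) choose x) * exp (phi \<nu> x y)) \<partial>count_space UNIV)
      = (\<Sum>y. \<integral>\<^sup>+a. ennreal (pmf (neg_binomial_pmf (x + 1) a) y) \<partial>\<nu>)"
    unfolding e by (rule nn_integral_count_space_nat)
  also have "\<dots> = (\<integral>\<^sup>+a. (\<Sum>y. ennreal (pmf (neg_binomial_pmf (x + 1) a) y)) \<partial>\<nu>)"
    using m by (intro nn_integral_suminf[symmetric])
  also have "\<dots> = (\<integral>\<^sup>+a. 1 \<partial>\<nu>)"
    by (simp add: nn_integral_count_space_nat[symmetric] nn_integral_pmf_eq_1)
  finally show "(\<integral>\<^sup>+y. ennreal (real ((x + y) choose x) * exp (phi \<nu> x y)) \<partial>count_space UNIV) = 1"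
    by (simp add: emeasure_space_1)
qed simp

lemma env_law_rho_product:
  assumes "\<nu> \<in> space (prob_algebra unit_borel)"
  shows "(\<integral>\<^sup>+w. (\<Prod>k=1..n. ennreal (rho w (int k))) \<partial>env_law \<nu>) = (\<integral>\<^sup>+w. ennreal (rho w 0) \<partial>env_law \<nu>) ^ n"
proof -
  interpret nu: prob_space \<nu> using assms by (simp add: space_prob_algebra)
  interpret PP: product_prob_space "\<lambda>_::int. \<nu>" UNIV ..
  have sets [measurable_cong]: "sets \<nu> = sets unit_borel" using assms by (simp add: space_prob_algebra)
  have "(\<lambda>a::real. ennreal ((1 - a) / a)) \<in> borel_measurable unit_borel"
    by (rule measurable_restrict_space1) measurable
  then have m [measurable]: "(\<lambda>a. ennreal ((1 - a) / a)) \<in> borel_measurable \<nu>"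
    unfolding measurable_cong_sets[OF sets refl] .
  have fin: "(\<integral>\<^sup>+w. (\<Prod>k\<in>J. ennreal ((1 - w k) / w k)) \<partial>env_law \<nu>) = (\<integral>\<^sup>+a. ennreal ((1 - a) / a) \<partial>\<nu>) ^ card J"
    if J: "finite J" for J :: "int set"
  proof -
    have "(\<integral>\<^sup>+a. ennreal ((1 - a) / a) \<partial>\<nu>) ^ card J
        = (\<integral>\<^sup>+w. (\<Prod>k\<in>J. ennreal ((1 - w k) / w k)) \<partial>PiM J (\<lambda>_. \<nu>))"
      unfolding PP.product_nn_integral_prod[where f="\<lambda>_ a. ennreal ((1 - a) / a)", OF J m] by (simp only: prod_constant)
    also have "\<dots> = (\<integral>\<^sup>+w. (\<Prod>k\<in>J. ennreal ((1 - w k) / w k)) \<partial>distr (PiM UNIV (\<lambda>_. \<nu>)) (PiM J (\<lambda>_. \<nu>)) (\<lambda>x. restrict x J))"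
      unfolding PP.distr_PiM_restrict_finite[OF J subset_UNIV] ..
    also have "\<dots> = (\<integral>\<^sup>+w. (\<Prod>k\<in>J. ennreal ((1 - restrict w J k) / restrict w J k)) \<partial>env_law \<nu>)"
      unfolding env_law_def
    proof (rule nn_integral_distr[where f = "\<lambda>w. \<Prod>k\<in>J. ennreal ((1 - w k) / w k)"])
      show "(\<lambda>x. restrict x J) \<in> PiM UNIV (\<lambda>_. \<nu>) \<rightarrow>\<^sub>M PiM J (\<lambda>_. \<nu>)"
        by (rule measurable_restrict_subset[OF subset_UNIV])
      have "(\<lambda>w. \<Prod>k\<in>J. ennreal ((1 - w k) / w k)) \<in> borel_measurable (PiM J (\<lambda>_. \<nu>))"
      proof (rule borel_measurable_prod_ennreal)
        fix k assume "k \<in> J"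
        then have "(\<lambda>w. w k) \<in> PiM J (\<lambda>_. \<nu>) \<rightarrow>\<^sub>M \<nu>"
          by (rule measurable_component_singleton)
        from measurable_compose[OF this m]
        show "(\<lambda>w. ennreal ((1 - w k) / w k)) \<in> borel_measurable (PiM J (\<lambda>_. \<nu>))" .
      qed
      then show "(\<lambda>w. \<Prod>k\<in>J. ennreal ((1 - w k) / w k))
          \<in> borel_measurable (distr (PiM UNIV (\<lambda>_. \<nu>)) (PiM J (\<lambda>_. \<nu>)) (\<lambda>x. restrict x J))"
        unfolding measurable_distr_eq1 .
    qed
    also have "\<dots> = (\<integral>\<^sup>+w. (\<Prod>k\<in>J. ennreal ((1 - w k) / w k)) \<partial>env_law \<nu>)"
      by (simp only: restrict_apply if_True cong: prod.cong)
    finally show ?thesis by (rule sym)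
  qed
  have "(\<Prod>k=1..n. ennreal (rho w (int k))) = (\<Prod>k\<in>int ` {1..n}. ennreal ((1 - w k) / w k))" for w
    by (subst prod.reindex) (auto simp: rho_def)
  then show ?thesis
    using fin[of "int ` {1..n}"] fin[of "{0}"]
    by (simp only: finite_imageI finite_atLeastAtMost card_image inj_on_of_nat card_atLeastAtMost
          finite.intros) (simp add: rho_def)
qed

lemma inverse_ennreal_antimono: "a \<le> b \<Longrightarrow> inverse b \<le> inverse a" for a b :: ennreal
  unfolding less_eq_ennreal.rep_eq inverse_ennreal.rep_eq by (intro ereal_inverse_antimono) auto

lemma env_S_bounds: "0 \<le> env_S w" "env_S w \<le> 1"
proof -
  have "(\<Prod>k=1..0. ennreal (rho w (int k))) \<le> (\<Sum>n. \<Prod>k=1..n. ennreal (rho w (int k)))"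
    using sum_le_suminf[of "\<lambda>n. \<Prod>k=1..n. ennreal (rho w (int k))" "{0}"] by simp
  then have "inverse (\<Sum>n. \<Prod>k=1..n. ennreal (rho w (int k))) \<le> inverse 1"
    by (intro inverse_ennreal_antimono) simp
  then show "env_S w \<le> 1"
    unfolding env_S_def by (intro enn2real_leI) auto
qed (simp add: env_S_def)

lemma measurable_env_S:
  assumes "\<nu> \<in> space (prob_algebra unit_borel)"
  shows "env_S \<in> borel_measurable (env_law \<nu>)"
proof -
  have sets: "sets (env_law \<nu>) = sets env_space"
    using env_law_in_prob_algebra[OF assms] by (simp add: space_prob_algebra)
  have [measurable]: "(\<lambda>w. w x) \<in> borel_measurable env_space" for x :: int
    by (rule measurable_compose[OF measurable_component_singleton])
       (auto intro: measurable_restrict_space1)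
  have "env_S \<in> borel_measurable env_space"
    unfolding env_S_def[abs_def] rho_def by measurable
  then show ?thesis by (simp add: measurable_cong_sets[OF sets refl])
qed

lemma AE_env_S_pos:
  assumes \<nu>: "\<nu> \<in> space (prob_algebra unit_borel)"
    and lt: "(\<integral>\<^sup>+w. ennreal (rho w 0) \<partial>env_law \<nu>) < 1"
  shows "AE w in env_law \<nu>. 0 < env_S w"
proof -
  define r where "r = enn2real (\<integral>\<^sup>+w. ennreal (rho w 0) \<partial>env_law \<nu>)"
  have r: "(\<integral>\<^sup>+w. ennreal (rho w 0) \<partial>env_law \<nu>) = ennreal r" "0 \<le> r"
    using lt less_trans[OF lt ennreal_one_less_top] by (auto simp: r_def)
  with lt have r1: "r < 1" by (simp add: ennreal_less_one_iff)
  have sets: "sets (env_law \<nu>) = sets env_space"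
    using env_law_in_prob_algebra[OF \<nu>] by (simp add: space_prob_algebra)
  have [measurable]: "(\<lambda>w. w x) \<in> borel_measurable env_space" for x :: int
    by (rule measurable_compose[OF measurable_component_singleton])
       (auto intro: measurable_restrict_space1)
  have "(\<lambda>w. \<Prod>k=1..n. ennreal (rho w (int k))) \<in> borel_measurable env_space" for n
    unfolding rho_def by measurable
  then have m [measurable]: "(\<lambda>w. \<Prod>k=1..n. ennreal (rho w (int k))) \<in> borel_measurable (env_law \<nu>)" for n
    by (simp add: measurable_cong_sets[OF sets refl])
  have "(\<integral>\<^sup>+w. (\<Sum>n. \<Prod>k=1..n. ennreal (rho w (int k))) \<partial>env_law \<nu>) = (\<Sum>n. ennreal r ^ n)"
    unfolding nn_integral_suminf[OF m] env_law_rho_product[OF \<nu>] r ..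
  also have "\<dots> = (\<Sum>n. ennreal (r ^ n))" using r by (simp add: ennreal_power)
  also have "\<dots> = ennreal (1 / (1 - r))"
    using r r1 by (intro suminf_ennreal_eq geometric_sums) auto
  finally have "(\<integral>\<^sup>+w. (\<Sum>n. \<Prod>k=1..n. ennreal (rho w (int k))) \<partial>env_law \<nu>) \<noteq> \<infinity>" by simp
  then have "AE w in env_law \<nu>. (\<Sum>n. \<Prod>k=1..n. ennreal (rho w (int k))) \<noteq> \<infinity>"
    by (intro nn_integral_PInf_AE) measurable
  then show ?thesis
  proof eventually_elim
    fix w assume fin: "(\<Sum>n. \<Prod>k=1..n. ennreal (rho w (int k))) \<noteq> \<infinity>"
    have "1 \<le> (\<Sum>n. \<Prod>k=1..n. ennreal (rho w (int k)))"
      using sum_le_suminf[of "\<lambda>n. \<Prod>k=1..n. ennreal (rho w (int k))" "{0}"] by simp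
    then have "inverse (\<Sum>n. \<Prod>k=1..n. ennreal (rho w (int k))) \<noteq> \<top>"
      by (auto simp:)
    moreover have "inverse (\<Sum>n. \<Prod>k=1..n. ennreal (rho w (int k))) \<noteq> 0"
      using fin by simp
    ultimately show "0 < env_S w"
      unfolding env_S_def enn2real_positive_iff by (metis less_top zero_less_iff_neq_zero)
  qed
qed

lemma pmf_pi_star:
  assumes \<nu>: "\<nu> \<in> space (prob_algebra unit_borel)"
    and lt: "(\<integral>\<^sup>+w. ennreal (rho w 0) \<partial>env_law \<nu>) < 1"
  shows "pmf (pi_star \<nu>) k = (\<integral>w. env_S w * (1 - env_S w) ^ k \<partial>env_law \<nu>)"
  unfolding pi_star_def
proof (rule pmf_embed_pmf)
  interpret prob_space "env_law \<nu>"
    using env_law_in_prob_algebra[OF \<nu>] by (simp add: space_prob_algebra)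
  note [measurable] = measurable_env_S[OF \<nu>]
  have b: "0 \<le> env_S w * (1 - env_S w) ^ k" "env_S w * (1 - env_S w) ^ k \<le> 1" for w k
    using env_S_bounds[of w] by (auto intro!: mult_le_one power_le_one)
  show "0 \<le> (\<integral>w. env_S w * (1 - env_S w) ^ k \<partial>env_law \<nu>)" for k
    using b by (intro Bochner_Integration.integral_nonneg) auto
  have i: "integrable (env_law \<nu>) (\<lambda>w. env_S w * (1 - env_S w) ^ k)" for k
    using b by (intro integrable_const_bound[where B=1] AE_I2) auto
  have e: "ennreal (\<integral>w. env_S w * (1 - env_S w) ^ k \<partial>env_law \<nu>)
      = (\<integral>\<^sup>+w. ennreal (env_S w * (1 - env_S w) ^ k) \<partial>env_law \<nu>)" for k
    using b i by (intro nn_integral_eq_integral[symmetric] AE_I2) auto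
  have "(\<integral>\<^sup>+k. ennreal (\<integral>w. env_S w * (1 - env_S w) ^ k \<partial>env_law \<nu>) \<partial>count_space UNIV)
      = (\<Sum>k. \<integral>\<^sup>+w. ennreal (env_S w * (1 - env_S w) ^ k) \<partial>env_law \<nu>)"
    unfolding e by (rule nn_integral_count_space_nat)
  also have "\<dots> = (\<integral>\<^sup>+w. (\<Sum>k. ennreal (env_S w * (1 - env_S w) ^ k)) \<partial>env_law \<nu>)"
    by (intro nn_integral_suminf[symmetric]) measurable
  also have "\<dots> = (\<integral>\<^sup>+w. 1 \<partial>env_law \<nu>)"
  proof (rule nn_integral_cong_AE, rule AE_mp[OF AE_env_S_pos[OF assms]], rule AE_I2, rule impI)
    fix w assume pos: "0 < env_S w"
    have "(\<lambda>k. env_S w * (1 - env_S w) ^ k) sums (env_S w * (1 / (1 - (1 - env_S w))))"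
      using pos env_S_bounds[of w] by (intro sums_mult geometric_sums) auto
    then have "(\<lambda>k. env_S w * (1 - env_S w) ^ k) sums 1" using pos by simp
    then have "(\<Sum>k. ennreal (env_S w * (1 - env_S w) ^ k)) = ennreal 1"
      using b by (intro suminf_ennreal_eq) auto
    then show "(\<Sum>k. ennreal (env_S w * (1 - env_S w) ^ k)) = 1" by simp
  qed
  finally show "(\<integral>\<^sup>+k. ennreal (\<integral>w. env_S w * (1 - env_S w) ^ k \<partial>env_law \<nu>) \<partial>count_space UNIV) = 1"
    by (simp add: emeasure_space_1)
qed

section \<open>Convergence in probability\<close>

text \<open>
  Convergence to a constant. Measurability is part of the definition, since \<open>measure\<close> vanishes on
  sets that are not measurable.
\<close>

definition tendsto_in_prob :: "'a measure \<Rightarrow> (nat \<Rightarrow> 'a \<Rightarrow> real) \<Rightarrow> real \<Rightarrow> bool" where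
  "tendsto_in_prob M Y c \<longleftrightarrow>
     (\<forall>n. Y n \<in> borel_measurable M) \<and>
     (\<forall>e>0. (\<lambda>n. measure M {w \<in> space M. \<bar>Y n w - c\<bar> > e}) \<longlonglongrightarrow> 0)"

end

theory Submission
  imports Defs
begin

text \<open>
  The numbers \<open>left_steps n X (int n), \<dots>, left_steps n X 0\<close> of left jumps
  form, under the annealed law, a Markov chain on the natural numbers that starts at 0 and has
  kernel \<open>Q_kernel\<close>. The criterion is an additive functional of this chain, so the theorem is a weak
  law of large numbers for a Markov chain whose invariant law is \<open>pi_star\<close>.

  The law of the crossing numbers (\<open>distr_crossing_path\<close>). In a fixed environment the probability
  that the walk, started at \<open>x\<close>, jumps left exactly \<open>l y\<close> times from each \<open>y\<close> in \<open>{0..<n}\<close> before it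
  reaches \<open>n\<close> ought to be a product of negative binomial weights (\<open>crossing_weight\<close>). This
  product satisfies the first-step equations of the walk, by Pascal's rule, hence a bounded potential
  built from it does not decrease in mean along the path. The walk does reach \<open>n\<close>: the sum of the
  mean passage times, finite for almost every environment because the mean of \<open>rho\<close> is less than 1,
  is a Lyapunov function. This yields the product as a lower bound of the probability; since both
  sides are probability distributions after averaging over the environment, they agree.

  The invariant law (\<open>pi_star_invariant\<close>, \<open>integrable_pi_star_real\<close>). Given the environment,
  \<open>pi_star\<close> is geometric with parameter \<open>env_S\<close>, and one step of the chain with success
  probability \<open>a\<close> turns a geometric variable with parameter \<open>t\<close> into one with parameter
  \<open>a t / (1 - a (1 - t))\<close>, which is \<open>env_S\<close> of the environment with \<open>a\<close> put in front. The mean of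
  \<open>pi_star\<close> is at most that of \<open>1 / env_S\<close>, a geometric series.

  The law of large numbers (\<open>L1_ergodic\<close>). A kernel with positive entries strictly contracts the
  \<open>L1\<close>-norm of bounded functions of mean zero, so covariances along the stationary chain tend to 0
  and averages of bounded functions converge in mean square; truncation extends this to integrable
  functions. The chain started at 0 has a law at most \<open>1 / pmf (pi_star \<nu>) 0\<close> times the stationary one, so it
  inherits convergence in probability.

  Integrability (\<open>phi_linear_growth\<close>). By Jensen's inequality \<open>phi\<close> is at least a linear function of its
  arguments, whose integral is finite as \<open>pi_star\<close> has a mean. A supremum over \<open>U\<close> lies between the
  value at any one point of \<open>U\<close> and 0, hence obeys the same bound.
\<close>

section \<open>Finite segments of a Markov chain\<close>

definition path_prefix :: "nat \<Rightarrow> (nat \<Rightarrow> 's) \<Rightarrow> 's list" where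
  "path_prefix t X = map X [0..<Suc t]"

lemma length_path_prefix [simp]: "length (path_prefix t X) = Suc t"
  by (simp add: path_prefix_def)

lemma nth_path_prefix [simp]: "i \<le> t \<Longrightarrow> path_prefix t X ! i = X i"
  by (simp add: path_prefix_def nth_append less_Suc_eq_le[symmetric] del: upt_Suc)

lemma path_prefix_eq_iff: "path_prefix t X = xs \<longleftrightarrow> length xs = Suc t \<and> (\<forall>i\<le>t. X i = xs ! i)"
  by (auto simp: list_eq_iff_nth_eq less_Suc_eq_le)

text \<open>
  The state space is countable, so every function of finitely many coordinates is measurable,
  whatever its values: it factors through the discrete space of lists.
\<close>

lemma measurable_prefix_dependent:
  fixes f :: "(nat \<Rightarrow> 's::countable) \<Rightarrow> 'b"
  assumes dep: "\<And>X Y. (\<forall>i\<le>t. X i = Y i) \<Longrightarrow> f X = f Y" and sp: "space N = UNIV"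
  shows "f \<in> path_space \<rightarrow>\<^sub>M N"
proof -
  have "path_prefix t \<in> path_space \<rightarrow>\<^sub>M (count_space UNIV :: 's list measure)"
  proof (subst measurable_count_space_eq2_countable, intro conjI ballI)
    fix xs :: "'s list"
    have "{X. \<forall>i\<le>t. X i = xs ! i} \<in> sets path_space" by (rule cylinder_sets)
    moreover have "path_prefix t -` {xs} \<inter> space path_space
        = (if length xs = Suc t then {X. \<forall>i\<le>t. X i = xs ! i} else {})"
      by (auto simp: space_PiM path_prefix_eq_iff)
    ultimately show "path_prefix t -` {xs} \<inter> space path_space \<in> sets path_space" by simp
  qed auto
  moreover have "(\<lambda>xs. f ((!) xs)) \<in> count_space UNIV \<rightarrow>\<^sub>M N" using sp by simp
  ultimately have "(\<lambda>X. f ((!) (path_prefix t X))) \<in> path_space \<rightarrow>\<^sub>M N" by (rule measurable_compose)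
  then show ?thesis using dep[of "(!) (path_prefix t X)" X for X] by simp
qed

text \<open>
  The law of the first \<open>t + 1\<close> states, as a discrete law on lists; extending at the end makes the
  one-step Markov property a single use of \<open>bind_pmf\<close>.
\<close>

primrec chain_pmf :: "'s pmf \<Rightarrow> ('s \<Rightarrow> 's pmf) \<Rightarrow> nat \<Rightarrow> 's list pmf" where
  "chain_pmf \<mu> K 0 = map_pmf (\<lambda>x. [x]) \<mu>"
| "chain_pmf \<mu> K (Suc t) = bind_pmf (chain_pmf \<mu> K t) (\<lambda>xs. map_pmf (\<lambda>y. xs @ [y]) (K (last xs)))"

lemma length_chain_pmf: "xs \<in> set_pmf (chain_pmf \<mu> K t) \<Longrightarrow> length xs = Suc t"
  by (induction t arbitrary: xs) auto

lemma pmf_chain_pmf: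
  "length xs = Suc t \<Longrightarrow>
    pmf (chain_pmf \<mu> K t) xs = pmf \<mu> (xs ! 0) * (\<Prod>i<t. pmf (K (xs ! i)) (xs ! Suc i))"
proof (induction t arbitrary: xs)
  case 0
  then obtain x where xs: "xs = [x]" by (auto simp: length_Suc_conv)
  have "pmf (map_pmf (\<lambda>x. [x]) \<mu>) [x] = pmf \<mu> x" by (rule pmf_map_inj') (auto simp: inj_def)
  then show ?case by (simp add: xs)
next
  case (Suc t)
  from Suc.prems have "xs \<noteq> []" by auto
  then obtain ys y where xs: "xs = ys @ [y]" by (cases xs rule: rev_cases) auto
  with Suc.prems have len: "length ys = Suc t" by simp
  have inj: "inj (\<lambda>y. zs @ [y])" for zs :: "'a list" by (auto simp: inj_def)
  have "pmf (map_pmf (\<lambda>y. zs @ [y]) (K (last zs))) (ys @ [y]) = pmf (K (last ys)) y * indicator {ys} zs" for zs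
  proof (cases "zs = ys")
    case True then show ?thesis using pmf_map_inj'[OF inj[of ys], of "K (last ys)" y] by simp
  next
    case False
    then have "pmf (map_pmf (\<lambda>y. zs @ [y]) (K (last zs))) (ys @ [y]) = 0"
      unfolding pmf_eq_0_set_pmf by auto
    then show ?thesis using False by simp
  qed
  then have "pmf (chain_pmf \<mu> K (Suc t)) xs = pmf (K (last ys)) y * pmf (chain_pmf \<mu> K t) ys"
    by (simp add: pmf_bind xs measure_pmf_single)
  also have "last ys = ys ! t" using len by (metis diff_Suc_1 last_conv_nth length_greater_0_conv zero_less_Suc)
  finally show ?case using len Suc.IH[OF len] by (simp add: xs nth_append)
qed

lemma distr_markov_law_prefix:
  fixes \<mu> :: "'s::countable pmf"
  shows "distr (markov_law \<mu> K) (count_space UNIV) (path_prefix t) = measure_pmf (chain_pmf \<mu> K t)"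
proof (rule measure_eqI_countable[of _ UNIV])
  interpret P: prob_space "markov_law \<mu> K" by (rule prob_space_markov_law)
  have m: "path_prefix t \<in> markov_law \<mu> K \<rightarrow>\<^sub>M count_space UNIV"
    by (unfold measurable_cong_sets[OF sets_markov_law refl], rule measurable_prefix_dependent[where t=t]) (auto simp: path_prefix_eq_iff)
  fix xs :: "'s list"
  have "emeasure (distr (markov_law \<mu> K) (count_space UNIV) (path_prefix t)) {xs}
      = emeasure (markov_law \<mu> K) {X. path_prefix t X = xs}"
    using m by (subst emeasure_distr) (auto intro!: arg_cong[where f="emeasure _"])
  also have "\<dots> = emeasure (measure_pmf (chain_pmf \<mu> K t)) {xs}"
  proof (cases "length xs = Suc t")
    case True
    then show ?thesis
      by (simp add: path_prefix_eq_iff P.emeasure_eq_measure measure_markov_law_cylinder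
        emeasure_pmf_single pmf_chain_pmf)
  next
    case False
    then have "pmf (chain_pmf \<mu> K t) xs = 0"
      using length_chain_pmf[of xs] by (auto simp: pmf_eq_0_set_pmf)
    then show ?thesis using False by (simp add: path_prefix_eq_iff emeasure_pmf_single)
  qed
  finally show "emeasure (distr (markov_law \<mu> K) (count_space UNIV) (path_prefix t)) {xs}
      = emeasure (measure_pmf (chain_pmf \<mu> K t)) {xs}" .
qed auto

lemma nn_integral_markov_law_prefix:
  fixes \<mu> :: "'s::countable pmf"
  shows "(\<integral>\<^sup>+X. f (path_prefix t X) \<partial>markov_law \<mu> K) = (\<integral>\<^sup>+xs. f xs \<partial>chain_pmf \<mu> K t)"
proof -
  have m: "path_prefix t \<in> markov_law \<mu> K \<rightarrow>\<^sub>M count_space UNIV"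
    by (unfold measurable_cong_sets[OF sets_markov_law refl], rule measurable_prefix_dependent[where t=t]) (auto simp: path_prefix_eq_iff)
  show ?thesis
    unfolding distr_markov_law_prefix[symmetric] by (rule nn_integral_distr[symmetric, OF m]) simp
qed

text \<open>
  The Markov property in the form used throughout: the next state may be integrated out against
  the kernel in any function of it and of the past.
\<close>

lemma nn_integral_markov_law_step:
  fixes \<mu> :: "'s::countable pmf" and f :: "(nat \<Rightarrow> 's) \<Rightarrow> 's \<Rightarrow> ennreal"
  assumes dep: "\<And>X Y y. (\<forall>i\<le>t. X i = Y i) \<Longrightarrow> f X y = f Y y"
  shows "(\<integral>\<^sup>+X. f X (X (Suc t)) \<partial>markov_law \<mu> K) = (\<integral>\<^sup>+X. (\<integral>\<^sup>+y. f X y \<partial>K (X t)) \<partial>markov_law \<mu> K)"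
proof -
  have "(\<integral>\<^sup>+X. f X (X (Suc t)) \<partial>markov_law \<mu> K)
      = (\<integral>\<^sup>+X. f ((!) (path_prefix (Suc t) X)) (path_prefix (Suc t) X ! Suc t) \<partial>markov_law \<mu> K)"
    by (intro nn_integral_cong) (simp, rule dep, simp)
  also have "\<dots> = (\<integral>\<^sup>+xs. \<integral>\<^sup>+y. f ((!) (xs @ [y])) ((xs @ [y]) ! Suc t) \<partial>K (last xs) \<partial>chain_pmf \<mu> K t)"
    unfolding nn_integral_markov_law_prefix[where f="\<lambda>xs. f ((!) xs) (xs ! Suc t)"] by simp
  also have "\<dots> = (\<integral>\<^sup>+xs. \<integral>\<^sup>+y. f ((!) xs) y \<partial>K (xs ! t) \<partial>chain_pmf \<mu> K t)"
  proof (rule nn_integral_cong_AE, unfold AE_measure_pmf_iff, rule ballI)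
    fix xs assume "xs \<in> set_pmf (chain_pmf \<mu> K t)"
    then have len: "length xs = Suc t" by (rule length_chain_pmf)
    have "f ((!) (xs @ [y])) ((xs @ [y]) ! Suc t) = f ((!) xs) y" for y
      using len dep[of "(!) (xs @ [y])" "(!) xs"] by (simp add: nth_append)
    moreover have "last xs = xs ! t"
      using len by (metis diff_Suc_1 last_conv_nth length_greater_0_conv zero_less_Suc)
    ultimately show "(\<integral>\<^sup>+y. f ((!) (xs @ [y])) ((xs @ [y]) ! Suc t) \<partial>K (last xs)) = (\<integral>\<^sup>+y. f ((!) xs) y \<partial>K (xs ! t))"
      by simp
  qed
  also have "\<dots> = (\<integral>\<^sup>+X. (\<integral>\<^sup>+y. f ((!) (path_prefix t X)) y \<partial>K (path_prefix t X ! t)) \<partial>markov_law \<mu> K)"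
    by (rule nn_integral_markov_law_prefix[symmetric])
  also have "\<dots> = (\<integral>\<^sup>+X. (\<integral>\<^sup>+y. f X y \<partial>K (X t)) \<partial>markov_law \<mu> K)"
    using dep[of "(!) (path_prefix t X)" X for X] by simp
  finally show ?thesis .
qed

text \<open>
  Carries identities between nonnegative integrals over to bounded real functions.
\<close>

lemma (in prob_space) integral_eq_nn_integral_shift:
  assumes "f \<in> borel_measurable M" and b: "\<And>x. \<bar>f x\<bar> \<le> B"
  shows "(\<integral>x. f x \<partial>M) = enn2real (\<integral>\<^sup>+x. ennreal (f x + B) \<partial>M) - B"
proof -
  have i: "integrable M f" using assms by (intro integrable_const_bound[where B=B]) auto
  have "(\<integral>x. f x + B \<partial>M) = enn2real (\<integral>\<^sup>+x. ennreal (f x + B) \<partial>M)"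
  proof (rule integral_eq_nn_integral)
    have "0 \<le> f x + B" for x using b[of x] by linarith
    then show "AE x in M. 0 \<le> f x + B" by simp
  qed (use assms(1) in simp)
  then show ?thesis using i by (simp add: prob_space)
qed

lemma integral_markov_law_step:
  fixes \<mu> :: "'s::countable pmf" and f :: "(nat \<Rightarrow> 's) \<Rightarrow> 's \<Rightarrow> real"
  assumes dep: "\<And>X Y y. (\<forall>i\<le>t. X i = Y i) \<Longrightarrow> f X y = f Y y" and b: "\<And>X y. \<bar>f X y\<bar> \<le> B"
  shows "(\<integral>X. f X (X (Suc t)) \<partial>markov_law \<mu> K) = (\<integral>X. (\<integral>y. f X y \<partial>K (X t)) \<partial>markov_law \<mu> K)"
proof -
  interpret P: prob_space "markov_law \<mu> K" by (rule prob_space_markov_law)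
  have i: "integrable (K x) (f X)" for x X
    using b by (intro measure_pmf.integrable_const_bound[where B=B]) auto
  have 1: "(\<lambda>X. f X (X (Suc t))) \<in> borel_measurable (markov_law \<mu> K)"
    unfolding measurable_cong_sets[OF sets_markov_law refl]
  proof (rule measurable_prefix_dependent[where t="Suc t"])
    fix X Y :: "nat \<Rightarrow> 's" assume *: "\<forall>i\<le>Suc t. X i = Y i"
    then show "f X (X (Suc t)) = f Y (Y (Suc t))" using dep[of X Y] by simp
  qed simp
  have 2: "(\<lambda>X. \<integral>y. f X y \<partial>K (X t)) \<in> borel_measurable (markov_law \<mu> K)"
    unfolding measurable_cong_sets[OF sets_markov_law refl]
  proof (rule measurable_prefix_dependent[where t=t])
    fix X Y :: "nat \<Rightarrow> 's" assume *: "\<forall>i\<le>t. X i = Y i"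
    then have "f X = f Y" using dep[of X Y] by blast
    then show "(\<integral>y. f X y \<partial>K (X t)) = (\<integral>y. f Y y \<partial>K (Y t))" using * by simp
  qed simp
  have b2: "\<bar>\<integral>y. f X y \<partial>K (X t)\<bar> \<le> B" for X
  proof -
    have "- B \<le> f X y" "f X y \<le> B" for y using b[of X y] by linarith+
    then show ?thesis
      using measure_pmf.integral_le_const[OF i[of "X t" X], of B]
        measure_pmf.integral_ge_const[OF i[of "X t" X], of "-B"] by (simp add: abs_le_iff)
  qed
  have "(\<integral>\<^sup>+X. ennreal (f X (X (Suc t)) + B) \<partial>markov_law \<mu> K)
      = (\<integral>\<^sup>+X. (\<integral>\<^sup>+y. ennreal (f X y + B) \<partial>K (X t)) \<partial>markov_law \<mu> K)"
    by (rule nn_integral_markov_law_step[where f="\<lambda>X y. ennreal (f X y + B)"]) (rule arg_cong[where f="\<lambda>z. ennreal (z + B)"], rule dep)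
  also have "\<dots> = (\<integral>\<^sup>+X. ennreal ((\<integral>y. f X y \<partial>K (X t)) + B) \<partial>markov_law \<mu> K)"
  proof (rule nn_integral_cong)
    fix X
    have "0 \<le> f X y + B" for y using b[of X y] by simp
    then have "(\<integral>\<^sup>+y. ennreal (f X y + B) \<partial>K (X t)) = ennreal (\<integral>y. f X y + B \<partial>K (X t))"
      using i by (intro nn_integral_eq_integral) auto
    then show "(\<integral>\<^sup>+y. ennreal (f X y + B) \<partial>K (X t)) = ennreal ((\<integral>y. f X y \<partial>K (X t)) + B)"
      using i by simp
  qed
  finally show ?thesis
    using P.integral_eq_nn_integral_shift[OF 1 b] P.integral_eq_nn_integral_shift[OF 2 b2] by simp
qed

section \<open>Ergodic averages of stationary chains with positive kernel\<close>

lemma integrable_pmf_bounded: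
  fixes f :: "'a \<Rightarrow> real"
  assumes "\<And>x. \<bar>f x\<bar> \<le> B"
  shows "integrable (measure_pmf p) f"
  using assms by (intro measure_pmf.integrable_const_bound[where B=B]) auto

lemma abs_expectation_pmf_le:
  fixes f :: "'a \<Rightarrow> real"
  assumes b: "\<And>x. \<bar>f x\<bar> \<le> B"
  shows "\<bar>measure_pmf.expectation p f\<bar> \<le> B"
proof -
  have "- B \<le> f x" "f x \<le> B" for x using b[of x] by linarith+
  then show ?thesis
    using measure_pmf.integral_le_const[of p f B] measure_pmf.integral_ge_const[of p f "-B"]
      integrable_pmf_bounded[of f B p, OF b] by (simp add: abs_le_iff)
qed

lemma integral_bind_pmf_bounded:
  fixes f :: "'a \<Rightarrow> real"
  assumes b: "\<And>x. \<bar>f x\<bar> \<le> B"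
  shows "(\<integral>y. f y \<partial>bind_pmf p k) = (\<integral>x. (\<integral>y. f y \<partial>k x) \<partial>p)"
proof -
  have nn: "0 \<le> f x + B" for x using b[of x] by linarith
  have "(\<integral>\<^sup>+y. ennreal (f y + B) \<partial>bind_pmf p k) = (\<integral>\<^sup>+x. (\<integral>\<^sup>+y. ennreal (f y + B) \<partial>k x) \<partial>p)" by simp
  also have "\<dots> = (\<integral>\<^sup>+x. ennreal ((\<integral>y. f y \<partial>k x) + B) \<partial>p)"
  proof (rule nn_integral_cong)
    fix x
    have "(\<integral>\<^sup>+y. ennreal (f y + B) \<partial>k x) = ennreal (\<integral>y. f y + B \<partial>k x)"
      using nn integrable_pmf_bounded[of f B, OF b] by (intro nn_integral_eq_integral) auto
    then show "(\<integral>\<^sup>+y. ennreal (f y + B) \<partial>k x) = ennreal ((\<integral>y. f y \<partial>k x) + B)"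
      using integrable_pmf_bounded[of f B, OF b] by simp
  qed
  finally show ?thesis
    using measure_pmf.integral_eq_nn_integral_shift[of f "bind_pmf p k" B]
      measure_pmf.integral_eq_nn_integral_shift[of "\<lambda>x. \<integral>y. f y \<partial>k x" p B] b
      abs_expectation_pmf_le[of f B, OF b] by simp
qed

lemma pmf_finite_set_approx:
  fixes p :: "'s::countable pmf"
  assumes "0 < e"
  obtains F where "finite F" "measure_pmf.prob p (- F) < e"
proof -
  define A where "A n = {x :: 's. to_nat x \<le> n}" for n
  have fin: "finite (A n)" for n
    by (rule finite_imageD[of to_nat]) (auto simp: A_def intro: finite_subset[of _ "{..n}"] inj_on_subset)
  have "(\<lambda>n. measure_pmf.prob p (A n)) \<longlonglongrightarrow> measure_pmf.prob p (\<Union>n. A n)"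
    by (rule measure_pmf.finite_Lim_measure_incseq) (auto simp: A_def incseq_def)
  moreover have "(\<Union>n. A n) = UNIV" by (auto simp: A_def)
  ultimately have "(\<lambda>n. measure_pmf.prob p (A n)) \<longlonglongrightarrow> 1" by simp
  then have "eventually (\<lambda>n. 1 - e < measure_pmf.prob p (A n)) sequentially"
    using assms by (intro order_tendstoD) auto
  then obtain n where "1 - e < measure_pmf.prob p (A n)" by (auto simp: eventually_sequentially)
  then have "measure_pmf.prob p (- A n) < e"
    using measure_pmf.prob_compl[of "A n" p] by (simp add: Compl_eq_Diff_UNIV)
  with fin show ?thesis by (rule that)
qed

text \<open>
  The first \<open>N\<close> terms contribute a fixed amount, which the division by \<open>n\<close> removes.
\<close>

lemma cesaro_zero:
  fixes a :: "nat \<Rightarrow> real"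
  assumes "a \<longlonglongrightarrow> 0"
  shows "(\<lambda>n. (\<Sum>m<n. a m) / real n) \<longlonglongrightarrow> 0"
proof (rule LIMSEQ_I)
  fix r :: real assume r: "0 < r"
  from LIMSEQ_D[OF assms, of "r/2"] r obtain N where N: "\<And>m. N \<le> m \<Longrightarrow> \<bar>a m\<bar> < r / 2" by auto
  define C where "C = (\<Sum>m<N. \<bar>a m\<bar>)"
  obtain N' :: nat where N': "2 * C / r < real N'" using reals_Archimedean2 by blast
  show "\<exists>no. \<forall>n\<ge>no. norm ((\<Sum>m<n. a m) / real n - 0) < r"
  proof (intro exI allI impI)
    fix n assume n: "max (Suc N) N' \<le> n"
    have "\<bar>\<Sum>m<n. a m\<bar> \<le> (\<Sum>m<n. \<bar>a m\<bar>)" by simp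
    also have "\<dots> = C + (\<Sum>m=N..<n. \<bar>a m\<bar>)"
      unfolding C_def lessThan_atLeast0 using n by (intro sum.atLeastLessThan_concat[symmetric]) auto
    also have "(\<Sum>m=N..<n. \<bar>a m\<bar>) \<le> (\<Sum>m=N..<n. r / 2)"
      using N by (intro sum_mono less_imp_le) auto
    also have "\<dots> \<le> real n * (r / 2)" using r by (simp add: mult_right_mono)
    also have "C < real n * (r / 2)"
    proof -
      have "2 * C / r < real n" using N' n by linarith
      then show ?thesis using r by (simp add: field_simps)
    qed
    finally have "\<bar>\<Sum>m<n. a m\<bar> < real n * r" by (simp add: field_simps)
    then show "norm ((\<Sum>m<n. a m) / real n - 0) < r" using n by (simp add: field_simps)
  qed
qed

lemma (in prob_space) expectation_abs_le_sqrt: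
  fixes f :: "'a \<Rightarrow> real"
  assumes m: "f \<in> borel_measurable M" and b: "\<And>x. \<bar>f x\<bar> \<le> B"
  shows "expectation (\<lambda>x. \<bar>f x\<bar>) \<le> sqrt (expectation (\<lambda>x. (f x)\<^sup>2))"
proof -
  have i: "integrable M (\<lambda>x. \<bar>f x\<bar>)"
    using assms by (intro integrable_const_bound[where B=B]) auto
  have "\<bar>f x\<bar>\<^sup>2 \<le> B\<^sup>2" for x using power_mono[OF b[of x], of 2] by simp
  then have i2: "integrable M (\<lambda>x. \<bar>f x\<bar>\<^sup>2)"
    using m by (intro integrable_const_bound[where B="B\<^sup>2"]) auto
  have "(expectation (\<lambda>x. \<bar>f x\<bar>))\<^sup>2 \<le> expectation (\<lambda>x. \<bar>f x\<bar>\<^sup>2)"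
    using variance_eq[OF i i2] variance_positive[of "\<lambda>x. \<bar>f x\<bar>"] by simp
  then show ?thesis by (simp add: real_le_rsqrt)
qed

definition averaging :: "('s \<Rightarrow> 's pmf) \<Rightarrow> ('s \<Rightarrow> real) \<Rightarrow> 's \<Rightarrow> real" where
  "averaging K f x = (\<integral>y. f y \<partial>K x)"

text \<open>
  Positivity of all entries replaces irreducibility and aperiodicity, and gives the quantitative
  contraction below at an arbitrary state \<open>z\<close>.
\<close>

locale invariant_positive_kernel =
  fixes \<pi> :: "'s::countable pmf" and K :: "'s \<Rightarrow> 's pmf"
  assumes invariant: "bind_pmf \<pi> K = \<pi>"
    and positive: "0 < pmf (K x) y"
begin

lemma invariant_pos: "0 < pmf \<pi> y"
proof -
  obtain x where "x \<in> set_pmf \<pi>" using set_pmf_not_empty by fast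
  moreover have "y \<in> set_pmf (K x)" using positive[of x y] by (simp add: set_pmf_iff)
  ultimately have "y \<in> set_pmf (bind_pmf \<pi> K)" by auto
  then show ?thesis unfolding invariant by (rule pmf_positive)
qed

lemma averaging_bounded: "(\<And>x. \<bar>f x\<bar> \<le> B) \<Longrightarrow> \<bar>averaging K f x\<bar> \<le> B"
  unfolding averaging_def by (rule abs_expectation_pmf_le)

lemma integral_averaging:
  "(\<And>x. \<bar>f x\<bar> \<le> B) \<Longrightarrow> (\<integral>x. averaging K f x \<partial>\<pi>) = (\<integral>x. f x \<partial>\<pi>)"
  unfolding averaging_def using integral_bind_pmf_bounded[of f B \<pi> K] by (simp add: invariant)

text \<open>
  A function \<open>u\<close> of mean zero has positive and negative parts of equal mass. Both are averaged into the
  value at \<open>z\<close>, where they cancel; the smaller of the two averages measures the loss of \<open>L1\<close>-norm. It is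
  bounded below through the finite set \<open>F\<close> that carries most of the mass of \<open>\<pi>\<close> and on which the
  entries \<open>pmf (K z) y\<close> are at least \<open>q\<close>.
\<close>

lemma averaging_contracts:
  assumes b: "\<And>x. \<bar>u x\<bar> \<le> B" and zero: "(\<integral>x. u x \<partial>\<pi>) = 0"
    and a: "a \<le> (\<integral>x. \<bar>u x\<bar> \<partial>\<pi>)"
    and F: "finite F" "B * measure_pmf.prob \<pi> (- F) \<le> a / 4"
    and q: "0 \<le> q" "\<And>y. y \<in> F \<Longrightarrow> q \<le> pmf (K z) y"
  shows "(\<integral>x. \<bar>averaging K u x\<bar> \<partial>\<pi>) \<le> (\<integral>x. \<bar>u x\<bar> \<partial>\<pi>) - pmf \<pi> z * q * a / 2"
proof -
  define up where "up x = max (u x) 0" for x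
  define um where "um x = max (- u x) 0" for x
  have u: "u x = up x - um x" "\<bar>u x\<bar> = up x + um x" for x by (auto simp: up_def um_def)
  have nn: "0 \<le> up x" "0 \<le> um x" for x by (auto simp: up_def um_def)
  have le: "up x \<le> B" "um x \<le> B" for x using b[of x] by (auto simp: up_def um_def)
  have bb: "\<bar>up x\<bar> \<le> B" "\<bar>um x\<bar> \<le> B" for x using nn le by auto
  note i = integrable_pmf_bounded[of up B, OF bb(1)] integrable_pmf_bounded[of um B, OF bb(2)]
  have "(\<integral>x. up x \<partial>\<pi>) - (\<integral>x. um x \<partial>\<pi>) = 0"
    using zero i[of \<pi>] unfolding u(1) by simp
  moreover have "(\<integral>x. up x \<partial>\<pi>) + (\<integral>x. um x \<partial>\<pi>) \<ge> a"
    using a i[of \<pi>] unfolding u(2) by simp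
  ultimately have half: "a / 2 \<le> (\<integral>x. up x \<partial>\<pi>)" "a / 2 \<le> (\<integral>x. um x \<partial>\<pi>)" by linarith+
  have low: "q * (a / 4) \<le> (\<integral>y. v y \<partial>K z)"
    if v: "\<And>x. 0 \<le> v x" "\<And>x. v x \<le> B" "a / 2 \<le> (\<integral>x. v x \<partial>\<pi>)" for v
  proof -
    have vb: "\<bar>v x\<bar> \<le> B" for x using v by simp
    have vF: "\<bar>v x * indicator F x\<bar> \<le> B" for x using v(1,2)[of x] order_trans[OF v(1,2)] by (auto simp: indicator_def)
    have "\<bar>B * indicator (- F) x\<bar> \<le> \<bar>B\<bar>" for x by (simp add: indicator_def)
    then have iB: "integrable \<pi> (\<lambda>x. B * indicator (- F) x)" by (rule integrable_pmf_bounded)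
    have iF: "integrable p (\<lambda>x. v x * indicator F x)" for p :: "'s pmf"
      using vF by (rule integrable_pmf_bounded)
    have "a / 2 \<le> (\<integral>x. v x * indicator F x + B * indicator (- F) x \<partial>\<pi>)"
      using v by (intro order_trans[OF v(3)] integral_mono Bochner_Integration.integrable_add iF iB
          integrable_pmf_bounded[of v B, OF vb]) (auto simp: indicator_def)
    also have "\<dots> = (\<integral>x. v x * indicator F x \<partial>\<pi>) + (\<integral>x. B * indicator (- F) x \<partial>\<pi>)"
      by (rule Bochner_Integration.integral_add[OF iF iB])
    also have "(\<integral>x. B * indicator (- F) x \<partial>\<pi>) = B * measure_pmf.prob \<pi> (- F)" by simp
    finally have "a / 4 \<le> (\<integral>x. v x * indicator F x \<partial>\<pi>)" using F(2) by linarith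
    also have "\<dots> = (\<Sum>y\<in>F. v y * pmf \<pi> y)"
      using F(1) by (subst integral_measure_pmf_real[where A=F]) (auto simp: indicator_def)
    finally have "q * (a / 4) \<le> (\<Sum>y\<in>F. q * (v y * pmf \<pi> y))"
      unfolding sum_distrib_left[symmetric] by (intro mult_left_mono q)
    also have "\<dots> \<le> (\<Sum>y\<in>F. v y * pmf (K z) y)"
    proof (rule sum_mono)
      fix y assume y: "y \<in> F"
      have "q * pmf \<pi> y \<le> q * 1" using q(1) by (intro mult_left_mono pmf_le_1)
      then have "q * pmf \<pi> y \<le> pmf (K z) y" using q(2)[OF y] by linarith
      then have "v y * (q * pmf \<pi> y) \<le> v y * pmf (K z) y" using v(1) by (intro mult_left_mono)
      then show "q * (v y * pmf \<pi> y) \<le> v y * pmf (K z) y" by (simp add: ac_simps)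
    qed
    also have "\<dots> = (\<integral>x. v x * indicator F x \<partial>K z)"
      using F(1) by (subst integral_measure_pmf_real[where A=F]) (auto simp: indicator_def)
    also have "\<dots> \<le> (\<integral>x. v x \<partial>K z)"
      using integrable_pmf_bounded[of v B, OF vb] integrable_pmf_bounded[of "\<lambda>x. v x * indicator F x" B, OF vF] v(1)
      by (intro integral_mono) (auto simp: indicator_def)
    finally show ?thesis .
  qed
  \<comment> \<open>\<open>d\<close> is the pointwise loss caused by the cancellation of the two parts.\<close>
  define d where "d x = averaging K (\<lambda>x. \<bar>u x\<bar>) x - \<bar>averaging K u x\<bar>" for x
  have d: "d x = 2 * min (\<integral>y. up y \<partial>K x) (\<integral>y. um y \<partial>K x)" for x
  proof -
    have "averaging K (\<lambda>x. \<bar>u x\<bar>) x = (\<integral>y. up y \<partial>K x) + (\<integral>y. um y \<partial>K x)"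
      unfolding averaging_def u(2) using i by simp
    moreover have "averaging K u x = (\<integral>y. up y \<partial>K x) - (\<integral>y. um y \<partial>K x)"
      unfolding averaging_def u(1) using i by simp
    moreover have "0 \<le> (\<integral>y. up y \<partial>K x)" "0 \<le> (\<integral>y. um y \<partial>K x)"
      using nn by (auto intro: integral_nonneg)
    ultimately show ?thesis by (auto simp: d_def min_def abs_if)
  qed
  have d0: "0 \<le> d x" for x unfolding d using nn by (auto intro!: integral_nonneg)
  have dz: "q * a / 2 \<le> d z"
    unfolding d using low[of up] low[of um] nn le half by (simp add: min_def)
  have "\<bar>\<bar>u x\<bar>\<bar> \<le> B" for x using b by simp
  note ab = averaging_bounded[of "\<lambda>x. \<bar>u x\<bar>" B, OF this] averaging_bounded[of u B, OF b]
    integral_averaging[of "\<lambda>x. \<bar>u x\<bar>" B, OF this]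
  have ia: "integrable \<pi> (averaging K (\<lambda>x. \<bar>u x\<bar>))" "integrable \<pi> (\<lambda>x. \<bar>averaging K u x\<bar>)"
    using ab(1,2) by (auto intro!: integrable_pmf_bounded[where B=B])
  have "pmf \<pi> z * (q * a / 2) \<le> pmf \<pi> z * d z" using dz by (intro mult_left_mono) auto
  also have "\<dots> = (\<integral>x. d x * indicator {z} x \<partial>\<pi>)"
    by (subst integral_measure_pmf_real[where A="{z}"]) (auto simp: indicator_def)
  also have "\<dots> \<le> (\<integral>x. d x \<partial>\<pi>)"
  proof (rule integral_mono)
    have "\<bar>d x * indicator {z} x\<bar> \<le> \<bar>d z\<bar>" for x by (auto simp: indicator_def)
    then show "integrable \<pi> (\<lambda>x. d x * indicator {z} x)" by (rule integrable_pmf_bounded)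
    show "integrable \<pi> d" unfolding d_def[abs_def] using ia by simp
  qed (use d0 in \<open>auto simp: indicator_def\<close>)
  also have "\<dots> = (\<integral>x. \<bar>u x\<bar> \<partial>\<pi>) - (\<integral>x. \<bar>averaging K u x\<bar> \<partial>\<pi>)"
    unfolding d_def using ia ab(3) by simp
  finally show ?thesis by simp
qed

lemma averaging_funpow:
  assumes b: "\<And>x. \<bar>h x\<bar> \<le> B"
  shows "\<bar>(averaging K ^^ m) h x\<bar> \<le> B" "(\<integral>x. (averaging K ^^ m) h x \<partial>\<pi>) = (\<integral>x. h x \<partial>\<pi>)"
proof -
  have 1: "\<bar>(averaging K ^^ m) h x\<bar> \<le> B" for m x
    by (induction m arbitrary: x) (auto intro: b averaging_bounded)
  show "\<bar>(averaging K ^^ m) h x\<bar> \<le> B" by (rule 1)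
  show "(\<integral>x. (averaging K ^^ m) h x \<partial>\<pi>) = (\<integral>x. h x \<partial>\<pi>)"
    by (induction m) (auto simp: integral_averaging[of _ B, OF 1])
qed

text \<open>
  If the norms stayed above \<open>e\<close>, each step would lower them by the same positive amount: the loss depends
  only on \<open>e\<close> and on the uniform bound \<open>B\<close>, which is preserved by averaging.
\<close>

lemma averaging_mixes:
  assumes b: "\<And>x. \<bar>h x\<bar> \<le> B" and zero: "(\<integral>x. h x \<partial>\<pi>) = 0"
  shows "(\<lambda>m. \<integral>x. \<bar>(averaging K ^^ m) h x\<bar> \<partial>\<pi>) \<longlonglongrightarrow> 0"
proof -
  define a where "a m = (\<integral>x. \<bar>(averaging K ^^ m) h x\<bar> \<partial>\<pi>)" for m
  note fp = averaging_funpow[of h B, OF b]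
  have B: "0 \<le> B" using b[of undefined] by linarith
  have a0: "0 \<le> a m" for m by (simp add: a_def)
  have step: "a (Suc m) \<le> a m - pmf \<pi> z * q * e / 2"
    if "e \<le> a m" "finite F" "B * measure_pmf.prob \<pi> (- F) \<le> e / 4" "0 \<le> q" "\<And>y. y \<in> F \<Longrightarrow> q \<le> pmf (K z) y"
    for m e F q z
    using averaging_contracts[of "(averaging K ^^ m) h" B e F q z, OF fp(1)] that zero fp(2)[of m] by (simp add: a_def)
  have dec: "a n \<le> a m" if "m \<le> n" for m n
  proof -
    have "a (Suc m) \<le> a m" for m
    proof -
      have bb: "\<bar>\<bar>(averaging K ^^ m) h x\<bar>\<bar> \<le> B" for x using fp(1) by simp
      have "a (Suc m) \<le> (\<integral>x. averaging K (\<lambda>x. \<bar>(averaging K ^^ m) h x\<bar>) x \<partial>\<pi>)"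
        unfolding a_def funpow.simps o_apply
      proof (intro integral_mono integrable_pmf_bounded[where B=B])
        show "\<bar>\<bar>averaging K ((averaging K ^^ m) h) x\<bar>\<bar> \<le> B" for x
          using averaging_bounded[of "(averaging K ^^ m) h" B, OF fp(1)] by simp
        show "\<bar>averaging K (\<lambda>x. \<bar>(averaging K ^^ m) h x\<bar>) x\<bar> \<le> B" for x
          by (rule averaging_bounded) (rule bb)
      qed (simp add: averaging_def)
      then show ?thesis using integral_averaging[of "\<lambda>x. \<bar>(averaging K ^^ m) h x\<bar>" B, OF bb] by (simp add: a_def)
    qed
    then show ?thesis using that by (rule lift_Suc_antimono_le)
  qed
  have "\<exists>m. a m < e" if e: "0 < e" for e
  proof (rule ccontr)
    assume "\<not> (\<exists>m. a m < e)"
    then have ge: "e \<le> a m" for m by (simp add: not_less)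
    \<comment> \<open>The denominator \<open>B + 1\<close> is positive also for \<open>B = 0\<close>.\<close>
    obtain F where F: "finite F" "measure_pmf.prob \<pi> (- F) < e / 4 / (B + 1)"
      using pmf_finite_set_approx[of "e / 4 / (B + 1)" \<pi>] e B by auto
    have "(B + 1) * measure_pmf.prob \<pi> (- F) \<le> e / 4" using F(2) B by (simp add: field_simps)
    then have FB: "B * measure_pmf.prob \<pi> (- F) \<le> e / 4"
      using measure_nonneg[of \<pi> "- F"] unfolding distrib_right by linarith
    \<comment> \<open>Any state serves as the place of cancellation.\<close>
    define z where "z = (undefined :: 's)"
    define q where "q = Min (insert 1 (pmf (K z) ` F))"
    have q: "0 < q" "\<And>y. y \<in> F \<Longrightarrow> q \<le> pmf (K z) y" using F(1) positive by (auto simp: q_def)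
    define k where "k = pmf \<pi> z * q * e / 2"
    have k: "0 < k" using invariant_pos[of z] q e by (simp add: k_def)
    have "a m \<le> a 0 - real m * k" for m
    proof (induction m)
      case (Suc m)
      then show ?case using step[OF ge F(1) FB, of q z m] q unfolding k_def[symmetric] by (simp add: algebra_simps)
    qed simp
    moreover obtain m :: nat where "a 0 / k < real m" using reals_Archimedean2 by blast
    then have "a 0 < real m * k" using k by (simp add: field_simps)
    ultimately show False using a0[of m] by (smt (verit))
  qed
  then have "\<exists>N. \<forall>n\<ge>N. \<bar>a n\<bar> < e" if "0 < e" for e
    using that dec a0 by (metis abs_of_nonneg le_less_trans)
  then show ?thesis unfolding a_def[symmetric] by (intro LIMSEQ_I) simp
qed

definition pair_law :: "('s \<times> 's) pmf" where
  "pair_law = bind_pmf \<pi> (\<lambda>x. map_pmf (Pair x) (K x))"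

abbreviation path_law :: "(nat \<Rightarrow> 's) measure" where
  "path_law \<equiv> markov_law \<pi> K"

lemma nn_integral_path_law_at: "(\<integral>\<^sup>+X. f (X t) \<partial>path_law) = (\<integral>\<^sup>+x. f x \<partial>\<pi>)"
proof (induction t arbitrary: f)
  case 0
  have "(\<integral>\<^sup>+X. f (path_prefix 0 X ! 0) \<partial>path_law) = (\<integral>\<^sup>+xs. f (xs ! 0) \<partial>chain_pmf \<pi> K 0)"
    by (rule nn_integral_markov_law_prefix)
  then show ?case by simp
next
  case (Suc t)
  have "(\<integral>\<^sup>+X. f (X (Suc t)) \<partial>path_law) = (\<integral>\<^sup>+X. (\<integral>\<^sup>+y. f y \<partial>K (X t)) \<partial>path_law)"
    by (rule nn_integral_markov_law_step[where f="\<lambda>_ y. f y"]) simp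
  also have "\<dots> = (\<integral>\<^sup>+x. (\<integral>\<^sup>+y. f y \<partial>K x) \<partial>\<pi>)" by (rule Suc.IH)
  also have "\<dots> = (\<integral>\<^sup>+x. f x \<partial>bind_pmf \<pi> K)" by simp
  finally show ?case by (simp add: invariant)
qed

lemma measurable_path_coords:
  "(\<lambda>X. (X t, X (Suc t))) \<in> path_law \<rightarrow>\<^sub>M count_space UNIV"
  unfolding measurable_cong_sets[OF sets_markov_law refl]
  by (rule measurable_prefix_dependent[where t="Suc t"]) auto

lemma distr_path_law_pair: "distr path_law (count_space UNIV) (\<lambda>X. (X t, X (Suc t))) = measure_pmf pair_law"
proof (rule measure_eqI)
  fix A :: "('s \<times> 's) set"
  have "emeasure (distr path_law (count_space UNIV) (\<lambda>X. (X t, X (Suc t)))) A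
      = (\<integral>\<^sup>+z. indicator A z \<partial>distr path_law (count_space UNIV) (\<lambda>X. (X t, X (Suc t))))" by simp
  also have "\<dots> = (\<integral>\<^sup>+X. indicator A (X t, X (Suc t)) \<partial>path_law)"
    by (rule nn_integral_distr[OF measurable_path_coords]) simp
  also have "\<dots> = (\<integral>\<^sup>+X. (\<integral>\<^sup>+y. indicator A (X t, y) \<partial>K (X t)) \<partial>path_law)"
    by (rule nn_integral_markov_law_step[where f="\<lambda>X y. indicator A (X t, y)"]) simp
  also have "\<dots> = (\<integral>\<^sup>+x. (\<integral>\<^sup>+y. indicator A (x, y) \<partial>K x) \<partial>\<pi>)" by (rule nn_integral_path_law_at)
  also have "\<dots> = (\<integral>\<^sup>+z. indicator A z \<partial>pair_law)" by (simp add: pair_law_def del: nn_integral_indicator)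
  finally show "emeasure (distr path_law (count_space UNIV) (\<lambda>X. (X t, X (Suc t)))) A = emeasure pair_law A" by simp
qed simp

lemma integral_path_law_pair:
  fixes g :: "'s \<times> 's \<Rightarrow> real"
  shows "(\<integral>X. g (X t, X (Suc t)) \<partial>path_law) = (\<integral>z. g z \<partial>pair_law)"
    "integrable path_law (\<lambda>X. g (X t, X (Suc t))) \<longleftrightarrow> integrable pair_law g"
  unfolding distr_path_law_pair[of t, symmetric]
  by (simp_all add: integral_distr[OF measurable_path_coords] integrable_distr_eq[OF measurable_path_coords])

lemma integral_pair_law_bounded:
  fixes g :: "'s \<times> 's \<Rightarrow> real"
  assumes "\<And>z. \<bar>g z\<bar> \<le> B"
  shows "(\<integral>z. g z \<partial>pair_law) = (\<integral>x. (\<integral>y. g (x, y) \<partial>K x) \<partial>\<pi>)"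
  unfolding pair_law_def by (subst integral_bind_pmf_bounded[OF assms]) simp

text \<open>
  Iterating the Markov property \<open>m\<close> times moves a function of the state at time \<open>s + m\<close> back to time \<open>s\<close>.
\<close>

lemma integral_path_law_lag:
  assumes dep: "\<And>X Y. (\<forall>i\<le>s. X i = Y i) \<Longrightarrow> f X = f Y"
    and bf: "\<And>X. \<bar>f X\<bar> \<le> C" and bh: "\<And>x. \<bar>h x\<bar> \<le> B"
  shows "(\<integral>X. f X * h (X (s + m)) \<partial>path_law) = (\<integral>X. f X * (averaging K ^^ m) h (X s) \<partial>path_law)"
  using bh
proof (induction m arbitrary: h)
  case (Suc m)
  have "(\<integral>X. f X * h (X (s + Suc m)) \<partial>path_law) = (\<integral>X. f X * h (X (Suc (s + m))) \<partial>path_law)" by simp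
  also have "\<dots> = (\<integral>X. (\<integral>y. f X * h y \<partial>K (X (s + m))) \<partial>path_law)"
  proof (rule integral_markov_law_step[where f="\<lambda>X y. f X * h y" and B="C * B"])
    show "f X * h y = f Y * h y" if "\<forall>i\<le>s + m. X i = Y i" for X Y y
      using dep[of X Y] that by simp
    show "\<bar>f X * h y\<bar> \<le> C * B" for X y
      unfolding abs_mult using bf[of X] Suc.prems[of y] by (intro mult_mono) auto
  qed
  also have "\<dots> = (\<integral>X. f X * averaging K h (X (s + m)) \<partial>path_law)" by (simp add: averaging_def)
  also have "\<dots> = (\<integral>X. f X * (averaging K ^^ m) (averaging K h) (X s) \<partial>path_law)"
    by (rule Suc.IH) (rule averaging_bounded[OF Suc.prems])
  finally show ?case by (simp only: funpow_Suc_right o_apply)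
qed simp

text \<open>
  Conditioning first on the past of the later pair and then on the state \<open>m\<close> steps earlier leaves the
  \<open>m\<close>-fold average of \<open>h\<close>, evaluated at a state whose law is \<open>\<pi>\<close>. The estimate tends to 0 with growing
  \<open>m\<close> once \<open>g\<close> has mean zero.
\<close>

lemma covariance_bound:
  fixes g :: "'s \<times> 's \<Rightarrow> real"
  assumes b: "\<And>z. \<bar>g z\<bar> \<le> B"
  defines "h \<equiv> \<lambda>x. \<integral>y. g (x, y) \<partial>K x"
  shows "\<bar>\<integral>X. g (X i, X (Suc i)) * g (X (Suc i + m), X (Suc (Suc i + m))) \<partial>path_law\<bar>
    \<le> B * (\<integral>x. \<bar>(averaging K ^^ m) h x\<bar> \<partial>\<pi>)"
proof -
  interpret P: prob_space path_law by (rule prob_space_markov_law)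
  have bh: "\<bar>h x\<bar> \<le> B" for x unfolding h_def by (rule abs_expectation_pmf_le) (rule b)
  have B: "0 \<le> B" using b[of undefined] by linarith
  note fp = averaging_funpow(1)[of h B, OF bh]
  let ?f = "\<lambda>X. g (X i, X (Suc i))" and ?u = "(averaging K ^^ m) h"
  have "(\<integral>X. ?f X * g (X (Suc i + m), X (Suc (Suc i + m))) \<partial>path_law)
      = (\<integral>X. (\<integral>y. ?f X * g (X (Suc i + m), y) \<partial>K (X (Suc i + m))) \<partial>path_law)"
  proof (rule integral_markov_law_step[where f="\<lambda>X y. ?f X * g (X (Suc i + m), y)" and B="B * B"])
    show "\<bar>?f X * g (X (Suc i + m), y)\<bar> \<le> B * B" for X y
      unfolding abs_mult using b B by (intro mult_mono) auto
  qed simp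
  also have "\<dots> = (\<integral>X. ?f X * h (X (Suc i + m)) \<partial>path_law)" by (simp add: h_def)
  also have "\<dots> = (\<integral>X. ?f X * ?u (X (Suc i)) \<partial>path_law)"
    by (rule integral_path_law_lag[where f="?f" and C=B and B=B]) (simp, rule b, rule bh)
  also have "\<bar>\<dots>\<bar> \<le> (\<integral>X. \<bar>?f X * ?u (X (Suc i))\<bar> \<partial>path_law)"
    by (rule integral_abs_bound)
  also have "\<dots> = (\<integral>z. \<bar>g z * ?u (snd z)\<bar> \<partial>pair_law)"
    using integral_path_law_pair(1)[of "\<lambda>z. \<bar>g z * ?u (snd z)\<bar>" i] by simp
  also have "\<dots> \<le> (\<integral>z. B * \<bar>?u (snd z)\<bar> \<partial>pair_law)"
  proof (rule integral_mono)
    have 1: "\<bar>\<bar>g z * ?u (snd z)\<bar>\<bar> \<le> B * B" "\<bar>B * \<bar>?u (snd z)\<bar>\<bar> \<le> B * B" for z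
      unfolding abs_mult using b[of z] B fp by (auto intro!: mult_mono)
    show "integrable pair_law (\<lambda>z. \<bar>g z * ?u (snd z)\<bar>)" by (rule integrable_pmf_bounded[OF 1(1)])
    show "integrable pair_law (\<lambda>z. B * \<bar>?u (snd z)\<bar>)" by (rule integrable_pmf_bounded[OF 1(2)])
    show "\<bar>g z * ?u (snd z)\<bar> \<le> B * \<bar>?u (snd z)\<bar>" for z
      unfolding abs_mult using b by (intro mult_right_mono) auto
  qed
  also have "\<dots> = B * (\<integral>z. \<bar>?u (snd z)\<bar> \<partial>pair_law)" by simp
  also have "(\<integral>z. \<bar>?u (snd z)\<bar> \<partial>pair_law) = (\<integral>x. (\<integral>y. \<bar>?u y\<bar> \<partial>K x) \<partial>\<pi>)"
    by (subst integral_pair_law_bounded[where B=B]) (simp_all add: fp)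
  also have "\<dots> = (\<integral>x. averaging K (\<lambda>x. \<bar>?u x\<bar>) x \<partial>\<pi>)"
    by (intro Bochner_Integration.integral_cong refl averaging_def[symmetric])
  also have "\<dots> = (\<integral>x. \<bar>?u x\<bar> \<partial>\<pi>)" by (rule integral_averaging[where B=B]) (simp add: fp)
  finally show ?thesis .
qed

text \<open>
  Induction on \<open>n\<close>: expanding the square adds a diagonal term and the covariances with the last
  summand, which are controlled by the lags \<open>n - 1, \<dots>, 0\<close>.
\<close>

lemma second_moment_bound:
  fixes g :: "'s \<times> 's \<Rightarrow> real"
  assumes b: "\<And>z. \<bar>g z\<bar> \<le> B"
  defines "a \<equiv> \<lambda>m. \<integral>x. \<bar>(averaging K ^^ m) (\<lambda>x. \<integral>y. g (x, y) \<partial>K x) x\<bar> \<partial>\<pi>"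
  shows "(\<integral>X. (\<Sum>i<n. g (X i, X (Suc i)))\<^sup>2 \<partial>path_law) \<le> real n * (B\<^sup>2 + 2 * B * (\<Sum>m<n. a m))"
proof (induction n)
  case (Suc n)
  interpret P: prob_space path_law by (rule prob_space_markov_law)
  let ?Y = "\<lambda>i X. g (X i, X (Suc i))"
  have B: "0 \<le> B" using b[of undefined] by linarith
  have a0: "0 \<le> a m" for m by (simp add: a_def)
  have m [measurable]: "?Y i \<in> borel_measurable path_law" for i
    by (rule measurable_compose[OF measurable_path_coords]) simp
  have i2: "integrable path_law (\<lambda>X. ?Y i X * ?Y j X)" for i j
  proof (rule P.integrable_const_bound[where B="B * B"])
    show "AE X in path_law. norm (?Y i X * ?Y j X) \<le> B * B"
      unfolding real_norm_def abs_mult using b B by (intro AE_I2 mult_mono) auto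
  qed measurable
  have sq: "(\<Sum>i<k. ?Y i X)\<^sup>2 = (\<Sum>i<k. \<Sum>j<k. ?Y i X * ?Y j X)" for k X
    by (simp add: power2_eq_square sum_product)
  have iS: "integrable path_law (\<lambda>X. (\<Sum>i<k. ?Y i X)\<^sup>2)" for k
    unfolding sq by (intro Bochner_Integration.integrable_sum i2)
  have "(\<integral>X. (\<Sum>i<Suc n. ?Y i X)\<^sup>2 \<partial>path_law)
      = (\<integral>X. (\<Sum>i<n. ?Y i X)\<^sup>2 + 2 * (\<Sum>i<n. ?Y i X * ?Y n X) + ?Y n X * ?Y n X \<partial>path_law)"
    by (simp add: power2_eq_square algebra_simps sum_distrib_left sum_distrib_right)
  also have "\<dots> = (\<integral>X. (\<Sum>i<n. ?Y i X)\<^sup>2 \<partial>path_law) + 2 * (\<Sum>i<n. \<integral>X. ?Y i X * ?Y n X \<partial>path_law)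
      + (\<integral>X. ?Y n X * ?Y n X \<partial>path_law)"
    using i2 iS by (simp add: Bochner_Integration.integral_sum)
  also have "(\<integral>X. ?Y n X * ?Y n X \<partial>path_law) \<le> B\<^sup>2"
  proof (rule P.integral_le_const[OF i2 AE_I2])
    fix X
    have "\<bar>?Y n X\<bar> * \<bar>?Y n X\<bar> \<le> B * B" using b B by (intro mult_mono) auto
    then show "?Y n X * ?Y n X \<le> B\<^sup>2" by (simp add: power2_eq_square abs_mult[symmetric])
  qed
  also have "(\<Sum>i<n. \<integral>X. ?Y i X * ?Y n X \<partial>path_law) \<le> (\<Sum>i<n. B * a (n - Suc i))"
  proof (rule sum_mono)
    fix i assume "i \<in> {..<n}"
    then have n: "Suc i + (n - Suc i) = n" by simp
    show "(\<integral>X. ?Y i X * ?Y n X \<partial>path_law) \<le> B * a (n - Suc i)"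
      using covariance_bound[of g B i "n - Suc i", OF b] unfolding n a_def by linarith
  qed
  also have "\<dots> = B * (\<Sum>m<n. a m)"
    unfolding sum_distrib_left[symmetric] by (simp add: sum.nat_diff_reindex)
  also have "(\<integral>X. (\<Sum>i<n. ?Y i X)\<^sup>2 \<partial>path_law) \<le> real n * (B\<^sup>2 + 2 * B * (\<Sum>m<n. a m))"
    by (rule Suc.IH)
  finally have "(\<integral>X. (\<Sum>i<Suc n. ?Y i X)\<^sup>2 \<partial>path_law)
      \<le> real n * (B\<^sup>2 + 2 * B * (\<Sum>m<n. a m)) + 2 * (B * (\<Sum>m<n. a m)) + B\<^sup>2" by simp
  also have "\<dots> = real (Suc n) * (B\<^sup>2 + 2 * B * (\<Sum>m<n. a m))" by (simp add: algebra_simps)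
  also have "\<dots> \<le> real (Suc n) * (B\<^sup>2 + 2 * B * (\<Sum>m<Suc n. a m))"
    using a0[of n] B by (intro mult_left_mono add_mono) auto
  finally show ?case .
qed simp

lemma bounded_L1_ergodic:
  fixes g :: "'s \<times> 's \<Rightarrow> real"
  assumes b: "\<And>z. \<bar>g z\<bar> \<le> B" and zero: "(\<integral>z. g z \<partial>pair_law) = 0"
  shows "(\<lambda>n. \<integral>X. \<bar>1 / real n * (\<Sum>i<n. g (X i, X (Suc i)))\<bar> \<partial>path_law) \<longlonglongrightarrow> 0"
proof -
  interpret P: prob_space path_law by (rule prob_space_markov_law)
  define h where "h x = (\<integral>y. g (x, y) \<partial>K x)" for x
  define a where "a m = (\<integral>x. \<bar>(averaging K ^^ m) h x\<bar> \<partial>\<pi>)" for m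
  have m: "(\<lambda>X. g (X i, X (Suc i))) \<in> borel_measurable path_law" for i
    by (rule measurable_compose[OF measurable_path_coords]) simp
  have bh: "\<bar>h x\<bar> \<le> B" for x unfolding h_def by (rule abs_expectation_pmf_le) (rule b)
  have "(\<integral>x. h x \<partial>\<pi>) = 0" using zero integral_pair_law_bounded[of g B, OF b] by (simp add: h_def)
  then have a: "a \<longlonglongrightarrow> 0" unfolding a_def using bh by (intro averaging_mixes[where B=B]) auto
  have "(\<lambda>n. B\<^sup>2 / real n + 2 * B * ((\<Sum>m<n. a m) / real n)) \<longlonglongrightarrow> 0 + 2 * B * 0"
    by (intro tendsto_intros cesaro_zero[OF a] lim_const_over_n)
  then have lim: "(\<lambda>n. sqrt (B\<^sup>2 / real n + 2 * B * ((\<Sum>m<n. a m) / real n))) \<longlonglongrightarrow> 0"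
    using tendsto_real_sqrt by fastforce
  show ?thesis
  proof (rule tendsto_sandwich[OF _ _ tendsto_const lim])
    show "\<forall>\<^sub>F n in sequentially. 0 \<le> (\<integral>X. \<bar>1 / real n * (\<Sum>i<n. g (X i, X (Suc i)))\<bar> \<partial>path_law)" by simp
    show "\<forall>\<^sub>F n in sequentially. (\<integral>X. \<bar>1 / real n * (\<Sum>i<n. g (X i, X (Suc i)))\<bar> \<partial>path_law)
        \<le> sqrt (B\<^sup>2 / real n + 2 * B * ((\<Sum>m<n. a m) / real n))"
    proof (rule eventually_sequentiallyI[of 1])
      fix n :: nat assume n: "1 \<le> n"
      have bd: "\<bar>1 / real n * (\<Sum>i<n. g (X i, X (Suc i)))\<bar> \<le> B" for X
      proof -
        have "\<bar>\<Sum>i<n. g (X i, X (Suc i))\<bar> \<le> (\<Sum>i<n. B)" by (intro order_trans[OF sum_abs] sum_mono b)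
        then show ?thesis using n by (simp add: field_simps)
      qed
      have "(\<integral>X. \<bar>1 / real n * (\<Sum>i<n. g (X i, X (Suc i)))\<bar> \<partial>path_law)
          \<le> sqrt (\<integral>X. (1 / real n * (\<Sum>i<n. g (X i, X (Suc i))))\<^sup>2 \<partial>path_law)"
        using m by (intro P.expectation_abs_le_sqrt[OF _ bd]) measurable
      also have "(\<integral>X. (1 / real n * (\<Sum>i<n. g (X i, X (Suc i))))\<^sup>2 \<partial>path_law)
          = 1 / (real n)\<^sup>2 * (\<integral>X. (\<Sum>i<n. g (X i, X (Suc i)))\<^sup>2 \<partial>path_law)"
        by (simp add: power_mult_distrib power_divide)
      also have "\<dots> \<le> 1 / (real n)\<^sup>2 * (real n * (B\<^sup>2 + 2 * B * (\<Sum>m<n. a m)))"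
        using second_moment_bound[of g B n, OF b] unfolding a_def h_def by (intro mult_left_mono) auto
      also have "\<dots> = B\<^sup>2 / real n + 2 * B * ((\<Sum>m<n. a m) / real n)"
        using n by (simp add: power2_eq_square field_simps)
      finally show "(\<integral>X. \<bar>1 / real n * (\<Sum>i<n. g (X i, X (Suc i)))\<bar> \<partial>path_law)
        \<le> sqrt (B\<^sup>2 / real n + 2 * B * ((\<Sum>m<n. a m) / real n))" by simp
    qed
  qed
qed

text \<open>
  Truncate \<open>g\<close> at height \<open>M\<close>. The bounded part is covered by the previous lemma, and by stationarity the
  remainder contributes its integral to the mean of every ergodic average, uniformly in \<open>n\<close>.
\<close>

theorem L1_ergodic:
  fixes g :: "'s \<times> 's \<Rightarrow> real"
  assumes int: "integrable pair_law g"
  shows "(\<lambda>n. \<integral>X. \<bar>1 / real n * (\<Sum>i<n. g (X i, X (Suc i))) - (\<integral>z. g z \<partial>pair_law)\<bar> \<partial>path_law) \<longlonglongrightarrow> 0"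
proof (rule LIMSEQ_I)
  interpret P: prob_space path_law by (rule prob_space_markov_law)
  fix r :: real assume r: "0 < r"
  define c where "c = (\<integral>z. g z \<partial>pair_law)"
  define t where "t M z = (if \<bar>g z\<bar> \<le> real M then g z else 0)" for M :: nat and z
  have "(\<lambda>M. \<integral>z. \<bar>g z - t M z\<bar> \<partial>pair_law) \<longlonglongrightarrow> (\<integral>z. 0 \<partial>pair_law)"
  proof (rule integral_dominated_convergence[where w="\<lambda>z. \<bar>g z\<bar>"])
    show "AE z in pair_law. (\<lambda>M. \<bar>g z - t M z\<bar>) \<longlonglongrightarrow> 0"
    proof (rule AE_I2)
      fix z
      obtain M0 :: nat where "\<bar>g z\<bar> \<le> real M0" using real_arch_simple by blast
      then have "\<bar>g z - t M z\<bar> = 0" if "M0 \<le> M" for M using that by (auto simp: t_def)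
      then show "(\<lambda>M. \<bar>g z - t M z\<bar>) \<longlonglongrightarrow> 0"
        by (intro tendsto_eventually eventually_sequentiallyI)
    qed
  qed (use int in \<open>auto simp: t_def\<close>)
  then have "(\<lambda>M. \<integral>z. \<bar>g z - t M z\<bar> \<partial>pair_law) \<longlonglongrightarrow> 0" by simp
  then have "eventually (\<lambda>M. (\<integral>z. \<bar>g z - t M z\<bar> \<partial>pair_law) < r / 3) sequentially"
    using r by (intro order_tendstoD) auto
  then obtain M where M: "(\<integral>z. \<bar>g z - t M z\<bar> \<partial>pair_law) < r / 3" by (auto simp: eventually_sequentially)
  have tb: "\<bar>t M z\<bar> \<le> real M" for z by (simp add: t_def)
  note it = integrable_pmf_bounded[of "t M" "real M" pair_law, OF tb]
  define cM where "cM = (\<integral>z. t M z \<partial>pair_law)"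
  have cM: "\<bar>cM\<bar> \<le> real M" unfolding cM_def by (rule abs_expectation_pmf_le) (rule tb)
  have "\<bar>cM - c\<bar> = \<bar>\<integral>z. g z - t M z \<partial>pair_law\<bar>" using int it by (simp add: c_def cM_def)
  also have "\<dots> \<le> (\<integral>z. \<bar>g z - t M z\<bar> \<partial>pair_law)" by (rule integral_abs_bound)
  finally have cc: "\<bar>cM - c\<bar> < r / 3" using M by simp
  define A where "A f n X = 1 / real n * (\<Sum>i<n. f (X i, X (Suc i)))" for f :: "'s \<times> 's \<Rightarrow> real" and n and X :: "nat \<Rightarrow> 's"
  have iA: "integrable path_law (A f n)" if "integrable pair_law f" for f n
    unfolding A_def[abs_def] using that
    by (intro integrable_mult_right Bochner_Integration.integrable_sum) (simp add: integral_path_law_pair(2))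
  have bM: "\<bar>t M z - cM\<bar> \<le> 2 * real M" for z using tb[of z] cM by linarith
  have "(\<lambda>n. \<integral>X. \<bar>A (\<lambda>z. t M z - cM) n X\<bar> \<partial>path_law) \<longlonglongrightarrow> 0"
    unfolding A_def using it by (intro bounded_L1_ergodic[OF bM]) (simp add: cM_def)
  from LIMSEQ_D[OF this, of "r / 3"] r obtain N where
    N: "\<And>n. N \<le> n \<Longrightarrow> (\<integral>X. \<bar>A (\<lambda>z. t M z - cM) n X\<bar> \<partial>path_law) < r / 3" by auto
  show "\<exists>no. \<forall>n\<ge>no. norm ((\<integral>X. \<bar>1 / real n * (\<Sum>i<n. g (X i, X (Suc i))) - (\<integral>z. g z \<partial>pair_law)\<bar> \<partial>path_law) - 0) < r"
  proof (intro exI allI impI)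
    fix n assume n: "max 1 N \<le> n"
    have split: "A g n X - c = A (\<lambda>z. g z - t M z) n X + A (\<lambda>z. t M z - cM) n X + (cM - c)" for X
      using n by (simp add: A_def sum_subtractf field_simps)
    have le: "\<bar>A f n X\<bar> \<le> A (\<lambda>z. \<bar>f z\<bar>) n X" for f X
      by (simp add: A_def abs_mult sum_abs mult_left_mono divide_right_mono)
    have ig: "integrable pair_law (\<lambda>z. g z - t M z)" "integrable pair_law (\<lambda>z. t M z - cM)"
      using int it by auto
    have one: "measure path_law UNIV = 1" using P.prob_space by (simp only: space_markov_law)
    have "(\<integral>X. \<bar>A g n X - c\<bar> \<partial>path_law)
        \<le> (\<integral>X. A (\<lambda>z. \<bar>g z - t M z\<bar>) n X + \<bar>A (\<lambda>z. t M z - cM) n X\<bar> + \<bar>cM - c\<bar> \<partial>path_law)"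
    proof (rule integral_mono)
      show "integrable path_law (\<lambda>X. \<bar>A g n X - c\<bar>)" using iA[OF int] by auto
      show "integrable path_law (\<lambda>X. A (\<lambda>z. \<bar>g z - t M z\<bar>) n X + \<bar>A (\<lambda>z. t M z - cM) n X\<bar> + \<bar>cM - c\<bar>)"
        using iA[OF ig(2)] iA[OF integrable_abs[OF ig(1)]] by auto
      show "\<bar>A g n X - c\<bar> \<le> A (\<lambda>z. \<bar>g z - t M z\<bar>) n X + \<bar>A (\<lambda>z. t M z - cM) n X\<bar> + \<bar>cM - c\<bar>" for X
        unfolding split using le[of "\<lambda>z. g z - t M z" X] by linarith
    qed
    also have "\<dots> = (\<integral>X. A (\<lambda>z. \<bar>g z - t M z\<bar>) n X \<partial>path_law)
        + (\<integral>X. \<bar>A (\<lambda>z. t M z - cM) n X\<bar> \<partial>path_law) + \<bar>cM - c\<bar>"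
      using iA[OF ig(2)] iA[OF integrable_abs[OF ig(1)]] one by simp
    also have "(\<integral>X. A (\<lambda>z. \<bar>g z - t M z\<bar>) n X \<partial>path_law) = (\<integral>z. \<bar>g z - t M z\<bar> \<partial>pair_law)"
    proof -
      let ?f = "\<lambda>z. \<bar>g z - t M z\<bar>"
      have "(\<integral>X. A ?f n X \<partial>path_law) = 1 / real n * (\<Sum>i<n. \<integral>X. ?f (X i, X (Suc i)) \<partial>path_law)"
        unfolding A_def using integrable_abs[OF ig(1)] integral_path_law_pair(2)[of ?f]
        by (simp add: Bochner_Integration.integral_sum)
      also have "\<dots> = (\<integral>z. ?f z \<partial>pair_law)" using n integral_path_law_pair(1)[of ?f] by simp
      finally show ?thesis .
    qed
    finally have "(\<integral>X. \<bar>A g n X - c\<bar> \<partial>path_law) < r" using M cc N[of n] n by simp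
    then show "norm ((\<integral>X. \<bar>1 / real n * (\<Sum>i<n. g (X i, X (Suc i))) - (\<integral>z. g z \<partial>pair_law)\<bar> \<partial>path_law) - 0) < r"
      by (simp add: A_def c_def)
  qed
qed

lemma map_fst_pair_law: "map_pmf fst pair_law = \<pi>"
  by (simp add: pair_law_def map_bind_pmf map_pmf_comp bind_return_pmf')

lemma map_snd_pair_law: "map_pmf snd pair_law = \<pi>"
  using invariant by (simp add: pair_law_def map_bind_pmf map_pmf_comp)

lemma integrable_pair_law_linear_growth:
  fixes f :: "'s \<Rightarrow> real" and g :: "'s \<times> 's \<Rightarrow> real"
  assumes f: "integrable \<pi> f" and le: "\<And>x y. \<bar>g (x, y)\<bar> \<le> C + A * f x + B * f y"
  shows "integrable pair_law g"
proof (rule Bochner_Integration.integrable_bound)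
  have "integrable pair_law (\<lambda>z. f (fst z))" "integrable pair_law (\<lambda>z. f (snd z))"
    using f integrable_map_pmf_eq[of fst pair_law f] integrable_map_pmf_eq[of snd pair_law f]
    by (simp_all add: map_fst_pair_law map_snd_pair_law)
  then show "integrable pair_law (\<lambda>z. C + A * f (fst z) + B * f (snd z))" by simp
  show "AE z in pair_law. norm (g z) \<le> norm (C + A * f (fst z) + B * f (snd z))"
    using le by (intro AE_I2) (metis abs_ge_self order_trans prod.collapse real_norm_def)
qed simp

text \<open>
  The stationary chain starts at \<open>z\<close> with probability \<open>pmf \<pi> z\<close>, and then it is the chain started at
  \<open>z\<close>. So statements in probability pass from the stationary chain to the chain from a point.
\<close>

lemma chain_from_point_le:
  "emeasure (chain_pmf (return_pmf z) K n) S \<le> emeasure (chain_pmf \<pi> K n) S / pmf \<pi> z"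
proof -
  have le: "ennreal (pmf (chain_pmf (return_pmf z) K n) xs) \<le> ennreal (1 / pmf \<pi> z) * ennreal (pmf (chain_pmf \<pi> K n) xs)" for xs
  proof (cases "xs \<in> set_pmf (chain_pmf (return_pmf z) K n)")
    case True
    then have len: "length xs = Suc n" by (rule length_chain_pmf)
    have "pmf (return_pmf z) (xs ! 0) \<le> 1 / pmf \<pi> z * pmf \<pi> (xs ! 0)"
      using invariant_pos[of z] by (auto simp: indicator_def)
    then have "pmf (chain_pmf (return_pmf z) K n) xs \<le> 1 / pmf \<pi> z * pmf (chain_pmf \<pi> K n) xs"
      unfolding pmf_chain_pmf[OF len] mult.assoc[symmetric] by (intro mult_right_mono prod_nonneg) auto
    then show ?thesis by (simp add: ennreal_mult'[symmetric] ennreal_leI)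
  next
    case False
    then have "pmf (chain_pmf (return_pmf z) K n) xs = 0" by (simp add: pmf_eq_0_set_pmf)
    then show ?thesis by simp
  qed
  have "emeasure (chain_pmf (return_pmf z) K n) S
      = (\<integral>\<^sup>+xs. ennreal (pmf (chain_pmf (return_pmf z) K n) xs) * indicator S xs \<partial>count_space UNIV)"
    by (simp add: nn_integral_measure_pmf[symmetric])
  also have "\<dots> \<le> (\<integral>\<^sup>+xs. ennreal (1 / pmf \<pi> z) * (ennreal (pmf (chain_pmf \<pi> K n) xs) * indicator S xs) \<partial>count_space UNIV)"
    using le by (intro nn_integral_mono) (auto simp: mult.assoc[symmetric] intro!: mult_right_mono)
  also have "\<dots> = ennreal (1 / pmf \<pi> z) * (\<integral>\<^sup>+xs. ennreal (pmf (chain_pmf \<pi> K n) xs) * indicator S xs \<partial>count_space UNIV)"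
    by (rule nn_integral_cmult) simp
  also have "\<dots> = ennreal (1 / pmf \<pi> z) * emeasure (chain_pmf \<pi> K n) S"
    by (simp add: nn_integral_measure_pmf[symmetric])
  also have "\<dots> = emeasure (chain_pmf \<pi> K n) S / pmf \<pi> z"
    using invariant_pos[of z] by (simp add: divide_ennreal_def inverse_ennreal inverse_eq_divide mult.commute)
  finally show ?thesis .
qed

end

section \<open>The environment and the invariant law\<close>

abbreviation (input) single_site :: "real measure \<Rightarrow> bool" where
  "single_site \<nu> \<equiv> \<nu> \<in> space (prob_algebra unit_borel)"

lemma single_site_props:
  assumes "single_site \<nu>"
  shows "prob_space \<nu>" "sets \<nu> = sets unit_borel" "space \<nu> = {0<..<1}"
proof -
  show "prob_space \<nu>" "sets \<nu> = sets unit_borel" using assms by (simp_all add: space_prob_algebra)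
  then show "space \<nu> = {0<..<1}"
    using sets_eq_imp_space_eq[of \<nu> unit_borel] by (simp add: space_restrict_space)
qed

lemma measurable_single_site:
  assumes "single_site \<nu>" "f \<in> borel \<rightarrow>\<^sub>M N"
  shows "f \<in> \<nu> \<rightarrow>\<^sub>M N"
  using measurable_restrict_space1[OF assms(2), of "{0<..<1}"]
  by (simp add: measurable_cong_sets[OF single_site_props(2)[OF assms(1)] refl])

lemma sets_env_law: "single_site \<nu> \<Longrightarrow> sets (env_law \<nu>) = sets env_space"
  using env_law_in_prob_algebra by (auto simp: space_prob_algebra)

lemma space_env_law: "single_site \<nu> \<Longrightarrow> w \<in> space (env_law \<nu>) \<longleftrightarrow> (\<forall>x. 0 < w x \<and> w x < 1)"
  using sets_eq_imp_space_eq[OF sets_env_law] space_env_space by blast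

lemma prob_space_env_law: "single_site \<nu> \<Longrightarrow> prob_space (env_law \<nu>)"
  using env_law_in_prob_algebra by (auto simp: space_prob_algebra)

lemma measurable_env_coord:
  assumes "single_site \<nu>" shows "(\<lambda>w. w x) \<in> borel_measurable (env_law \<nu>)"
proof -
  have "(\<lambda>w. w x) \<in> borel_measurable env_space"
    by (rule measurable_compose[OF measurable_component_singleton])
       (auto intro: measurable_restrict_space1)
  then show ?thesis by (simp add: measurable_cong_sets[OF sets_env_law[OF assms] refl])
qed

lemma distr_env_coord: "single_site \<nu> \<Longrightarrow> distr (env_law \<nu>) \<nu> (\<lambda>w. w x) = \<nu>"
  unfolding env_law_def by (rule distr_PiM_component) (auto dest: single_site_props)

text \<open>
  Independence of the sites, for products over finitely many of them.
\<close>

lemma nn_integral_env_prod: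
  fixes f :: "int \<Rightarrow> real \<Rightarrow> ennreal"
  assumes \<nu>: "single_site \<nu>" and J: "finite J" and m: "\<And>k. k \<in> J \<Longrightarrow> f k \<in> borel_measurable \<nu>"
  shows "(\<integral>\<^sup>+w. (\<Prod>k\<in>J. f k (w k)) \<partial>env_law \<nu>) = (\<Prod>k\<in>J. \<integral>\<^sup>+a. f k a \<partial>\<nu>)"
proof -
  interpret nu: prob_space \<nu> by (rule single_site_props[OF \<nu>])
  interpret PP: product_prob_space "\<lambda>_::int. \<nu>" UNIV ..
  have m': "(\<lambda>w. f k (w k)) \<in> borel_measurable (PiM J (\<lambda>_. \<nu>))" if "k \<in> J" for k
  proof -
    have "(\<lambda>w. w k) \<in> PiM J (\<lambda>_. \<nu>) \<rightarrow>\<^sub>M \<nu>" using that by (rule measurable_component_singleton)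
    from measurable_compose[OF this m[OF that]] show ?thesis .
  qed
  have "(\<Prod>k\<in>J. \<integral>\<^sup>+a. f k a \<partial>\<nu>) = (\<integral>\<^sup>+w. (\<Prod>k\<in>J. f k (w k)) \<partial>PiM J (\<lambda>_. \<nu>))"
    using m J by (subst PP.product_nn_integral_prod) auto
  also have "\<dots> = (\<integral>\<^sup>+w. (\<Prod>k\<in>J. f k (w k)) \<partial>distr (PiM UNIV (\<lambda>_. \<nu>)) (PiM J (\<lambda>_. \<nu>)) (\<lambda>x. restrict x J))"
    unfolding PP.distr_PiM_restrict_finite[OF J subset_UNIV] ..
  also have "\<dots> = (\<integral>\<^sup>+w. (\<Prod>k\<in>J. f k (restrict w J k)) \<partial>env_law \<nu>)"
    unfolding env_law_def
  proof (rule nn_integral_distr[where f = "\<lambda>w. \<Prod>k\<in>J. f k (w k)"])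
    show "(\<lambda>x. restrict x J) \<in> PiM UNIV (\<lambda>_. \<nu>) \<rightarrow>\<^sub>M PiM J (\<lambda>_. \<nu>)"
      by (rule measurable_restrict_subset[OF subset_UNIV])
  qed (use m' in \<open>auto intro!: borel_measurable_prod_ennreal\<close>)
  finally show ?thesis by simp
qed

text \<open>
  The reciprocal of \<open>env_S\<close>, with the sites \<open>1, 2, \<dots>\<close> renumbered from 0. On one-sided sequences the
  shift of the environment becomes \<open>case_nat\<close>.
\<close>

definition odds_series :: "(nat \<Rightarrow> real) \<Rightarrow> ennreal" where
  "odds_series s = (\<Sum>n. \<Prod>k<n. ennreal ((1 - s k) / s k))"

lemma env_S_eq: "env_S w = enn2real (inverse (odds_series (\<lambda>n. w (int n + 1))))"
proof -
  have "(\<Prod>k=1..n. ennreal (rho w (int k))) = (\<Prod>k<n. ennreal ((1 - w (int k + 1)) / w (int k + 1)))" for n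
    using prod.atLeast1_atMost_eq[of "\<lambda>k. ennreal (rho w (int k))" n] by (simp add: rho_def add.commute)
  then show ?thesis by (simp add: env_S_def odds_series_def)
qed

lemma odds_series_ge_1: "1 \<le> odds_series s"
  unfolding odds_series_def
  using sum_le_suminf[of "\<lambda>n. \<Prod>k<n. ennreal ((1 - s k) / s k)" "{0}"] by simp

lemma odds_series_case_nat: "odds_series (case_nat a s) = 1 + ennreal ((1 - a) / a) * odds_series s"
proof -
  have "odds_series (case_nat a s)
      = (\<Prod>k<0. ennreal ((1 - case_nat a s k) / case_nat a s k))
        + (\<Sum>n. \<Prod>k<Suc n. ennreal ((1 - case_nat a s k) / case_nat a s k))"
    unfolding odds_series_def
    using suminf_offset[of "\<lambda>n. \<Prod>k<n. ennreal ((1 - case_nat a s k) / case_nat a s k)" 1] by simp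
  also have "\<dots> = 1 + (\<Sum>n. ennreal ((1 - a) / a) * (\<Prod>k<n. ennreal ((1 - s k) / s k)))"
    unfolding prod.lessThan_Suc_shift by simp
  also have "\<dots> = 1 + ennreal ((1 - a) / a) * odds_series s"
    by (simp add: odds_series_def ennreal_suminf_cmult)
  finally show ?thesis .
qed

lemma enn2real_inverse_eq:
  assumes "r \<noteq> \<infinity>" "r \<noteq> 0"
  shows "enn2real (inverse r) = 1 / enn2real r" "0 < enn2real r"
proof -
  obtain x where x: "r = ennreal x" "0 \<le> x" using assms(1) by (cases r) auto
  with assms(2) have "0 < x" by (cases "x = 0") auto
  with x show "enn2real (inverse r) = 1 / enn2real r" "0 < enn2real r"
    by (simp_all add: inverse_ennreal inverse_eq_divide)
qed

lemma odds_series_env_S: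
  assumes "0 < env_S w"
  shows "odds_series (\<lambda>n. w (int n + 1)) = ennreal (1 / env_S w)"
proof -
  let ?r = "odds_series (\<lambda>n. w (int n + 1))"
  have "?r \<noteq> \<infinity>" using assms unfolding env_S_eq by auto
  moreover have "?r \<noteq> 0" using odds_series_ge_1[of "\<lambda>n. w (int n + 1)"] by auto
  ultimately show ?thesis
    using enn2real_inverse_eq[of ?r] unfolding env_S_eq by (simp add: less_top)
qed

lemma env_S_step:
  assumes a: "0 < a" "a < 1" and s: "odds_series s = ennreal (1 / t)" "0 < t" "t \<le> 1"
  shows "enn2real (inverse (odds_series (case_nat a s))) = a * t / (1 - a * (1 - t))"
proof -
  have "odds_series (case_nat a s) = ennreal (1 + (1 - a) / a * (1 / t))"
    using a s by (simp add: odds_series_case_nat ennreal_mult[symmetric] ennreal_1[symmetric] ennreal_plus[symmetric]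
        del: ennreal_1 ennreal_plus)
  moreover have "0 < 1 + (1 - a) / a * (1 / t)" using a s by (intro add_pos_nonneg) auto
  ultimately have "enn2real (inverse (odds_series (case_nat a s))) = 1 / (1 + (1 - a) / a * (1 / t))"
    by (simp add: inverse_ennreal inverse_eq_divide)
  also have "\<dots> = a * t / (1 - a * (1 - t))"
    using a s by (simp add: divide_simps) (simp add: algebra_simps)
  finally show ?thesis .
qed

text \<open>
  Putting an independent site in front of an i.i.d. sequence does not change its law, while it changes the
  value \<open>t\<close> of \<open>env_S\<close> into \<open>a * t / (1 - a * (1 - t))\<close> by \<open>odds_series_case_nat\<close>.
\<close>

lemma nn_integral_env_S_step:
  assumes \<nu>: "single_site \<nu>" and lt: "(\<integral>\<^sup>+w. ennreal (rho w 0) \<partial>env_law \<nu>) < 1"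
    and [measurable]: "f \<in> borel_measurable borel"
  shows "(\<integral>\<^sup>+w. f (env_S w) \<partial>env_law \<nu>)
    = (\<integral>\<^sup>+w. (\<integral>\<^sup>+a. f (a * env_S w / (1 - a * (1 - env_S w))) \<partial>\<nu>) \<partial>env_law \<nu>)"
proof -
  interpret nu: prob_space \<nu> by (rule single_site_props[OF \<nu>])
  \<comment> \<open>Restricted to the sites \<open>1, 2, \<dots>\<close> the environment is an i.i.d. sequence indexed by \<open>nat\<close>.\<close>
  interpret S: sequence_space \<nu> ..
  let ?S = "PiM (UNIV :: nat set) (\<lambda>_. \<nu>)"
  interpret PS: prob_space ?S by (rule S.prob_space_axioms)
  interpret pair: pair_prob_space \<nu> ?S ..
  let ?sh = "\<lambda>w n. w (int n + 1) :: real"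
  have c [measurable]: "(\<lambda>s. s k) \<in> borel_measurable ?S" for k
    by (rule measurable_compose[OF measurable_component_singleton]) (auto intro: measurable_single_site[OF \<nu>])
  have R [measurable]: "odds_series \<in> borel_measurable ?S" unfolding odds_series_def[abs_def] by measurable
  have shm: "?sh \<in> env_law \<nu> \<rightarrow>\<^sub>M ?S"
    unfolding env_law_def by (rule measurable_PiM_single') (auto simp: space_PiM)
  have sh: "distr (env_law \<nu>) ?S ?sh = ?S"
    using distr_PiM_reindex[of UNIV "\<lambda>_::int. \<nu>" "\<lambda>n::nat. int n + 1" UNIV] nu.prob_space_axioms
    by (simp add: env_law_def inj_on_def restrict_def)
  define F where "F s = f (enn2real (inverse (odds_series s)))" for s
  have F [measurable]: "F \<in> borel_measurable ?S" unfolding F_def[abs_def] by measurable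
  have env: "(\<integral>\<^sup>+w. g (?sh w) \<partial>env_law \<nu>) = (\<integral>\<^sup>+s. g s \<partial>?S)" if "g \<in> borel_measurable ?S" for g
    using nn_integral_distr[OF shm, of g] that by (simp add: sh)
  have cn: "(\<lambda>(a, s). case_nat a s) \<in> \<nu> \<Otimes>\<^sub>M ?S \<rightarrow>\<^sub>M ?S" by measurable
  then have [measurable]: "(\<lambda>z. F (case_nat (fst z) (snd z))) \<in> borel_measurable (\<nu> \<Otimes>\<^sub>M ?S)"
    using measurable_compose[OF cn F] by (simp add: case_prod_beta)
  have "(\<integral>\<^sup>+w. f (env_S w) \<partial>env_law \<nu>) = (\<integral>\<^sup>+s. F s \<partial>?S)"
    using env[OF F] unfolding F_def env_S_eq .
  also have "\<dots> = (\<integral>\<^sup>+s. F s \<partial>distr (\<nu> \<Otimes>\<^sub>M ?S) ?S (\<lambda>(a, s). case_nat a s))"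
    by (simp add: S.PiM_iter)
  also have "\<dots> = (\<integral>\<^sup>+z. F (case_nat (fst z) (snd z)) \<partial>(\<nu> \<Otimes>\<^sub>M ?S))"
    using nn_integral_distr[OF cn, of F] by (simp add: case_prod_beta)
  also have "\<dots> = (\<integral>\<^sup>+s. (\<integral>\<^sup>+a. F (case_nat a s) \<partial>\<nu>) \<partial>?S)"
    by (subst pair.nn_integral_snd[symmetric]) auto
  also have "\<dots> = (\<integral>\<^sup>+w. (\<integral>\<^sup>+a. F (case_nat a (?sh w)) \<partial>\<nu>) \<partial>env_law \<nu>)"
    by (rule env[symmetric]) measurable
  also have "\<dots> = (\<integral>\<^sup>+w. (\<integral>\<^sup>+a. f (a * env_S w / (1 - a * (1 - env_S w))) \<partial>\<nu>) \<partial>env_law \<nu>)"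
  proof (rule nn_integral_cong_AE, use AE_env_S_pos[OF \<nu> lt] in eventually_elim, rule nn_integral_cong)
    fix w a assume w: "0 < env_S w" and "a \<in> space \<nu>"
    then have "0 < a" "a < 1" using single_site_props[OF \<nu>] by auto
    then show "F (case_nat a (?sh w)) = f (a * env_S w / (1 - a * (1 - env_S w)))"
      unfolding F_def using env_S_step[OF _ _ odds_series_env_S[OF w] w env_S_bounds(2)] by simp
  qed
  finally show ?thesis .
qed

text \<open>
  One step of the chain from \<open>x\<close> counts the failures before the success number \<open>x + 1\<close>, with a random
  success probability.
\<close>

lemma ennreal_pmf_Q_kernel:
  assumes "single_site \<nu>"
  shows "ennreal (pmf (Q_kernel \<nu> x) y) = (\<integral>\<^sup>+a. ennreal (pmf (neg_binomial_pmf (x + 1) a) y) \<partial>\<nu>)"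
proof -
  note b = phi_integral_bounds[OF assms, of x y]
  have "pmf (Q_kernel \<nu> x) y = (\<integral>a. real ((x + y) choose x) * (a ^ (x + 1) * (1 - a) ^ y) \<partial>\<nu>)"
    unfolding pmf_Q_kernel[OF assms] phi_def using b by simp
  also have "ennreal \<dots> = (\<integral>\<^sup>+a. ennreal (real ((x + y) choose x) * (a ^ (x + 1) * (1 - a) ^ y)) \<partial>\<nu>)"
    using b(1) by (intro nn_integral_eq_integral[symmetric] AE_I2) (auto simp: single_site_props[OF assms])
  also have "\<dots> = (\<integral>\<^sup>+a. ennreal (pmf (neg_binomial_pmf (x + 1) a) y) \<partial>\<nu>)"
  proof (rule nn_integral_cong)
    fix a assume "a \<in> space \<nu>"
    moreover have "(y + x) choose y = (x + y) choose x"
      using binomial_symmetric[of y "y + x"] by (simp add: add.commute)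
    ultimately show "ennreal (real ((x + y) choose x) * (a ^ (x + 1) * (1 - a) ^ y))
        = ennreal (pmf (neg_binomial_pmf (x + 1) a) y)"
      by (subst pmf_neg_binomial) (auto simp: single_site_props[OF assms] mult.assoc)
  qed
  finally show ?thesis .
qed

lemma Q_kernel_pos: "single_site \<nu> \<Longrightarrow> 0 < pmf (Q_kernel \<nu> x) y"
  by (simp add: pmf_Q_kernel)

lemma measurable_pmf_neg_binomial:
  assumes \<nu>: "single_site \<nu>"
  shows "(\<lambda>a. ennreal (pmf (neg_binomial_pmf x a) y)) \<in> borel_measurable \<nu>"
proof -
  have "(\<lambda>a. ennreal (pmf (neg_binomial_pmf x a) y)) \<in> borel_measurable \<nu> \<longleftrightarrow>
    (\<lambda>a. ennreal (real ((y + x - 1) choose y) * a ^ x * (1 - a) ^ y)) \<in> borel_measurable \<nu>"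
    by (intro measurable_cong) (subst pmf_neg_binomial, auto simp: single_site_props[OF \<nu>])
  also have \<dots> by (rule measurable_single_site[OF \<nu>]) measurable
  finally show ?thesis .
qed

text \<open>
  With \<open>p = 1 - a * (1 - t)\<close>, the summands are, up to a constant factor, the probabilities of the negative
  binomial law with parameters \<open>y + 1\<close> and \<open>p\<close>, so they add up to that factor.
\<close>

lemma geometric_neg_binomial_mixture:
  assumes a: "0 < a" "a < 1" and t: "0 < t" "t \<le> 1"
  defines "t' \<equiv> a * t / (1 - a * (1 - t))"
  shows "(\<Sum>x. ennreal (t * (1 - t) ^ x) * ennreal (pmf (neg_binomial_pmf (x + 1) a) y)) = ennreal (t' * (1 - t') ^ y)"
proof -
  define p where "p = 1 - a * (1 - t)"
  have "a * (1 - t) \<le> a * 1" using a t by (intro mult_left_mono) auto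
  moreover have "0 \<le> a * (1 - t)" using a t by simp
  ultimately have p: "0 < p" "p \<le> 1" using a unfolding p_def by linarith+
  have t1: "1 - t' = (1 - a) / p"
    using p unfolding t'_def p_def[symmetric] by (simp add: field_simps) (simp add: p_def algebra_simps)
  define C where "C = a * t * (1 - a) ^ y / p ^ (y + 1)"
  have C: "C = t' * (1 - t') ^ y"
    unfolding t1 by (simp add: C_def t'_def p_def[symmetric] power_divide)
  have C0: "0 \<le> C" using a t p by (simp add: C_def)
  have "t * (1 - t) ^ x * pmf (neg_binomial_pmf (x + 1) a) y = C * pmf (neg_binomial_pmf (y + 1) p) x" for x
  proof -
    have "(y + x) choose y = (x + y) choose x"
      using binomial_symmetric[of y "y + x"] by (simp add: add.commute)
    moreover have "(1 - p) ^ x = a ^ x * (1 - t) ^ x" by (simp add: p_def power_mult_distrib)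
    ultimately show ?thesis
      using a p by (subst (1 2) pmf_neg_binomial) (auto simp: C_def field_simps)
  qed
  then have "(\<Sum>x. ennreal (t * (1 - t) ^ x) * ennreal (pmf (neg_binomial_pmf (x + 1) a) y))
      = (\<Sum>x. ennreal C * ennreal (pmf (neg_binomial_pmf (y + 1) p) x))"
    using t C0 by (simp add: ennreal_mult'[symmetric])
  also have "\<dots> = ennreal C * (\<Sum>x. ennreal (pmf (neg_binomial_pmf (y + 1) p) x))"
    by (rule ennreal_suminf_cmult)
  also have "(\<Sum>x. ennreal (pmf (neg_binomial_pmf (y + 1) p) x)) = 1"
    by (simp add: nn_integral_count_space_nat[symmetric] nn_integral_pmf_eq_1)
  finally show ?thesis by (simp add: C)
qed

lemma ennreal_pmf_pi_star:
  assumes \<nu>: "single_site \<nu>" and lt: "(\<integral>\<^sup>+w. ennreal (rho w 0) \<partial>env_law \<nu>) < 1"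
  shows "ennreal (pmf (pi_star \<nu>) k) = (\<integral>\<^sup>+w. ennreal (env_S w * (1 - env_S w) ^ k) \<partial>env_law \<nu>)"
proof -
  interpret prob_space "env_law \<nu>" by (rule prob_space_env_law[OF \<nu>])
  note [measurable] = measurable_env_S[OF \<nu>]
  have b: "0 \<le> env_S w * (1 - env_S w) ^ k" "env_S w * (1 - env_S w) ^ k \<le> 1" for w
    using env_S_bounds[of w] by (auto intro!: mult_le_one power_le_one)
  show ?thesis unfolding pmf_pi_star[OF assms]
    using b by (intro nn_integral_eq_integral[symmetric] integrable_const_bound[where B=1] AE_I2) auto
qed

lemma nn_integral_pi_star:
  assumes \<nu>: "single_site \<nu>" and lt: "(\<integral>\<^sup>+w. ennreal (rho w 0) \<partial>env_law \<nu>) < 1"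
  shows "(\<integral>\<^sup>+x. f x \<partial>pi_star \<nu>) = (\<integral>\<^sup>+w. (\<Sum>x. ennreal (env_S w * (1 - env_S w) ^ x) * f x) \<partial>env_law \<nu>)"
proof -
  note [measurable] = measurable_env_S[OF \<nu>]
  have "(\<integral>\<^sup>+x. f x \<partial>pi_star \<nu>) = (\<Sum>x. ennreal (pmf (pi_star \<nu>) x) * f x)"
    by (simp add: nn_integral_measure_pmf nn_integral_count_space_nat)
  also have "\<dots> = (\<Sum>x. \<integral>\<^sup>+w. ennreal (env_S w * (1 - env_S w) ^ x) * f x \<partial>env_law \<nu>)"
    unfolding ennreal_pmf_pi_star[OF assms] by (subst nn_integral_multc) auto
  also have "\<dots> = (\<integral>\<^sup>+w. (\<Sum>x. ennreal (env_S w * (1 - env_S w) ^ x) * f x) \<partial>env_law \<nu>)"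
    by (rule nn_integral_suminf[symmetric]) measurable
  finally show ?thesis .
qed

text \<open>
  Given the environment this is \<open>geometric_neg_binomial_mixture\<close>; \<open>nn_integral_env_S_step\<close> identifies the
  new parameter with \<open>env_S\<close> in law.
\<close>

lemma pi_star_invariant:
  assumes \<nu>: "single_site \<nu>" and lt: "(\<integral>\<^sup>+w. ennreal (rho w 0) \<partial>env_law \<nu>) < 1"
  shows "bind_pmf (pi_star \<nu>) (Q_kernel \<nu>) = pi_star \<nu>"
proof (rule pmf_eqI)
  fix y
  note [measurable] = measurable_env_S[OF \<nu>]
  note m = measurable_pmf_neg_binomial[OF \<nu>]
  have "ennreal (pmf (bind_pmf (pi_star \<nu>) (Q_kernel \<nu>)) y)
      = (\<integral>\<^sup>+w. (\<Sum>x. ennreal (env_S w * (1 - env_S w) ^ x) * ennreal (pmf (Q_kernel \<nu> x) y)) \<partial>env_law \<nu>)"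
    by (simp only: ennreal_pmf_bind nn_integral_pi_star[OF assms])
  also have "\<dots> = (\<integral>\<^sup>+w. (\<integral>\<^sup>+a. (\<Sum>x. ennreal (env_S w * (1 - env_S w) ^ x)
      * ennreal (pmf (neg_binomial_pmf (x + 1) a) y)) \<partial>\<nu>) \<partial>env_law \<nu>)"
    unfolding ennreal_pmf_Q_kernel[OF \<nu>] using m
    by (intro nn_integral_cong) (subst nn_integral_suminf, auto simp: nn_integral_cmult)
  also have "\<dots> = (\<integral>\<^sup>+w. (\<integral>\<^sup>+a. (\<lambda>t. ennreal (t * (1 - t) ^ y)) (a * env_S w / (1 - a * (1 - env_S w))) \<partial>\<nu>) \<partial>env_law \<nu>)"
  proof (rule nn_integral_cong_AE, use AE_env_S_pos[OF assms] in eventually_elim, rule nn_integral_cong)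
    fix w a assume w: "0 < env_S w" and "a \<in> space \<nu>"
    then have "0 < a" "a < 1" using single_site_props[OF \<nu>] by auto
    from geometric_neg_binomial_mixture[OF this w env_S_bounds(2)]
    show "(\<Sum>x. ennreal (env_S w * (1 - env_S w) ^ x) * ennreal (pmf (neg_binomial_pmf (x + 1) a) y))
      = (\<lambda>t. ennreal (t * (1 - t) ^ y)) (a * env_S w / (1 - a * (1 - env_S w)))" by simp
  qed
  also have "\<dots> = (\<integral>\<^sup>+w. ennreal (env_S w * (1 - env_S w) ^ y) \<partial>env_law \<nu>)"
    by (rule nn_integral_env_S_step[OF assms, symmetric]) measurable
  also have "\<dots> = ennreal (pmf (pi_star \<nu>) y)" by (rule ennreal_pmf_pi_star[OF assms, symmetric])
  finally show "pmf (bind_pmf (pi_star \<nu>) (Q_kernel \<nu>)) y = pmf (pi_star \<nu>) y" by simp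
qed

text \<open>
  A geometric variable with parameter \<open>t\<close> has mean \<open>(1 - t) / t\<close>, and \<open>1 / env_S\<close> is a series whose terms
  have the means \<open>r ^ n\<close> with \<open>r < 1\<close>.
\<close>

lemma integrable_pi_star_real:
  assumes \<nu>: "single_site \<nu>" and lt: "(\<integral>\<^sup>+w. ennreal (rho w 0) \<partial>env_law \<nu>) < 1"
  shows "integrable (pi_star \<nu>) real"
proof -
  let ?r = "\<integral>\<^sup>+w. ennreal (rho w 0) \<partial>env_law \<nu>"
  define r where "r = enn2real ?r"
  have r: "?r = ennreal r" "0 \<le> r"
    using lt less_trans[OF lt ennreal_one_less_top] by (auto simp: r_def)
  with lt have r1: "r < 1" by (simp add: ennreal_less_one_iff)
  note [measurable] = measurable_env_coord[OF \<nu>]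
  have m: "(\<lambda>w. \<Prod>k=1..n. ennreal (rho w (int k))) \<in> borel_measurable (env_law \<nu>)" for n
    unfolding rho_def by measurable
  have "(\<integral>\<^sup>+x. ennreal (real x) \<partial>pi_star \<nu>)
      \<le> (\<integral>\<^sup>+w. (\<Sum>n. \<Prod>k=1..n. ennreal (rho w (int k))) \<partial>env_law \<nu>)"
    unfolding nn_integral_pi_star[OF assms]
  proof (rule nn_integral_mono_AE, use AE_env_S_pos[OF assms] in eventually_elim)
    fix w assume w: "0 < env_S w"
    let ?t = "env_S w"
    have t: "?t \<in> {0<..1}" using w env_S_bounds[of w] by simp
    have "(\<Sum>x. ennreal (?t * (1 - ?t) ^ x) * ennreal (real x)) = (\<integral>\<^sup>+x. of_nat x \<partial>neg_binomial_pmf 1 ?t)"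
      unfolding nn_integral_measure_pmf nn_integral_count_space_nat
      by (subst pmf_neg_binomial[OF t]) (simp add: ennreal_of_nat_eq_real_of_nat)
    also have "\<dots> = ennreal ((1 - ?t) / ?t)" using nn_integral_neg_binomial_pmf_real[OF t, of 1] by simp
    also have "\<dots> \<le> ennreal (1 / ?t)" using w by (intro ennreal_leI divide_right_mono) auto
    also have "\<dots> = (\<Sum>n. \<Prod>k=1..n. ennreal (rho w (int k)))"
      unfolding odds_series_env_S[OF w, symmetric] odds_series_def
      using prod.atLeast1_atMost_eq[of "\<lambda>k. ennreal (rho w (int k))"] by (simp add: rho_def add.commute)
    finally show "(\<Sum>x. ennreal (?t * (1 - ?t) ^ x) * ennreal (real x))
        \<le> (\<Sum>n. \<Prod>k=1..n. ennreal (rho w (int k)))" .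
  qed
  also have "\<dots> = (\<Sum>n. ennreal r ^ n)"
    unfolding nn_integral_suminf[OF m] env_law_rho_product[OF \<nu>] r ..
  also have "\<dots> = (\<Sum>n. ennreal (r ^ n))" using r by (simp add: ennreal_power)
  also have "\<dots> = ennreal (1 / (1 - r))"
    using r r1 by (intro suminf_ennreal_eq geometric_sums) auto
  also have "\<dots> < \<infinity>" by simp
  finally show ?thesis by (intro integrableI_nonneg) auto
qed

section \<open>Crossing numbers of the walk\<close>

lemma nn_integral_walk_kernel:
  assumes "0 \<le> w x" "w x \<le> 1"
  shows "(\<integral>\<^sup>+y. f y \<partial>walk_kernel w x) = ennreal (w x) * f (x + 1) + ennreal (1 - w x) * f (x - 1)"
  using assms by (simp add: walk_kernel_def mult.commute)

definition below :: "nat \<Rightarrow> nat \<Rightarrow> (nat \<Rightarrow> int) \<Rightarrow> bool" where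
  "below n t X \<longleftrightarrow> (\<forall>s\<le>t. X s < int n)"

definition left_count :: "nat \<Rightarrow> (nat \<Rightarrow> int) \<Rightarrow> int \<Rightarrow> nat" where
  "left_count t X x = (\<Sum>s<t. if X s = x \<and> X (Suc s) = x - 1 then 1 else 0)"

lemma below_Suc: "below n (Suc t) X \<longleftrightarrow> below n t X \<and> X (Suc t) < int n"
  by (auto simp: below_def le_Suc_eq)

lemma below_cong: "(\<And>i. i \<le> t \<Longrightarrow> X i = Y i) \<Longrightarrow> below n t X = below n t Y"
  by (simp add: below_def)

lemma left_count_cong: "(\<And>i. i \<le> t \<Longrightarrow> X i = Y i) \<Longrightarrow> left_count t X = left_count t Y"
  by (simp add: left_count_def fun_eq_iff)

lemma left_count_Suc:
  "left_count (Suc t) X x = left_count t X x + (if X t = x \<and> X (Suc t) = x - 1 then 1 else 0)"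
  by (simp add: left_count_def)

lemma hitting_time_eq:
  assumes "\<And>r. r < s \<Longrightarrow> X r < int n" "X s = int n"
  shows "hitting_time n X = s"
  unfolding hitting_time_def
proof (rule cInf_eq_minimum)
  fix t assume "t \<in> {t. X t = int n}"
  then show "s \<le> t" using assms(1)[of t] by (cases "t < s") auto
qed (use assms in simp)

text \<open>
  Pascal's rule: the first trial is either a success or a failure.
\<close>

lemma neg_binomial_pascal:
  assumes p: "p \<in> {0<..1}"
  shows "pmf (neg_binomial_pmf (Suc r) p) k = p * pmf (neg_binomial_pmf r p) k
    + (1 - p) * (if k = 0 then 0 else pmf (neg_binomial_pmf (Suc r) p) (k - 1))"
proof (cases k)
  case (Suc j)
  have "real (k + Suc r - 1 choose k) = real (k + r - 1 choose k) + real (j + Suc r - 1 choose j)"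
    by (simp add: Suc add.commute)
  then show ?thesis
    unfolding pmf_neg_binomial[OF p] by (simp add: Suc algebra_simps)
qed (simp add: pmf_neg_binomial[OF p])

text \<open>
  The quenched probability that the walk from \<open>x\<close> jumps left \<open>l y\<close> times from each \<open>y\<close> in \<open>{0..<n}\<close> before it
  reaches \<open>n\<close>. The walk jumps right from \<open>y\<close> as often as it jumps left from \<open>y + 1\<close>, and once more
  if it starts at or to the left of \<open>y\<close>; the left jumps are the failures before the last of these
  successes. Left jumps from negative sites are not prescribed: whatever their number, the walk comes back to 0.
  The boundary value is \<open>l n = 0\<close>, since the walk never leaves \<open>n\<close>.
\<close>

definition crossing_weight :: "nat \<Rightarrow> (int \<Rightarrow> real) \<Rightarrow> int \<Rightarrow> (nat \<Rightarrow> nat) \<Rightarrow> real" where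
  "crossing_weight n w x l =
     (\<Prod>y<n. pmf (neg_binomial_pmf (l (Suc y) + (if x \<le> int y then 1 else 0)) (w (int y))) (l y))"

lemma crossing_weight_nonneg: "0 \<le> crossing_weight n w x l"
  by (simp add: crossing_weight_def prod_nonneg)

lemma crossing_weight_le_1: "crossing_weight n w x l \<le> 1"
  unfolding crossing_weight_def by (rule prod_le_1) (simp add: pmf_le_1)

lemma crossing_weight_negative: "x \<le> 0 \<Longrightarrow> crossing_weight n w x l = crossing_weight n w 0 l"
  unfolding crossing_weight_def by (intro prod.cong) auto

text \<open>
  The first-step equation of the walk. The three weights differ only in the factor of the site \<open>x\<close>: a right
  jump uses up one success there, a left jump one failure, and at \<open>x - 1\<close> the additional left jump from
  \<open>x\<close> is made up for by the new starting point.
\<close>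

lemma crossing_weight_step:
  assumes w: "0 < w (int x)" "w (int x) < 1" and x: "x < n"
  shows "crossing_weight n w (int x) l = w (int x) * crossing_weight n w (int x + 1) l
    + (1 - w (int x)) * (if l x = 0 then 0 else crossing_weight n w (int x - 1) (l(x := l x - 1)))"
proof -
  let ?p = "w (int x)"
  define R where "R = (\<Prod>y\<in>{..<n} - {x}. pmf (neg_binomial_pmf (l (Suc y) + (if int x \<le> int y then 1 else 0)) (w (int y))) (l y))"
  have split: "crossing_weight n w z m
      = pmf (neg_binomial_pmf (m (Suc x) + (if z \<le> int x then 1 else 0)) ?p) (m x)
        * (\<Prod>y\<in>{..<n} - {x}. pmf (neg_binomial_pmf (m (Suc y) + (if z \<le> int y then 1 else 0)) (w (int y))) (m y))" for z m
    unfolding crossing_weight_def using x by (subst prod.remove[of _ x]) auto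
  have 1: "crossing_weight n w (int x) l = pmf (neg_binomial_pmf (Suc (l (Suc x))) ?p) (l x) * R"
    unfolding split R_def by simp
  have 2: "crossing_weight n w (int x + 1) l = pmf (neg_binomial_pmf (l (Suc x)) ?p) (l x) * R"
    unfolding split R_def by (intro arg_cong2[where f="(*)"] prod.cong) auto
  have 3: "crossing_weight n w (int x - 1) (l(x := l x - 1))
      = pmf (neg_binomial_pmf (Suc (l (Suc x))) ?p) (l x - 1) * R" if "l x \<noteq> 0"
  proof -
    have "pmf (neg_binomial_pmf ((l(x := l x - 1)) (Suc y) + (if int x - 1 \<le> int y then 1 else 0)) (w (int y))) ((l(x := l x - 1)) y)
        = pmf (neg_binomial_pmf (l (Suc y) + (if int x \<le> int y then 1 else 0)) (w (int y))) (l y)" if "y \<noteq> x" for y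
      using that \<open>l x \<noteq> 0\<close> by (cases "Suc y = x") auto
    then show ?thesis
      unfolding split R_def by (intro arg_cong2[where f="(*)"] prod.cong) auto
  qed
  have "?p \<in> {0<..1}" using w by simp
  note pascal = neg_binomial_pascal[OF this, of "l (Suc x)" "l x"]
  show ?thesis
  proof (cases "l x = 0")
    case True
    then show ?thesis unfolding 1 2 using pascal by simp
  next
    case False
    then show ?thesis unfolding 1 2 using pascal
      by (simp add: 3[OF False] distrib_right del: One_nat_def)
  qed
qed

text \<open>
  At the largest \<open>y\<close> with \<open>l y \<noteq> 0\<close> there is no success, so there cannot be a failure before the last
  one.
\<close>

lemma crossing_weight_target:
  assumes "l n = 0" "\<not> (\<forall>y<n. l y = 0)"
  shows "crossing_weight n w (int n) l = 0"
proof -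
  define y where "y = (GREATEST y. y < n \<and> l y \<noteq> 0)"
  have y: "y < n \<and> l y \<noteq> 0"
    unfolding y_def by (rule GreatestI_ex_nat[where b=n]) (use assms(2) in auto)
  have "l (Suc y) = 0"
  proof (rule ccontr)
    assume *: "l (Suc y) \<noteq> 0"
    then have "Suc y < n" using y assms(1) by (cases "Suc y = n") auto
    with * have "Suc y \<le> y" unfolding y_def by (intro Greatest_le_nat[where b=n]) auto
    then show False by simp
  qed
  then have "pmf (neg_binomial_pmf (l (Suc y) + (if int n \<le> int y then 1 else 0)) (w (int y))) (l y) = 0"
    using y by simp
  then show ?thesis unfolding crossing_weight_def using y by (subst prod_zero_iff) auto
qed

text \<open>
  The weight of the left jumps that are still to come when \<open>c\<close> of the prescribed \<open>l\<close> have been made; 0 if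
  there have been too many.
\<close>

definition remaining_weight :: "nat \<Rightarrow> (int \<Rightarrow> real) \<Rightarrow> (nat \<Rightarrow> nat) \<Rightarrow> int \<Rightarrow> (int \<Rightarrow> nat) \<Rightarrow> real" where
  "remaining_weight n w l x c =
     (if \<forall>y<n. c (int y) \<le> l y then crossing_weight n w x (\<lambda>y. l y - c (int y)) else 0)"

lemma remaining_weight_bounds: "0 \<le> remaining_weight n w l x c" "remaining_weight n w l x c \<le> 1"
  by (simp_all add: remaining_weight_def crossing_weight_nonneg crossing_weight_le_1)

lemma remaining_weight_step:
  assumes w: "0 < w x" "w x < 1" and x: "x < int n"
  shows "remaining_weight n w l x c = w x * remaining_weight n w l (x + 1) c
    + (1 - w x) * remaining_weight n w l (x - 1) (c(x := Suc (c x)))"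
proof (cases "0 \<le> x")
  case False
  then have "(\<forall>y<n. (c(x := Suc (c x))) (int y) \<le> l y) \<longleftrightarrow> (\<forall>y<n. c (int y) \<le> l y)"
    "(\<lambda>y. l y - (c(x := Suc (c x))) (int y)) = (\<lambda>y. l y - c (int y))" by auto
  moreover have "crossing_weight n w (x + 1) m = crossing_weight n w x m"
    "crossing_weight n w (x - 1) m = crossing_weight n w x m" for m
    using False crossing_weight_negative[of "x + 1"] crossing_weight_negative[of x]
      crossing_weight_negative[of "x - 1"] by auto
  ultimately have "remaining_weight n w l (x + 1) c = remaining_weight n w l x c"
    "remaining_weight n w l (x - 1) (c(x := Suc (c x))) = remaining_weight n w l x c"
    unfolding remaining_weight_def by (simp_all only:)
  then show ?thesis by (simp add: algebra_simps)
next
  case True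
  then obtain k where k: "x = int k" "k < n" using x by (cases x) auto
  show ?thesis
  proof (cases "\<forall>y<n. c (int y) \<le> l y")
    case False
    then obtain y where "y < n" "l y < c (int y)" by (auto simp: not_le)
    moreover have "c (int y) \<le> (c(x := Suc (c x))) (int y)" by simp
    ultimately have F': "\<not> (\<forall>y<n. (c(x := Suc (c x))) (int y) \<le> l y)" by (meson le_less_trans less_le_not_le)
    have "remaining_weight n w l z c = 0" for z
      unfolding remaining_weight_def using False by (rule if_not_P)
    moreover have "remaining_weight n w l z (c(x := Suc (c x))) = 0" for z
      unfolding remaining_weight_def using F' by (rule if_not_P)
    ultimately show ?thesis by simp
  next
    case le: True
    let ?m = "\<lambda>y. l y - c (int y)"
    have eq: "remaining_weight n w l (x - 1) (c(x := Suc (c x)))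
        = (if ?m k = 0 then 0 else crossing_weight n w (int k - 1) (?m(k := ?m k - 1)))"
    proof -
      have "(\<forall>y<n. (c(x := Suc (c x))) (int y) \<le> l y) \<longleftrightarrow> ?m k \<noteq> 0"
        using le k by (auto simp: Suc_le_eq)
      moreover have "(\<lambda>y. l y - (c(x := Suc (c x))) (int y)) = ?m(k := ?m k - 1)"
        using k by (auto simp: fun_eq_iff)
      ultimately show ?thesis by (simp add: remaining_weight_def k)
    qed
    show ?thesis unfolding eq using crossing_weight_step[of w k n ?m] w k le
      by (simp add: remaining_weight_def)
  qed
qed

lemma remaining_weight_target:
  assumes "l n = 0"
  shows "remaining_weight n w l (int n) c \<le> (if \<forall>y<n. c (int y) = l y then 1 else 0)"
proof (cases "\<forall>y<n. c (int y) = l y")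
  case False
  have "crossing_weight n w (int n) (\<lambda>y. l y - c (int y)) = 0" if le: "\<forall>y<n. c (int y) \<le> l y"
  proof (rule crossing_weight_target)
    obtain y where "y < n" "c (int y) \<noteq> l y" using False by auto
    then have "y < n" "l y - c (int y) \<noteq> 0" using le by (auto simp: le_less)
    then show "\<not> (\<forall>y<n. l y - c (int y) = 0)" by meson
  qed (simp add: assms)
  with False show ?thesis by (auto simp: remaining_weight_def)
qed (use remaining_weight_bounds in simp)

definition reached_with :: "nat \<Rightarrow> (nat \<Rightarrow> nat) \<Rightarrow> nat \<Rightarrow> (nat \<Rightarrow> int) \<Rightarrow> bool" where
  "reached_with n l t X \<longleftrightarrow>
     (\<exists>s\<le>t. (\<forall>r<s. X r < int n) \<and> X s = int n \<and> (\<forall>y<n. left_count s X (int y) = l y))"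

lemma reached_with_cong:
  assumes eq: "\<And>i. i \<le> t \<Longrightarrow> X i = Y i"
  shows "reached_with n l t X = reached_with n l t Y"
  unfolding reached_with_def
proof (rule ex_cong1, rule conj_cong[OF refl])
  fix s assume "s \<le> t"
  then have XY: "X i = Y i" if "i \<le> s" for i using eq[of i] that by simp
  then have "left_count s X = left_count s Y" by (rule left_count_cong)
  then show "((\<forall>r<s. X r < int n) \<and> X s = int n \<and> (\<forall>y<n. left_count s X (int y) = l y))
    = ((\<forall>r<s. Y r < int n) \<and> Y s = int n \<and> (\<forall>y<n. left_count s Y (int y) = l y))"
    using XY by (auto simp: less_imp_le)
qed

lemma reached_with_Suc:
  "reached_with n l (Suc t) X \<longleftrightarrow> reached_with n l t X \<or>
    (below n t X \<and> X (Suc t) = int n \<and> (\<forall>y<n. left_count (Suc t) X (int y) = l y))"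
  unfolding reached_with_def below_def by (auto simp: le_Suc_eq less_Suc_eq_le)

lemma reached_with_left_steps:
  assumes "reached_with n l t X" "l n = 0" "y \<le> n"
  shows "left_steps n X (int y) = l y"
proof -
  obtain s where s: "\<And>r. r < s \<Longrightarrow> X r < int n" "X s = int n" "\<And>y. y < n \<Longrightarrow> left_count s X (int y) = l y"
    using assms(1) by (auto simp: reached_with_def)
  have "left_steps n X x = left_count s X x" for x
    using hitting_time_eq[of s X n, OF s(1,2)] by (simp add: left_steps_def left_count_def)
  moreover have "left_count s X (int n) = 0" using s(1) by (force simp: left_count_def)
  ultimately show ?thesis using s(3) assms(2,3) by (cases "y = n") auto
qed

text \<open>
  The conditional probability, given the path up to time \<open>t\<close>, of reaching \<open>n\<close> with the crossing
  numbers \<open>l\<close>, as predicted by \<open>remaining_weight\<close>.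
\<close>

definition hitting_potential :: "nat \<Rightarrow> (int \<Rightarrow> real) \<Rightarrow> (nat \<Rightarrow> nat) \<Rightarrow> nat \<Rightarrow> (nat \<Rightarrow> int) \<Rightarrow> ennreal" where
  "hitting_potential n w l t X =
     (if below n t X then ennreal (remaining_weight n w l (X t) (left_count t X))
      else if reached_with n l t X then 1 else 0)"

lemma not_below_reached: "reached_with n l t X \<Longrightarrow> \<not> below n t X"
  by (auto simp: reached_with_def below_def)

text \<open>
  The submartingale property, which is \<open>remaining_weight_step\<close> integrated over the path. Only at the
  target can the potential increase, by \<open>remaining_weight_target\<close>.
\<close>

lemma nn_integral_hitting_potential_mono:
  assumes w: "\<And>x. 0 < w x" "\<And>x. w x < 1" and l: "l n = 0"
  shows "(\<integral>\<^sup>+X. hitting_potential n w l t X \<partial>quenched_law w)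
    \<le> (\<integral>\<^sup>+X. hitting_potential n w l (Suc t) X \<partial>quenched_law w)"
proof -
  \<comment> \<open>The potential at time \<open>t + 1\<close> as a function of the past \<open>X\<close> and the next state \<open>y\<close>; the value 0 beyond \<open>n\<close> is never charged by the kernel.\<close>
  define f where "f X y = (if below n t X then
      let c = (\<lambda>x. left_count t X x + (if X t = x \<and> y = x - 1 then 1 else 0)) in
      if y < int n then ennreal (remaining_weight n w l y c)
      else if y = int n \<and> (\<forall>z<n. c (int z) = l z) then 1 else 0
    else if reached_with n l t X then 1 else (0::ennreal))" for X and y :: int
  have f: "f X (X (Suc t)) = hitting_potential n w l (Suc t) X" for X
  proof -
    have c: "(\<lambda>x. left_count t X x + (if X t = x \<and> X (Suc t) = x - 1 then 1 else 0)) = left_count (Suc t) X"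
      by (simp add: left_count_Suc fun_eq_iff)
    show ?thesis
      unfolding f_def Let_def c hitting_potential_def below_Suc reached_with_Suc
      using not_below_reached[of n l t X] by auto
  qed
  have "(\<integral>\<^sup>+X. hitting_potential n w l t X \<partial>quenched_law w)
      \<le> (\<integral>\<^sup>+X. (\<integral>\<^sup>+y. f X y \<partial>walk_kernel w (X t)) \<partial>quenched_law w)"
  proof (rule nn_integral_mono)
    fix X
    show "hitting_potential n w l t X \<le> (\<integral>\<^sup>+y. f X y \<partial>walk_kernel w (X t))"
    proof (cases "below n t X")
      case False
      then show ?thesis by (simp add: hitting_potential_def f_def)
    next
      case True
      let ?x = "X t" and ?c = "left_count t X"
      have x: "?x < int n" using True by (simp add: below_def)
      have stay: "(\<lambda>x. left_count t X x + (if X t = x \<and> X t + 1 = x - 1 then 1 else 0)) = ?c" by auto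
      have up: "ennreal (remaining_weight n w l (?x + 1) ?c) \<le> f X (?x + 1)"
      proof (cases "?x + 1 < int n")
        case less: True
        have "f X (?x + 1) = ennreal (remaining_weight n w l (?x + 1) ?c)"
          unfolding f_def Let_def stay using True less by simp
        then show ?thesis by simp
      next
        case False
        then have n: "?x + 1 = int n" using x by simp
        have "f X (?x + 1) = (if \<forall>z<n. ?c (int z) = l z then 1 else 0)"
          unfolding f_def Let_def stay using True n by simp
        also have "\<dots> = ennreal (if \<forall>z<n. ?c (int z) = l z then 1 else 0)"
          by (simp only: if_distrib[of ennreal] ennreal_1 ennreal_0)
        also have "\<dots> \<ge> ennreal (remaining_weight n w l (int n) ?c)"
          by (rule ennreal_leI) (rule remaining_weight_target[where n=n and l=l, OF l])
        finally show ?thesis unfolding n .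
      qed
      have down: "f X (?x - 1) = ennreal (remaining_weight n w l (?x - 1) (?c(?x := Suc (?c ?x))))"
      proof -
        have "(\<lambda>x. left_count t X x + (if X t = x \<and> ?x - 1 = x - 1 then 1 else 0)) = ?c(?x := Suc (?c ?x))"
          by auto
        then show ?thesis unfolding f_def Let_def using True x by simp
      qed
      have "hitting_potential n w l t X = ennreal (w ?x * remaining_weight n w l (?x + 1) ?c
          + (1 - w ?x) * remaining_weight n w l (?x - 1) (?c(?x := Suc (?c ?x))))"
        using True remaining_weight_step[of w ?x n l ?c, OF w x] by (simp add: hitting_potential_def)
      also have "\<dots> = ennreal (w ?x) * ennreal (remaining_weight n w l (?x + 1) ?c)
          + ennreal (1 - w ?x) * ennreal (remaining_weight n w l (?x - 1) (?c(?x := Suc (?c ?x))))"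
      proof -
        have "0 \<le> w ?x" "0 \<le> 1 - w ?x" using w[of ?x] by auto
        then show ?thesis
          by (subst ennreal_plus) (auto simp: ennreal_mult remaining_weight_bounds intro!: mult_nonneg_nonneg)
      qed
      also have "\<dots> \<le> ennreal (w ?x) * f X (?x + 1) + ennreal (1 - w ?x) * f X (?x - 1)"
        unfolding down by (intro add_mono mult_left_mono up) auto
      also have "\<dots> = (\<integral>\<^sup>+y. f X y \<partial>walk_kernel w ?x)"
        using w[of ?x] by (intro nn_integral_walk_kernel[symmetric]) auto
      finally show ?thesis .
    qed
  qed
  also have "\<dots> = (\<integral>\<^sup>+X. f X (X (Suc t)) \<partial>quenched_law w)"
    unfolding quenched_law_def
  proof (rule nn_integral_markov_law_step[symmetric])
    fix X Y :: "nat \<Rightarrow> int" and y assume eq: "\<forall>i\<le>t. X i = Y i"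
    then show "f X y = f Y y"
      unfolding f_def using below_cong[of t X Y] left_count_cong[of t X Y] reached_with_cong[of t X Y] by simp
  qed
  finally show ?thesis unfolding f .
qed

lemma nn_integral_quenched_law_0: "(\<integral>\<^sup>+X. f (X 0) \<partial>quenched_law w) = f 0"
proof -
  have "(\<integral>\<^sup>+X. f (path_prefix 0 X ! 0) \<partial>quenched_law w)
      = (\<integral>\<^sup>+xs. f (xs ! 0) \<partial>chain_pmf (return_pmf 0) (walk_kernel w) 0)"
    unfolding quenched_law_def by (rule nn_integral_markov_law_prefix)
  then show ?thesis by simp
qed

lemma sets_quenched_law [measurable_cong]: "sets (quenched_law w) = sets path_space"
  by (simp add: quenched_law_def)

lemma space_quenched_law [simp]: "space (quenched_law w) = UNIV"
  by (simp add: quenched_law_def)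

lemma measurable_below [measurable]: "{X. below n t X} \<in> sets path_space"
proof -
  have "{X \<in> space path_space. \<forall>s\<le>t. X s < int n} \<in> sets path_space" by measurable
  then show ?thesis by (simp add: space_PiM below_def)
qed

lemma measurable_left_steps_eq [measurable]: "{X. \<forall>y\<le>n. left_steps n X (int y) = l y} \<in> sets path_space"
proof -
  have "{X \<in> space path_space. \<forall>y\<le>n. left_steps n X (int y) = l y} \<in> sets path_space" by measurable
  then show ?thesis by (simp add: space_PiM)
qed

text \<open>
  The potential starts at \<open>crossing_weight n w 0 l\<close>. At time \<open>t\<close> it is at most 1 while the walk is still below
  \<open>n\<close>, and otherwise the indicator of having reached \<open>n\<close> in the prescribed way.
\<close>

lemma crossing_weight_le_hitting:
  assumes w: "\<And>x. 0 < w x" "\<And>x. w x < 1" and l: "l n = 0" and n: "0 < n"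
  shows "ennreal (crossing_weight n w 0 l)
    \<le> emeasure (quenched_law w) {X. below n t X} + emeasure (quenched_law w) {X. \<forall>y\<le>n. left_steps n X (int y) = l y}"
proof -
  have "ennreal (crossing_weight n w 0 l) = (\<integral>\<^sup>+X. hitting_potential n w l 0 X \<partial>quenched_law w)"
  proof -
    define g where "g x = (if x < int n then ennreal (remaining_weight n w l x (\<lambda>_. 0))
      else if x = int n \<and> (\<forall>y<n. l y = 0) then 1 else 0)" for x
    have "hitting_potential n w l 0 X = g (X 0)" for X
    proof -
      have "left_count 0 X = (\<lambda>_. 0)" by (simp add: left_count_def fun_eq_iff)
      then show ?thesis by (auto simp: g_def hitting_potential_def below_def reached_with_def)
    qed
    then have "(\<integral>\<^sup>+X. hitting_potential n w l 0 X \<partial>quenched_law w) = g 0"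
      using nn_integral_quenched_law_0[where f=g] by simp
    then show ?thesis using n by (simp add: g_def remaining_weight_def)
  qed
  also have "\<dots> \<le> (\<integral>\<^sup>+X. hitting_potential n w l t X \<partial>quenched_law w)"
  proof (induction t)
    case (Suc t)
    then show ?case using nn_integral_hitting_potential_mono[of w l n t, OF w l] by simp
  qed simp
  also have "\<dots> \<le> (\<integral>\<^sup>+X. indicator {X. below n t X} X
      + indicator {X. \<forall>y\<le>n. left_steps n X (int y) = l y} X \<partial>quenched_law w)"
  proof (rule nn_integral_mono)
    fix X
    have "ennreal (remaining_weight n w l (X t) (left_count t X)) \<le> 1"
      using remaining_weight_bounds(2) by (simp add: ennreal_le_1)
    then show "hitting_potential n w l t X \<le> indicator {X. below n t X} X
      + indicator {X. \<forall>y\<le>n. left_steps n X (int y) = l y} X"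
      using reached_with_left_steps[of n l t X] l by (auto simp: hitting_potential_def indicator_def add_increasing2)
  qed
  also have "\<dots> = emeasure (quenched_law w) {X. below n t X}
      + emeasure (quenched_law w) {X. \<forall>y\<le>n. left_steps n X (int y) = l y}"
    by (subst nn_integral_add) (auto simp: quenched_law_def)
  finally show ?thesis .
qed

text \<open>
  The mean time that the walk needs to go from \<open>x\<close> to \<open>x + 1\<close>, in the form of the solution of
  \<open>mean_passage_time_rec\<close> by iteration.
\<close>

definition mean_passage_time :: "(int \<Rightarrow> real) \<Rightarrow> int \<Rightarrow> ennreal" where
  "mean_passage_time w x = (\<Sum>k. ennreal (1 / w (x - int k)) * (\<Prod>j<k. ennreal (rho w (x - int j))))"

lemma mean_passage_time_rec:
  assumes w: "0 < w x" "w x < 1"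
  shows "ennreal (w x) * mean_passage_time w x = 1 + ennreal (1 - w x) * mean_passage_time w (x - 1)"
proof -
  have "mean_passage_time w x = ennreal (1 / w x) + (\<Sum>k. ennreal (1 / w (x - int (Suc k))) * (\<Prod>j<Suc k. ennreal (rho w (x - int j))))"
    unfolding mean_passage_time_def
    using suminf_offset[of "\<lambda>k. ennreal (1 / w (x - int k)) * (\<Prod>j<k. ennreal (rho w (x - int j)))" 1] by simp
  also have "(\<lambda>k. ennreal (1 / w (x - int (Suc k))) * (\<Prod>j<Suc k. ennreal (rho w (x - int j))))
      = (\<lambda>k. ennreal (rho w x) * (ennreal (1 / w (x - 1 - int k)) * (\<Prod>j<k. ennreal (rho w (x - 1 - int j)))))"
  proof
    fix k
    have "x - int (Suc j) = x - 1 - int j" for j by simp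
    then show "ennreal (1 / w (x - int (Suc k))) * (\<Prod>j<Suc k. ennreal (rho w (x - int j)))
      = ennreal (rho w x) * (ennreal (1 / w (x - 1 - int k)) * (\<Prod>j<k. ennreal (rho w (x - 1 - int j))))"
      unfolding prod.lessThan_Suc_shift by (simp only: of_nat_0 diff_zero ac_simps)
  qed
  also have "(\<Sum>k. ennreal (rho w x) * (ennreal (1 / w (x - 1 - int k)) * (\<Prod>j<k. ennreal (rho w (x - 1 - int j)))))
      = ennreal (rho w x) * mean_passage_time w (x - 1)"
    unfolding mean_passage_time_def by (rule ennreal_suminf_cmult)
  finally have "ennreal (w x) * mean_passage_time w x = ennreal (w x) * ennreal (1 / w x) + ennreal (w x) * ennreal (rho w x) * mean_passage_time w (x - 1)"
    by (simp add: distrib_left mult.assoc)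
  also have "ennreal (w x) * ennreal (1 / w x) = 1"
    using w by (simp add: ennreal_mult'[symmetric])
  also have "ennreal (w x) * ennreal (rho w x) = ennreal (1 - w x)"
    using w by (simp add: ennreal_mult'[symmetric] rho_def)
  finally show ?thesis .
qed

lemma nn_integral_rho:
  assumes \<nu>: "single_site \<nu>"
  shows "(\<integral>\<^sup>+w. ennreal (rho w 0) \<partial>env_law \<nu>) = (\<integral>\<^sup>+a. ennreal ((1 - a) / a) \<partial>\<nu>)"
proof -
  have "(\<lambda>a. ennreal ((1 - a) / a)) \<in> borel_measurable \<nu>" by (rule measurable_single_site[OF \<nu>]) measurable
  from nn_integral_env_prod[OF \<nu>, of "{0}" "\<lambda>_ a. ennreal ((1 - a) / a)", OF _ this]
  show ?thesis by (simp add: rho_def)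
qed

text \<open>
  By independence the term \<open>k\<close> of the series has mean \<open>(1 + r) * r ^ k\<close>, where \<open>r < 1\<close> is the mean of \<open>rho\<close>
  and \<open>1 + r\<close> that of \<open>1 / w\<close>.
\<close>

lemma AE_mean_passage_time_finite:
  assumes \<nu>: "single_site \<nu>" and lt: "(\<integral>\<^sup>+w. ennreal (rho w 0) \<partial>env_law \<nu>) < 1"
  shows "AE w in env_law \<nu>. mean_passage_time w x \<noteq> \<infinity>"
proof -
  interpret nu: prob_space \<nu> by (rule single_site_props[OF \<nu>])
  note [measurable] = measurable_env_coord[OF \<nu>]
  have m1 [measurable]: "(\<lambda>a. ennreal ((1 - a) / a)) \<in> borel_measurable \<nu>"
    by (rule measurable_single_site[OF \<nu>]) measurable
  have m2 [measurable]: "(\<lambda>a. ennreal (1 / a)) \<in> borel_measurable \<nu>"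
    by (rule measurable_single_site[OF \<nu>]) measurable
  define r where "r = (\<integral>\<^sup>+a. ennreal ((1 - a) / a) \<partial>\<nu>)"
  have r1: "r < 1" using lt by (simp add: nn_integral_rho[OF \<nu>] r_def)
  then have "r < \<top>" using less_trans[OF r1 ennreal_one_less_top] by simp
  then obtain q where q: "r = ennreal q" "0 \<le> q" by (cases r) auto
  have q1: "q < 1" using r1 q by (simp add: ennreal_less_one_iff)
  have inv: "(\<integral>\<^sup>+a. ennreal (1 / a) \<partial>\<nu>) = 1 + r"
  proof -
    have "(\<integral>\<^sup>+a. ennreal (1 / a) \<partial>\<nu>) = (\<integral>\<^sup>+a. 1 + ennreal ((1 - a) / a) \<partial>\<nu>)"
    proof (rule nn_integral_cong)
      fix a assume "a \<in> space \<nu>"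
      then have a: "0 < a" "a < 1" using single_site_props[OF \<nu>] by auto
      have "ennreal (1 / a) = ennreal (1 + (1 - a) / a)" using a by (simp add: field_simps)
      then show "ennreal (1 / a) = 1 + ennreal ((1 - a) / a)" using a by (subst (asm) ennreal_plus) auto
    qed
    also have "\<dots> = (\<integral>\<^sup>+a. 1 \<partial>\<nu>) + r"
      unfolding r_def by (rule nn_integral_add) (simp, rule m1)
    finally show ?thesis by (simp add: nu.emeasure_space_1)
  qed
  have term_k: "(\<integral>\<^sup>+w. ennreal (1 / w (x - int k)) * (\<Prod>j<k. ennreal (rho w (x - int j))) \<partial>env_law \<nu>) = (1 + r) * r ^ k" for k
  proof -
    define f where "f i a = (if i = x - int k then ennreal (1 / a) else ennreal ((1 - a) / a))" for i :: int and a :: real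
    let ?J = "(\<lambda>j. x - int j) ` {..k}"
    have inj: "inj_on (\<lambda>j. x - int j) {..k}" by (auto simp: inj_on_def)
    have split: "(\<Prod>i\<in>?J. h i) = h (x - int k) * (\<Prod>j<k. h (x - int j))" for h :: "int \<Rightarrow> ennreal"
      unfolding prod.reindex[OF inj] by (simp add: lessThan_Suc_atMost[symmetric] mult.commute)
    have f: "f (x - int k) a = ennreal (1 / a)" "j < k \<Longrightarrow> f (x - int j) = (\<lambda>a. ennreal ((1 - a) / a))" for j a
      by (simp_all add: f_def fun_eq_iff)
    have fm: "f i \<in> borel_measurable \<nu>" for i
      by (cases "i = x - int k") (simp_all add: f_def[abs_def] m1 m2)
    have 1: "(\<Prod>i\<in>?J. f i (w i)) = ennreal (1 / w (x - int k)) * (\<Prod>j<k. ennreal (rho w (x - int j)))" for w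
      unfolding split[of "\<lambda>i. f i (w i)"] f(1) by (intro arg_cong2[where f="(*)"] prod.cong) (simp_all add: f(2) rho_def)
    have 2: "(\<Prod>i\<in>?J. \<integral>\<^sup>+a. f i a \<partial>\<nu>) = (1 + r) * r ^ k"
      unfolding split[of "\<lambda>i. \<integral>\<^sup>+a. f i a \<partial>\<nu>"] f(1) inv by (simp add: f(2) r_def)
    have "(\<integral>\<^sup>+w. (\<Prod>i\<in>?J. f i (w i)) \<partial>env_law \<nu>) = (\<Prod>i\<in>?J. \<integral>\<^sup>+a. f i a \<partial>\<nu>)"
      by (rule nn_integral_env_prod[OF \<nu> _ fm]) simp
    then show ?thesis unfolding 1 2 .
  qed
  have "(\<integral>\<^sup>+w. mean_passage_time w x \<partial>env_law \<nu>) = (\<Sum>k. (1 + r) * r ^ k)"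
    unfolding mean_passage_time_def term_k[symmetric] rho_def by (rule nn_integral_suminf) measurable
  also have "\<dots> = (1 + r) * (\<Sum>k. ennreal (q ^ k))"
    using q by (simp add: ennreal_suminf_cmult ennreal_power)
  also have "(\<Sum>k. ennreal (q ^ k)) = ennreal (1 / (1 - q))"
    using q q1 by (intro suminf_ennreal_eq geometric_sums) auto
  finally have "(\<integral>\<^sup>+w. mean_passage_time w x \<partial>env_law \<nu>) \<noteq> \<infinity>"
    using q by (simp add: ennreal_mult_eq_top_iff)
  then show ?thesis
    unfolding mean_passage_time_def rho_def by (intro nn_integral_PInf_AE) measurable
qed

text \<open>
  The function \<open>f\<close>, the mean time to reach \<open>n\<close>, decreases by 1 on average in each step below \<open>n\<close>. So the total
  mean time spent below \<open>n\<close> is at most \<open>f 0\<close>.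
\<close>

lemma sum_emeasure_below:
  assumes w: "\<And>x. 0 < w x" "\<And>x. w x < 1"
  shows "(\<Sum>t<k. emeasure (quenched_law w) {X. below n t X}) \<le> (\<Sum>y\<in>{0..<int n}. mean_passage_time w y)"
proof -
  define f where "f x = (\<Sum>y\<in>{x..<int n}. mean_passage_time w y)" for x
  define V where "V t X = (if below n t X then f (X t) else 0)" for t X
  \<comment> \<open>Stated with sums only, since the values may be infinite.\<close>
  have harmonic: "ennreal (w x) * f (x + 1) + ennreal (1 - w x) * f (x - 1) + 1 = f x" if x: "x < int n" for x
  proof -
    have "{x..<int n} = insert x {x + 1..<int n}" "{x - 1..<int n} = insert (x - 1) {x..<int n}" using x by auto
    then have fx: "f x = mean_passage_time w x + f (x + 1)" "f (x - 1) = mean_passage_time w (x - 1) + f x" by (simp_all add: f_def)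
    have one: "ennreal (w x) + ennreal (1 - w x) = 1"
      using w[of x] by (subst ennreal_plus[symmetric]) auto
    have "ennreal (w x) * f (x + 1) + ennreal (1 - w x) * f (x - 1) + 1
        = ennreal (w x) * f (x + 1) + ennreal (1 - w x) * f x + (1 + ennreal (1 - w x) * mean_passage_time w (x - 1))"
      by (simp add: fx(2) distrib_left ac_simps)
    also have "\<dots> = ennreal (w x) * f x + ennreal (1 - w x) * f x"
      unfolding mean_passage_time_rec[of w x, OF w, symmetric] by (simp add: fx(1) distrib_left ac_simps)
    also have "\<dots> = f x" by (simp only: distrib_right[symmetric] one mult_1)
    finally show ?thesis .
  qed
  have Vm: "V t \<in> borel_measurable (quenched_law w)" for t
    unfolding measurable_cong_sets[OF sets_quenched_law refl]
    by (rule measurable_prefix_dependent[where t=t]) (auto simp: V_def below_def)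
  have "(\<Sum>t<k. emeasure (quenched_law w) {X. below n t X}) + (\<integral>\<^sup>+X. V k X \<partial>quenched_law w) \<le> f 0"
  proof (induction k)
    case 0
    have "(\<integral>\<^sup>+X. V 0 X \<partial>quenched_law w) \<le> (\<integral>\<^sup>+X. f (X 0) \<partial>quenched_law w)"
      by (intro nn_integral_mono) (auto simp: V_def)
    then show ?case by (simp add: nn_integral_quenched_law_0)
  next
    case (Suc k)
    define g where "g X y = (if below n k X then f y else 0)" for X y
    have "(\<integral>\<^sup>+X. V (Suc k) X \<partial>quenched_law w) \<le> (\<integral>\<^sup>+X. g X (X (Suc k)) \<partial>quenched_law w)"
      by (intro nn_integral_mono) (auto simp: V_def g_def below_Suc)
    also have "\<dots> = (\<integral>\<^sup>+X. (\<integral>\<^sup>+y. g X y \<partial>walk_kernel w (X k)) \<partial>quenched_law w)"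
      unfolding quenched_law_def
      by (rule nn_integral_markov_law_step) (auto simp: g_def below_def)
    finally have "(\<integral>\<^sup>+X. V (Suc k) X \<partial>quenched_law w) + emeasure (quenched_law w) {X. below n k X}
        \<le> (\<integral>\<^sup>+X. (\<integral>\<^sup>+y. g X y \<partial>walk_kernel w (X k)) \<partial>quenched_law w) + (\<integral>\<^sup>+X. indicator {X. below n k X} X \<partial>quenched_law w)"
      by (subst nn_integral_indicator) (auto simp: sets_quenched_law measurable_below intro!: add_right_mono)
    also have "\<dots> = (\<integral>\<^sup>+X. (\<integral>\<^sup>+y. g X y \<partial>walk_kernel w (X k)) + indicator {X. below n k X} X \<partial>quenched_law w)"
    proof (rule nn_integral_add[symmetric])
      show "(\<lambda>X. \<integral>\<^sup>+y. g X y \<partial>walk_kernel w (X k)) \<in> borel_measurable (quenched_law w)"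
        unfolding measurable_cong_sets[OF sets_quenched_law refl]
      proof (rule measurable_prefix_dependent[where t=k])
        fix X Y :: "nat \<Rightarrow> int" assume eq: "\<forall>i\<le>k. X i = Y i"
        then have "g X = g Y" by (simp add: g_def below_def fun_eq_iff)
        then show "(\<integral>\<^sup>+y. g X y \<partial>walk_kernel w (X k)) = (\<integral>\<^sup>+y. g Y y \<partial>walk_kernel w (Y k))" using eq by simp
      qed simp
    qed (simp add: sets_quenched_law measurable_below)
    also have "\<dots> = (\<integral>\<^sup>+X. V k X \<partial>quenched_law w)"
    proof (rule nn_integral_cong)
      fix X
      show "(\<integral>\<^sup>+y. g X y \<partial>walk_kernel w (X k)) + indicator {X. below n k X} X = V k X"
      proof (cases "below n k X")
        case True
        then have "X k < int n" by (simp add: below_def)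
        then show ?thesis using True harmonic w[of "X k"]
          by (simp add: V_def g_def nn_integral_walk_kernel)
      qed (simp add: V_def g_def)
    qed
    finally show ?case using Suc.IH by (simp add: add.assoc add.commute[of "emeasure _ _"]) (meson add_left_mono order_trans)
  qed
  then show ?thesis unfolding f_def by (rule order_trans[rotated]) simp
qed

lemma emeasure_below_tendsto_0:
  assumes w: "\<And>x. 0 < w x" "\<And>x. w x < 1" and fin: "\<And>y. mean_passage_time w y \<noteq> \<infinity>"
  shows "(\<lambda>t. emeasure (quenched_law w) {X. below n t X}) \<longlonglongrightarrow> 0"
proof -
  interpret P: prob_space "quenched_law w" unfolding quenched_law_def by (rule prob_space_markov_law)
  have "(\<Sum>y\<in>{0..<int n}. mean_passage_time w y) < \<top>" using fin by (simp add: less_top)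
  then obtain C where C: "(\<Sum>y\<in>{0..<int n}. mean_passage_time w y) = ennreal C" "0 \<le> C"
    by (cases "\<Sum>y\<in>{0..<int n}. mean_passage_time w y") auto
  have "(\<Sum>t<k. measure (quenched_law w) {X. below n t X}) \<le> C" for k
    using sum_emeasure_below[where w=w and k=k and n=n, OF w] C
    by (simp add: P.emeasure_eq_measure sum_nonneg)
  then have "summable (\<lambda>t. measure (quenched_law w) {X. below n t X})"
    by (intro bounded_imp_summable[where B=C]) (auto simp: lessThan_Suc_atMost[symmetric] simp del: sum.lessThan_Suc)
  then have "(\<lambda>t. measure (quenched_law w) {X. below n t X}) \<longlonglongrightarrow> 0" by (rule summable_LIMSEQ_zero)
  then have "(\<lambda>t. ennreal (measure (quenched_law w) {X. below n t X})) \<longlonglongrightarrow> ennreal 0"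
    by (rule tendsto_ennrealI)
  then show ?thesis by (simp add: P.emeasure_eq_measure)
qed

lemma quenched_left_steps_lower_bound:
  assumes w: "\<And>x. 0 < w x" "\<And>x. w x < 1" and fin: "\<And>y. mean_passage_time w y \<noteq> \<infinity>"
    and l: "l n = 0" and n: "0 < n"
  shows "ennreal (crossing_weight n w 0 l)
    \<le> emeasure (quenched_law w) {X. \<forall>y\<le>n. left_steps n X (int y) = l y}"
proof (rule LIMSEQ_le[OF tendsto_const])
  show "(\<lambda>t. emeasure (quenched_law w) {X. below n t X}
      + emeasure (quenched_law w) {X. \<forall>y\<le>n. left_steps n X (int y) = l y})
    \<longlonglongrightarrow> emeasure (quenched_law w) {X. \<forall>y\<le>n. left_steps n X (int y) = l y}"
    using tendsto_add[OF emeasure_below_tendsto_0[of w n, OF w fin] tendsto_const] by simp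
  show "\<exists>N. \<forall>t\<ge>N. ennreal (crossing_weight n w 0 l) \<le> emeasure (quenched_law w) {X. below n t X}
      + emeasure (quenched_law w) {X. \<forall>y\<le>n. left_steps n X (int y) = l y}"
    using crossing_weight_le_hitting[of w l n, OF w l n] by blast
qed

text \<open>
  The sites enter the quenched weight through separate factors, so that independence turns its mean into the
  product of the transition probabilities of \<open>Q_kernel\<close>.
\<close>

lemma annealed_left_steps_lower_bound:
  assumes \<nu>: "single_site \<nu>" and lt: "(\<integral>\<^sup>+w. ennreal (rho w 0) \<partial>env_law \<nu>) < 1"
    and l: "l n = 0" and n: "0 < n"
  shows "ennreal (\<Prod>y<n. pmf (Q_kernel \<nu> (l (Suc y))) (l y))
    \<le> emeasure (annealed_law \<nu>) {X. \<forall>y\<le>n. left_steps n X (int y) = l y}"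
proof -
  let ?f = "\<lambda>k a. ennreal (pmf (neg_binomial_pmf (l (Suc (nat k)) + 1) a) (l (nat k)))"
  have inj: "inj_on int {..<n}" by simp
  have "ennreal (\<Prod>y<n. pmf (Q_kernel \<nu> (l (Suc y))) (l y)) = (\<Prod>y<n. ennreal (pmf (Q_kernel \<nu> (l (Suc y))) (l y)))"
    by (simp add: prod_ennreal)
  also have "\<dots> = (\<Prod>k\<in>int ` {..<n}. \<integral>\<^sup>+a. ?f k a \<partial>\<nu>)"
    unfolding ennreal_pmf_Q_kernel[OF \<nu>] by (subst prod.reindex[OF inj]) simp
  also have "\<dots> = (\<integral>\<^sup>+w. (\<Prod>k\<in>int ` {..<n}. ?f k (w k)) \<partial>env_law \<nu>)"
    by (rule nn_integral_env_prod[OF \<nu>, symmetric]) (simp, rule measurable_pmf_neg_binomial[OF \<nu>])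
  also have "\<dots> = (\<integral>\<^sup>+w. ennreal (crossing_weight n w 0 l) \<partial>env_law \<nu>)"
    unfolding crossing_weight_def by (subst prod.reindex[OF inj]) (simp add: prod_ennreal)
  also have "\<dots> \<le> (\<integral>\<^sup>+w. emeasure (quenched_law w) {X. \<forall>y\<le>n. left_steps n X (int y) = l y} \<partial>env_law \<nu>)"
  proof (rule nn_integral_mono_AE)
    have "AE w in env_law \<nu>. \<forall>x. mean_passage_time w x \<noteq> \<infinity>"
      unfolding AE_all_countable using AE_mean_passage_time_finite[OF \<nu> lt] by blast
    then show "AE w in env_law \<nu>. ennreal (crossing_weight n w 0 l)
      \<le> emeasure (quenched_law w) {X. \<forall>y\<le>n. left_steps n X (int y) = l y}"
      using AE_space
    proof eventually_elim
      fix w assume "\<forall>x. mean_passage_time w x \<noteq> \<infinity>" "w \<in> space (env_law \<nu>)"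
      then show "ennreal (crossing_weight n w 0 l) \<le> emeasure (quenched_law w) {X. \<forall>y\<le>n. left_steps n X (int y) = l y}"
        using quenched_left_steps_lower_bound[of w l n] l n by (simp add: space_env_law[OF \<nu>])
    qed
  qed
  also have "\<dots> = emeasure (annealed_law \<nu>) {X. \<forall>y\<le>n. left_steps n X (int y) = l y}"
    by (rule emeasure_annealed_law[OF \<nu> measurable_left_steps_eq, symmetric])
  finally show ?thesis .
qed

text \<open>
  Two probability distributions of which one dominates the other are equal, as the complement of a set
  shows. Hence lower bounds on point probabilities suffice.
\<close>

lemma distr_eq_pmf_of_le:
  fixes p :: "'c::countable pmf"
  assumes M: "prob_space M" and A: "A \<in> M \<rightarrow>\<^sub>M count_space UNIV"
    and le: "\<And>z. ennreal (pmf p z) \<le> emeasure M (A -` {z} \<inter> space M)"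
  shows "distr M (count_space UNIV) A = measure_pmf p"
proof (rule measure_eqI)
  interpret D: prob_space "distr M (count_space UNIV) A" by (rule prob_space.prob_space_distr[OF M A])
  let ?D = "distr M (count_space UNIV) A"
  have ge: "measure_pmf.prob p S \<le> measure ?D S" for S
  proof -
    have "emeasure (measure_pmf p) S = (\<integral>\<^sup>+z. emeasure (measure_pmf p) {z} \<partial>count_space S)"
      by (rule emeasure_countable_singleton) auto
    also have "\<dots> \<le> (\<integral>\<^sup>+z. emeasure ?D {z} \<partial>count_space S)"
      using le by (intro nn_integral_mono) (simp add: emeasure_pmf_single emeasure_distr[OF A])
    also have "\<dots> = emeasure ?D S"
      by (rule emeasure_countable_singleton[symmetric]) auto
    finally show ?thesis by (simp add: D.emeasure_eq_measure measure_pmf.emeasure_eq_measure)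
  qed
  fix S :: "'c set"
  have "measure ?D S = measure_pmf.prob p S"
    using ge[of S] ge[of "- S"] D.prob_compl[of S] measure_pmf.prob_compl[of S p]
    by (simp add: Compl_eq_Diff_UNIV)
  then show "emeasure ?D S = emeasure (measure_pmf p) S"
    by (simp add: D.emeasure_eq_measure measure_pmf.emeasure_eq_measure)
qed simp

text \<open>
  The crossing numbers from site \<open>n\<close> down to site 0; this order makes them a Markov chain.
\<close>

definition crossing_path :: "nat \<Rightarrow> (nat \<Rightarrow> int) \<Rightarrow> nat list" where
  "crossing_path n X = path_prefix n (\<lambda>k. left_steps n X (int (n - k)))"

lemma crossing_path_eq_iff:
  assumes "length zs = Suc n"
  shows "crossing_path n X = zs \<longleftrightarrow> (\<forall>y\<le>n. left_steps n X (int y) = zs ! (n - y))"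
proof -
  have "crossing_path n X = zs \<longleftrightarrow> (\<forall>k\<le>n. left_steps n X (int (n - k)) = zs ! k)"
    using assms by (simp add: crossing_path_def path_prefix_eq_iff)
  also have "\<dots> \<longleftrightarrow> (\<forall>y\<le>n. left_steps n X (int y) = zs ! (n - y))"
    by (metis diff_diff_cancel diff_le_self)
  finally show ?thesis .
qed

lemma measurable_crossing_path: "crossing_path n \<in> path_space \<rightarrow>\<^sub>M count_space UNIV"
proof (subst measurable_count_space_eq2_countable, intro conjI ballI)
  fix zs :: "nat list"
  have "{X. \<forall>y\<le>n. left_steps n X (int y) = zs ! (n - y)} \<in> sets path_space" by (rule measurable_left_steps_eq)
  moreover have "length (crossing_path n X) = Suc n" for X by (simp add: crossing_path_def)
  then have "crossing_path n -` {zs} \<inter> space path_space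
      = (if length zs = Suc n then {X. \<forall>y\<le>n. left_steps n X (int y) = zs ! (n - y)} else {})"
    using crossing_path_eq_iff[of zs n] by (auto simp: space_PiM)
  ultimately show "crossing_path n -` {zs} \<inter> space path_space \<in> sets path_space" by simp
qed auto

text \<open>
  The reversed order of the sites makes the product in \<open>annealed_left_steps_lower_bound\<close> the probability of a
  path of the chain, and \<open>distr_eq_pmf_of_le\<close> turns the bound into an identity.
\<close>

lemma distr_crossing_path:
  assumes \<nu>: "single_site \<nu>" and lt: "(\<integral>\<^sup>+w. ennreal (rho w 0) \<partial>env_law \<nu>) < 1" and n: "0 < n"
  shows "distr (annealed_law \<nu>) (count_space UNIV) (crossing_path n)
    = measure_pmf (chain_pmf (return_pmf 0) (Q_kernel \<nu>) n)"
proof (rule distr_eq_pmf_of_le)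
  show "prob_space (annealed_law \<nu>)" by (rule prob_space_annealed_law[OF \<nu>])
  show "crossing_path n \<in> annealed_law \<nu> \<rightarrow>\<^sub>M count_space UNIV"
    unfolding measurable_cong_sets[OF sets_annealed_law[OF \<nu>] refl] by (rule measurable_crossing_path)
  have sp: "space (annealed_law \<nu>) = UNIV"
    using sets_eq_imp_space_eq[OF sets_annealed_law[OF \<nu>]] by (simp add: space_PiM)
  fix zs
  let ?p = "chain_pmf (return_pmf 0) (Q_kernel \<nu>) n"
  show "ennreal (pmf ?p zs) \<le> emeasure (annealed_law \<nu>) (crossing_path n -` {zs} \<inter> space (annealed_law \<nu>))"
  proof (cases "zs \<in> set_pmf ?p")
    case True
    then have len: "length zs = Suc n" by (rule length_chain_pmf)
    have pmf: "pmf ?p zs = indicator {0} (zs ! 0) * (\<Prod>i<n. pmf (Q_kernel \<nu> (zs ! i)) (zs ! Suc i))"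
      by (simp add: pmf_chain_pmf[OF len] indicator_def)
    with True have z0: "zs ! 0 = 0" by (auto simp: set_pmf_iff indicator_eq_0_iff)
    have "(\<Prod>i<n. pmf (Q_kernel \<nu> (zs ! i)) (zs ! Suc i))
        = (\<Prod>y<n. pmf (Q_kernel \<nu> (zs ! (n - Suc y))) (zs ! Suc (n - Suc y)))"
      by (rule prod.nat_diff_reindex[symmetric])
    also have "\<dots> = (\<Prod>y<n. pmf (Q_kernel \<nu> (zs ! (n - Suc y))) (zs ! (n - y)))"
      by (intro prod.cong) (auto simp: Suc_diff_Suc)
    finally have "pmf ?p zs = (\<Prod>y<n. pmf (Q_kernel \<nu> (zs ! (n - Suc y))) (zs ! (n - y)))"
      by (simp add: pmf z0)
    moreover have "crossing_path n -` {zs} \<inter> space (annealed_law \<nu>) = {X. \<forall>y\<le>n. left_steps n X (int y) = zs ! (n - y)}"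
      by (simp add: sp vimage_def crossing_path_eq_iff[OF len])
    ultimately show ?thesis
      using annealed_left_steps_lower_bound[OF \<nu> lt, where l="\<lambda>y. zs ! (n - y)", OF _ n] z0 by simp
  next
    case False
    then have "pmf ?p zs = 0" by (simp add: pmf_eq_0_set_pmf)
    then show ?thesis by simp
  qed
qed

lemma invariant_positive_kernel_Q:
  assumes "single_site \<nu>" "(\<integral>\<^sup>+w. ennreal (rho w 0) \<partial>env_law \<nu>) < 1"
  shows "invariant_positive_kernel (pi_star \<nu>) (Q_kernel \<nu>)"
  by unfold_locales (use pi_star_invariant[OF assms] Q_kernel_pos[OF assms(1)] in auto)

section \<open>Convergence of the criterion\<close>

text \<open>
  The sum over the sites is, in reversed order, a sum over the steps of the chain \<open>crossing_path\<close>. Its law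
  is dominated by a multiple of the stationary one, for which the mean deviation \<open>a n\<close> tends to 0 by
  \<open>L1_ergodic\<close>; Markov's inequality concludes.
\<close>

theorem additive_functional_tendsto_in_prob:
  fixes g :: "nat \<Rightarrow> nat \<Rightarrow> real"
  assumes \<nu>: "single_site \<nu>" and lt: "(\<integral>\<^sup>+w. ennreal (rho w 0) \<partial>env_law \<nu>) < 1"
    and le: "\<And>x y. \<bar>g x y\<bar> \<le> C + A * real x + B * real y"
  shows "integrable (stationary_law \<nu>) (\<lambda>Z. g (Z 0) (Z 1))" (is ?int)
    and "tendsto_in_prob (annealed_law \<nu>)
      (\<lambda>n X. 1 / real n * (\<Sum>x<n. g (left_steps n X (int x + 1)) (left_steps n X (int x))))
      (\<integral>Z. g (Z 0) (Z 1) \<partial>stationary_law \<nu>)" (is ?lim)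
proof -
  interpret K: invariant_positive_kernel "pi_star \<nu>" "Q_kernel \<nu>"
    by (rule invariant_positive_kernel_Q[OF \<nu> lt])
  interpret P: prob_space K.path_law by (rule prob_space_markov_law)
  interpret An: prob_space "annealed_law \<nu>" by (rule prob_space_annealed_law[OF \<nu>])
  let ?g = "\<lambda>z. g (fst z) (snd z)"
  have ig: "integrable K.pair_law ?g"
    using le by (intro K.integrable_pair_law_linear_growth[OF integrable_pi_star_real[OF \<nu> lt]]) simp
  show ?int
    using ig K.integral_path_law_pair(2)[of ?g 0] by (simp add: stationary_law_def)
  define c where "c = (\<integral>Z. g (Z 0) (Z 1) \<partial>stationary_law \<nu>)"
  have c: "c = (\<integral>z. ?g z \<partial>K.pair_law)"
    using K.integral_path_law_pair(1)[of ?g 0] by (simp add: stationary_law_def c_def)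
  define avg where "avg n zs = 1 / real n * (\<Sum>k<n. g (zs ! k) (zs ! Suc k))" for n and zs :: "nat list"
  define Y where "Y n X = 1 / real n * (\<Sum>x<n. g (left_steps n X (int x + 1)) (left_steps n X (int x)))" for n X
  have Y: "Y n X = avg n (crossing_path n X)" for n X
  proof -
    have "(\<Sum>x<n. g (left_steps n X (int x + 1)) (left_steps n X (int x)))
        = (\<Sum>k<n. g (left_steps n X (int (n - Suc k) + 1)) (left_steps n X (int (n - Suc k))))"
      by (rule sum.nat_diff_reindex[symmetric])
    also have "\<dots> = (\<Sum>k<n. g (crossing_path n X ! k) (crossing_path n X ! Suc k))"
    proof (rule sum.cong)
      fix k assume "k \<in> {..<n}"
      then have "int (n - Suc k) + 1 = int (n - k)" "k \<le> n" "Suc k \<le> n" by auto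
      then show "g (left_steps n X (int (n - Suc k) + 1)) (left_steps n X (int (n - Suc k)))
          = g (crossing_path n X ! k) (crossing_path n X ! Suc k)"
        by (simp add: crossing_path_def del: of_nat_diff)
    qed simp
    finally show ?thesis by (simp add: Y_def avg_def)
  qed
  have Ym: "Y n \<in> borel_measurable (annealed_law \<nu>)" for n
    unfolding measurable_cong_sets[OF sets_annealed_law[OF \<nu>] refl] Y_def[abs_def]
    by (intro borel_measurable_times borel_measurable_sum measurable_fun_left_steps)
  define a where "a n = (\<integral>X. \<bar>1 / real n * (\<Sum>i<n. ?g (X i, X (Suc i))) - c\<bar> \<partial>K.path_law)" for n
  have a0: "a \<longlonglongrightarrow> 0" unfolding a_def c by (rule K.L1_ergodic[OF ig])
  have bound: "measure (annealed_law \<nu>) {X \<in> space (annealed_law \<nu>). \<bar>Y n X - c\<bar> > e} \<le> a n / (e * pmf (pi_star \<nu>) 0)"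
    if e: "0 < e" and n: "0 < n" for e n
  proof -
    let ?S = "{zs. \<bar>avg n zs - c\<bar> > e}"
    have mc: "crossing_path n \<in> annealed_law \<nu> \<rightarrow>\<^sub>M count_space UNIV"
      unfolding measurable_cong_sets[OF sets_annealed_law[OF \<nu>] refl] by (rule measurable_crossing_path)
    have mp: "path_prefix n \<in> K.path_law \<rightarrow>\<^sub>M count_space UNIV"
      unfolding measurable_cong_sets[OF sets_markov_law refl]
      by (rule measurable_prefix_dependent[where t=n]) (auto simp: path_prefix_eq_iff)
    have "emeasure (annealed_law \<nu>) {X \<in> space (annealed_law \<nu>). \<bar>Y n X - c\<bar> > e}
        = emeasure (distr (annealed_law \<nu>) (count_space UNIV) (crossing_path n)) ?S"
      by (subst emeasure_distr[OF mc]) (auto simp: Y intro!: arg_cong[where f="emeasure _"])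
    also have "\<dots> = emeasure (chain_pmf (return_pmf 0) (Q_kernel \<nu>) n) ?S"
      by (simp only: distr_crossing_path[OF \<nu> lt n])
    also have "\<dots> \<le> emeasure (chain_pmf (pi_star \<nu>) (Q_kernel \<nu>) n) ?S / pmf (pi_star \<nu>) 0"
      by (rule K.chain_from_point_le)
    also have "emeasure (chain_pmf (pi_star \<nu>) (Q_kernel \<nu>) n) ?S = emeasure K.path_law {X. \<bar>avg n (path_prefix n X) - c\<bar> > e}"
      unfolding distr_markov_law_prefix[symmetric]
      by (subst emeasure_distr[OF mp]) (auto intro!: arg_cong[where f="emeasure _"])
    finally have 1: "measure (annealed_law \<nu>) {X \<in> space (annealed_law \<nu>). \<bar>Y n X - c\<bar> > e}
        \<le> measure K.path_law {X. \<bar>avg n (path_prefix n X) - c\<bar> > e} / pmf (pi_star \<nu>) 0"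
      using K.invariant_pos[of 0] by (simp add: An.emeasure_eq_measure P.emeasure_eq_measure divide_ennreal)
    let ?h = "\<lambda>X. \<bar>1 / real n * (\<Sum>i<n. ?g (X i, X (Suc i))) - c\<bar>"
    have avg: "avg n (path_prefix n X) = 1 / real n * (\<Sum>i<n. ?g (X i, X (Suc i)))" for X
      by (simp add: avg_def)
    have ih: "integrable K.path_law ?h"
      using ig K.integral_path_law_pair(2)[of ?g]
      by (intro integrable_abs Bochner_Integration.integrable_diff integrable_mult_right
          Bochner_Integration.integrable_sum) simp_all
    have "measure K.path_law {X. \<bar>avg n (path_prefix n X) - c\<bar> > e} \<le> measure K.path_law {X \<in> space K.path_law. e \<le> ?h X}"
    proof (rule P.finite_measure_mono)
      note [measurable] = borel_measurable_integrable[OF ih]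
      show "{X \<in> space K.path_law. e \<le> ?h X} \<in> sets K.path_law" by measurable
    qed (auto simp: avg)
    also have "\<dots> \<le> a n / e"
      unfolding a_def by (rule integral_Markov_inequality_measure[OF ih, of "{}"]) (use e in auto)
    finally have "measure K.path_law {X. \<bar>avg n (path_prefix n X) - c\<bar> > e} / pmf (pi_star \<nu>) 0 \<le> a n / e / pmf (pi_star \<nu>) 0"
      by (intro divide_right_mono) auto
    with 1 show ?thesis by simp
  qed
  have "(\<lambda>n. measure (annealed_law \<nu>) {X \<in> space (annealed_law \<nu>). \<bar>Y n X - c\<bar> > e}) \<longlonglongrightarrow> 0" if e: "0 < e" for e
  proof (rule tendsto_sandwich[OF _ _ tendsto_const])
    show "\<forall>\<^sub>F n in sequentially. 0 \<le> measure (annealed_law \<nu>) {X \<in> space (annealed_law \<nu>). \<bar>Y n X - c\<bar> > e}" by simp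
    show "\<forall>\<^sub>F n in sequentially. measure (annealed_law \<nu>) {X \<in> space (annealed_law \<nu>). \<bar>Y n X - c\<bar> > e}
        \<le> a n / (e * pmf (pi_star \<nu>) 0)"
      by (rule eventually_sequentiallyI[of 1]) (rule bound[OF e], simp)
    show "(\<lambda>n. a n / (e * pmf (pi_star \<nu>) 0)) \<longlonglongrightarrow> 0" using tendsto_divide_zero[OF a0] by simp
  qed
  with Ym have "tendsto_in_prob (annealed_law \<nu>) Y c" unfolding tendsto_in_prob_def by blast
  then show ?lim unfolding Y_def[abs_def] c_def .
qed

text \<open>
  Jensen's inequality for the exponential function.
\<close>

lemma phi_lower_bound:
  assumes \<nu>: "single_site \<nu>"
    and i1: "integrable \<nu> (\<lambda>a. ln a)" and i2: "integrable \<nu> (\<lambda>a. ln (1 - a))"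
  shows "real (x + 1) * (\<integral>a. ln a \<partial>\<nu>) + real y * (\<integral>a. ln (1 - a) \<partial>\<nu>) \<le> phi \<nu> x y"
proof -
  interpret prob_space \<nu> by (rule single_site_props[OF \<nu>])
  note b = phi_integral_bounds[OF \<nu>, of x y]
  let ?h = "\<lambda>a. real (x + 1) * ln a + real y * ln (1 - a)"
  have h: "exp (?h a) = a ^ (x + 1) * (1 - a) ^ y" if "a \<in> space \<nu>" for a
    using that single_site_props[OF \<nu>] by (simp add: exp_add exp_of_nat_mult exp_ln del: of_nat_add of_nat_Suc)
  have ih: "integrable \<nu> ?h" using i1 i2 by simp
  have ie: "integrable \<nu> (\<lambda>a. exp (?h a))"
    using b(1) by (subst Bochner_Integration.integrable_cong[OF refl h]) auto
  have "exp (expectation ?h) \<le> expectation (\<lambda>a. exp (?h a))"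
    by (rule jensens_inequality[OF ih, of UNIV]) (use ie exp_convex in auto)
  also have "\<dots> = expectation (\<lambda>a. a ^ (x + 1) * (1 - a) ^ y)"
    by (rule Bochner_Integration.integral_cong[OF refl h])
  finally have "expectation ?h \<le> phi \<nu> x y"
    unfolding phi_def using b(2) by (simp add: ln_ge_iff)
  then show ?thesis using i1 i2 by simp
qed

text \<open>
  As \<open>ln a = ln (1 - a) - ln ((1 - a) / a)\<close>, both logarithms in \<open>phi_lower_bound\<close> are integrable.
\<close>

lemma phi_linear_growth:
  assumes \<nu>: "single_site \<nu>"
    and i1: "integrable (env_law \<nu>) (\<lambda>w. \<bar>ln (rho w 0)\<bar>)" and i2: "integrable (env_law \<nu>) (\<lambda>w. ln (1 - w 0))"
  obtains C A B where "\<And>x y. - (C + A * real x + B * real y) \<le> phi \<nu> x y"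
proof -
  have [measurable]: "(\<lambda>w. w 0) \<in> env_law \<nu> \<rightarrow>\<^sub>M \<nu>" unfolding env_law_def by (rule measurable_component_singleton) simp
  have tr: "integrable (env_law \<nu>) (\<lambda>w. f (w 0)) \<longleftrightarrow> integrable \<nu> f" if "f \<in> borel_measurable borel" for f :: "real \<Rightarrow> real"
    using integrable_distr_eq[of "\<lambda>w. w 0" "env_law \<nu>" \<nu> f] measurable_single_site[OF \<nu> that]
    by (simp add: distr_env_coord[OF \<nu>])
  have j2: "integrable \<nu> (\<lambda>a. ln (1 - a))" using i2 by (subst (asm) tr) auto
  have ln_rho_meas: "(\<lambda>a. ln ((1 - a) / a)) \<in> borel_measurable \<nu>"
    by (rule measurable_single_site[OF \<nu>]) measurable
  have "integrable \<nu> (\<lambda>a. \<bar>ln ((1 - a) / a)\<bar>)"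
    using i1 tr[of "\<lambda>a. \<bar>ln ((1 - a) / a)\<bar>"] by (simp add: rho_def)
  then have j1: "integrable \<nu> (\<lambda>a. ln ((1 - a) / a))"
    using integrable_abs_iff[OF ln_rho_meas] by blast
  have "integrable \<nu> (\<lambda>a. ln (1 - a) - ln ((1 - a) / a))" using j1 j2 by simp
  then have j3: "integrable \<nu> ln"
    by (rule iffD1[OF Bochner_Integration.integrable_cong, rotated 2]) (auto simp: single_site_props[OF \<nu>] ln_div)
  show ?thesis
    by (rule that[of "- (\<integral>a. ln a \<partial>\<nu>)" "- (\<integral>a. ln a \<partial>\<nu>)" "- (\<integral>a. ln (1 - a) \<partial>\<nu>)"])
      (use phi_lower_bound[OF \<nu> j3 j2] in \<open>auto simp: algebra_simps\<close>)
qed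

text \<open>
  Both claims are cases of \<open>additive_functional_tendsto_in_prob\<close>, once \<open>phi\<close> and its suprema are seen to
  grow at most linearly.
\<close>

theorem theorem4p1:
  fixes \<Theta> :: "(real ^ 'd) set"
    and \<nu> :: "real ^ 'd \<Rightarrow> real measure"
    and \<theta>s :: "real ^ 'd"
  assumes compact: "compact \<Theta>"
    and marginals: "\<forall>\<theta>\<in>\<Theta>. \<nu> \<theta> \<in> space (prob_algebra unit_borel)"
    and interior: "\<theta>s \<in> interior \<Theta>"
    and cond1: "\<forall>\<theta>\<in>\<Theta>. integrable (env_law (\<nu> \<theta>)) (\<lambda>w. \<bar>ln (rho w 0)\<bar>) \<and>
                      (\<integral>w. ln (rho w 0) \<partial>env_law (\<nu> \<theta>)) < 0"
    and cond2: "\<forall>\<theta>\<in>\<Theta>. (\<integral>\<^sup>+w. ennreal (rho w 0) \<partial>env_law (\<nu> \<theta>)) < 1"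
    and cond3: "\<forall>x y. continuous_on \<Theta> (\<lambda>\<theta>. phi (\<nu> \<theta>) x y)"
    and cond4: "\<forall>\<theta>\<in>\<Theta>. \<forall>\<theta>'\<in>\<Theta>. \<nu> \<theta> \<noteq> \<nu> \<theta>' \<longleftrightarrow> \<theta> \<noteq> \<theta>'"
    and cond5: "\<forall>\<theta>\<in>\<Theta>. integrable (env_law (\<nu> \<theta>)) (\<lambda>w. ln (1 - w 0))"
               "bdd_below ((\<lambda>\<theta>. \<integral>w. ln (1 - w 0) \<partial>env_law (\<nu> \<theta>)) ` \<Theta>)"
  shows "(\<forall>\<theta>\<in>\<Theta>.
            integrable (stationary_law (\<nu> \<theta>s)) (\<lambda>Z. phi (\<nu> \<theta>) (Z 0) (Z 1)) \<and>
            tendsto_in_prob (annealed_law (\<nu> \<theta>s)) (\<lambda>n X. 1 / real n * criterion n (\<nu> \<theta>) X)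
              (\<integral>Z. phi (\<nu> \<theta>) (Z 0) (Z 1) \<partial>stationary_law (\<nu> \<theta>s))) \<and>
         (\<forall>U. openin (top_of_set \<Theta>) U \<and> U \<noteq> {} \<longrightarrow>
            integrable (stationary_law (\<nu> \<theta>s)) (\<lambda>Z. SUP \<theta>\<in>U. phi (\<nu> \<theta>) (Z 0) (Z 1)) \<and>
            tendsto_in_prob (annealed_law (\<nu> \<theta>s))
              (\<lambda>n X. 1 / real n * (\<Sum>x<n. SUP \<theta>\<in>U. phi (\<nu> \<theta>) (left_steps n X (int x + 1)) (left_steps n X (int x))))
              (\<integral>Z. (SUP \<theta>\<in>U. phi (\<nu> \<theta>) (Z 0) (Z 1)) \<partial>stationary_law (\<nu> \<theta>s)))"
proof -
  have "\<theta>s \<in> \<Theta>" using interior interior_subset by blast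
  then have s: "single_site (\<nu> \<theta>s)" "(\<integral>\<^sup>+w. ennreal (rho w 0) \<partial>env_law (\<nu> \<theta>s)) < 1"
    using marginals cond2 by auto
  \<comment> \<open>The linear lower bound at a single point \<open>\<theta>0\<close> of \<open>U\<close> controls the supremum, as \<open>phi\<close> is nonpositive.\<close>
  have *: "\<exists>C A B. \<forall>x y. \<bar>SUP \<theta>\<in>U. phi (\<nu> \<theta>) x y\<bar> \<le> C + A * real x + B * real y"
    if U: "U \<subseteq> \<Theta>" "\<theta>0 \<in> U" for U \<theta>0
  proof -
    have m: "single_site (\<nu> \<theta>)" if "\<theta> \<in> U" for \<theta> using that U marginals by auto
    obtain C A B where low: "\<And>x y. - (C + A * real x + B * real y) \<le> phi (\<nu> \<theta>0) x y"
      using phi_linear_growth[of "\<nu> \<theta>0"] U marginals cond1 cond5(1) by blast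
    have "\<bar>SUP \<theta>\<in>U. phi (\<nu> \<theta>) x y\<bar> \<le> C + A * real x + B * real y" for x y
    proof -
      have "phi (\<nu> \<theta>0) x y \<le> (SUP \<theta>\<in>U. phi (\<nu> \<theta>) x y)"
        using U(2) m by (intro cSUP_upper bdd_above_phi) auto
      moreover have "(SUP \<theta>\<in>U. phi (\<nu> \<theta>) x y) \<le> 0"
        using U(2) m by (intro cSUP_least) (auto intro: phi_nonpos)
      ultimately show ?thesis using low[of x y] by linarith
    qed
    then show ?thesis by blast
  qed
  show ?thesis
  proof (intro conjI ballI allI impI; (elim conjE)?)
    fix \<theta> assume \<theta>: "\<theta> \<in> \<Theta>"
    \<comment> \<open>A single parameter is the case of a singleton.\<close>
    obtain C A B where "\<And>x y. \<bar>phi (\<nu> \<theta>) x y\<bar> \<le> C + A * real x + B * real y"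
      using *[of "{\<theta>}" \<theta>] \<theta> by auto
    note r = additive_functional_tendsto_in_prob[where g="phi (\<nu> \<theta>)", OF s this]
    show "integrable (stationary_law (\<nu> \<theta>s)) (\<lambda>Z. phi (\<nu> \<theta>) (Z 0) (Z 1))" by (rule r(1))
    show "tendsto_in_prob (annealed_law (\<nu> \<theta>s)) (\<lambda>n X. 1 / real n * criterion n (\<nu> \<theta>) X)
        (\<integral>Z. phi (\<nu> \<theta>) (Z 0) (Z 1) \<partial>stationary_law (\<nu> \<theta>s))"
      unfolding criterion_def by (rule r(2))
  next
    fix U assume "openin (top_of_set \<Theta>) U" "U \<noteq> {}"
    then obtain \<theta>0 where U: "U \<subseteq> \<Theta>" "\<theta>0 \<in> U" using openin_imp_subset by blast
    obtain C A B where "\<And>x y. \<bar>SUP \<theta>\<in>U. phi (\<nu> \<theta>) x y\<bar> \<le> C + A * real x + B * real y"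
      using *[OF U] by blast
    note r = additive_functional_tendsto_in_prob[where g="\<lambda>x y. SUP \<theta>\<in>U. phi (\<nu> \<theta>) x y", OF s this]
    show "integrable (stationary_law (\<nu> \<theta>s)) (\<lambda>Z. SUP \<theta>\<in>U. phi (\<nu> \<theta>) (Z 0) (Z 1))" by (rule r(1))
    show "tendsto_in_prob (annealed_law (\<nu> \<theta>s))
        (\<lambda>n X. 1 / real n * (\<Sum>x<n. SUP \<theta>\<in>U. phi (\<nu> \<theta>) (left_steps n X (int x + 1)) (left_steps n X (int x))))
        (\<integral>Z. (SUP \<theta>\<in>U. phi (\<nu> \<theta>) (Z 0) (Z 1)) \<partial>stationary_law (\<nu> \<theta>s))" by (rule r(2))
  qed
qed

end
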